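(* Let $F$ be $\mathbb{R}$ or $\mathbb{C}$, $G_n=GL(n,F)$, $1\le d\le n$, and let $\pi\in\mathcal{M}^d_{HC}(G_n)$. Then 1. $D^d_{HC}(\pi)=E^d_{HC}(\pi)$ (i.e. the natural map $E^d_{HC}(\pi)\to D^d_{HC}(\pi)$ is an isomorphism). 2. $E^{d+1}_{HC}(\pi)=D^{d+1}_{HC}(\pi)=B^{d+1}_{HC}(\pi)=0$ (when $d+1\le n$).
   Context: $G_n$ is embedded in $G_m$, $m>n$, by $g\mapsto\mathrm{diag}(g,\mathrm{Id}_{m-n})$. Gothic letters denote complexified Lie algebras of real Lie groups. $P_n\subset G_n$ is the subgroup of matrices with last row $(0,\dots,0,1)$; $V_n\cong F^{n-1}$ is its unipotent radical, $P_n=G_{n-1}\ltimes V_n$. $\psi_n(x_1,\dots,x_{n-1})=\exp(\sqrt{-1}\pi\,\mathrm{Re}\,x_{n-1})$ is a character of $V_n$, and also denotes the corresponding character of $\mathfrak{v}_n$. For a $\mathfrak{p}_n$-module $\pi$: $\Phi(\pi)=|\det|^{-1/2}\otimes\pi/\mathrm{Span}\{\alpha v-\psi_n(\alpha)v: v\in\pi,\alpha\in\mathfrak{v}_n\}$ (a $\mathfrak{p}_{n-1}$-module); $\Psi(\pi)=\varprojlim_l\pi/\mathrm{Span}\{\beta v: v\in\pi,\beta\in(\mathfrak{v}_n)^{\otimes l}\}$ and $\Psi_0(\pi)=\pi/\mathfrak{v}_n\pi$ ($\mathfrak{g}_{n-1}$-modules). For $1\le k\le n$: $E^k(\pi)=\Phi^{k-1}(\pi)$,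 $D^k(\pi)=\Psi(E^k(\pi))$, $B^k(\pi)=\Psi_0(E^k(\pi))$. The subscript $HC$ denotes restriction to $\mathcal{M}_{HC}(G_n)$, the category of Harish-Chandra modules (finitely generated admissible $(\mathfrak{g}_n,K_n)$-modules, $K_n$ a maximal compact subgroup of $G_n$). For a $\mathfrak{g}$-module $\tau$, $\mathcal{V}(\tau)\subset\mathfrak{g}^*$ is the zero set of the ideal of $\mathrm{Sym}(\mathfrak{g})$ generated by symbols of elements of the annihilator of $\tau$ in $U(\mathfrak{g})$. For $F=\mathbb{R}$, $\mathfrak{g}_n^*$ is identified with complex $n\times n$ matrices and $\mathrm{depth}(\tau)$ is the smallest $d$ with $A^d=0$ for all $A\in\mathcal{V}(\tau)$; for $F=\mathbb{C}$, $\mathfrak{g}_n=\mathfrak{gl}(n,\mathbb{C})\oplus\mathfrak{gl}(n,\mathbb{C})$ and $\mathrm{depth}(\tau)$ is the smallest $d$ with $A^d=B^d=0$ for all $(A,B)\in\mathcal{V}(\tau)$. $\mathcal{M}^d_{HC}(G_n)$ is the subcategory of modules of depth at most $d$. *)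

theory Defs
  imports
    "HOL-Analysis.Function_Topology"
    "HOL-Library.Poly_Mapping"
    "HOL-Library.Extended_Nat"
    "HOL-Algebra.QuotRing"
    "Jordan_Normal_Form.Matrix"
begin

text \<open>
  The ground field is a set \<open>F\<close> of complex numbers, which will be either \<open>\<real>\<close> or \<open>UNIV\<close>;
  matrices over \<open>F\<close> are complex matrices with entries in \<open>F\<close>.
\<close>

section \<open>The groups\<close>

definition GL :: "complex set \<Rightarrow> nat \<Rightarrow> complex mat monoid" where
  "GL F n = \<lparr>carrier = {g \<in> carrier_mat n n. elements_mat g \<subseteq> F \<and> invertible_mat g},
             monoid.mult = (*), one = 1\<^sub>m n\<rparr>"

text \<open>Entries outside the index range are unspecified, hence the cut-off.\<close>

definition mat_topology :: "nat \<Rightarrow> complex mat topology" where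
  "mat_topology n = pullback_topology (carrier_mat n n)
     (\<lambda>A (i, j). if i < n \<and> j < n then A $$ (i, j) else 0) euclidean"

definition compact_subgroup :: "complex set \<Rightarrow> nat \<Rightarrow> complex mat set \<Rightarrow> bool" where
  "compact_subgroup F n K \<longleftrightarrow> subgroup K (GL F n) \<and> compactin (mat_topology n) K"

definition maximal_compact_subgroup :: "complex set \<Rightarrow> nat \<Rightarrow> complex mat set \<Rightarrow> bool" where
  "maximal_compact_subgroup F n K \<longleftrightarrow> compact_subgroup F n K \<and>
     (\<forall>K'. compact_subgroup F n K' \<and> K \<subseteq> K' \<longrightarrow> K' = K)"

definition mat_exp :: "nat \<Rightarrow> complex mat \<Rightarrow> complex mat" where
  "mat_exp n X = mat n n (\<lambda>(i, j). suminf (\<lambda>k. (X ^\<^sub>m k) $$ (i, j) / fact k))"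


section \<open>Real Lie algebras and their complexifications\<close>

definition gl :: "complex set \<Rightarrow> nat \<Rightarrow> complex mat set" where
  "gl F n = {X \<in> carrier_mat n n. elements_mat X \<subseteq> F}"

text \<open>Lie algebras of the mirabolic subgroup \<open>P\<^sub>n\<close> and of its unipotent radical \<open>V\<^sub>n\<close>.\<close>

definition mirabolic :: "complex set \<Rightarrow> nat \<Rightarrow> complex mat set" where
  "mirabolic F n = {X \<in> gl F n. \<forall>j<n. X $$ (n - 1, j) = 0}"

definition mirabolic_rad :: "complex set \<Rightarrow> nat \<Rightarrow> complex mat set" where
  "mirabolic_rad F n =
     {X \<in> mirabolic F n. \<forall>i<n. \<forall>j<n. j \<noteq> n - 1 \<longrightarrow> X $$ (i, j) = 0}"

definition lie_of_subgroup :: "complex set \<Rightarrow> nat \<Rightarrow> complex mat set \<Rightarrow> complex mat set" where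
  "lie_of_subgroup F n K = {Y \<in> gl F n. \<forall>t::real. mat_exp n (of_real t \<cdot>\<^sub>m Y) \<in> K}"

text \<open>
  The pair \<open>(X, Y)\<close> stands for \<open>X \<otimes> 1 + Y \<otimes> \<i>\<close>.  For \<open>F = UNIV\<close> this complex structure is
  different from multiplying the entries of the matrices by \<open>\<i>\<close>.
\<close>

type_synonym lie = "complex mat \<times> complex mat"

definition cplx :: "complex mat set \<Rightarrow> lie set" where
  "cplx L = L \<times> L"

fun lie_add :: "lie \<Rightarrow> lie \<Rightarrow> lie" where
  "lie_add (X, Y) (X', Y') = (X + X', Y + Y')"

fun lie_smult :: "complex \<Rightarrow> lie \<Rightarrow> lie" where
  "lie_smult c (X, Y) =
     (of_real (Re c) \<cdot>\<^sub>m X - of_real (Im c) \<cdot>\<^sub>m Y, of_real (Im c) \<cdot>\<^sub>m X + of_real (Re c) \<cdot>\<^sub>m Y)"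

definition commutator :: "complex mat \<Rightarrow> complex mat \<Rightarrow> complex mat" where
  "commutator X Y = X * Y - Y * X"

fun lie_bracket :: "lie \<Rightarrow> lie \<Rightarrow> lie" where
  "lie_bracket (X, Y) (X', Y') =
     (commutator X X' - commutator Y Y', commutator X Y' + commutator Y X')"

fun lie_Ad :: "complex set \<Rightarrow> nat \<Rightarrow> complex mat \<Rightarrow> lie \<Rightarrow> lie" where
  "lie_Ad F n k (X, Y) = (k * X * inv\<^bsub>GL F n\<^esub> k, k * Y * inv\<^bsub>GL F n\<^esub> k)"

text \<open>The differential of \<open>g \<mapsto> diag(g, 1)\<close>.\<close>

fun lie_embed :: "lie \<Rightarrow> lie" where
  "lie_embed (X, Y) = (diag_block_mat [X, 0\<^sub>m 1 1], diag_block_mat [Y, 0\<^sub>m 1 1])"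

text \<open>
  Complex linear extension of the differential of a character of the real group.
\<close>

definition cplx_ext :: "(complex mat \<Rightarrow> complex) \<Rightarrow> lie \<Rightarrow> complex" where
  "cplx_ext f z = f (fst z) + \<i> * f (snd z)"

text \<open>
  \<open>\<psi>\<^sub>n\<close> on the Lie algebra of \<open>V\<^sub>n\<close>: the coordinate \<open>x\<^bsub>n-1\<^esub>\<close> is the entry in row \<open>n - 1\<close> and
  column \<open>n\<close>, i.e. \<open>(n - 2, n - 1)\<close> when counting from 0.
\<close>

definition psi :: "nat \<Rightarrow> lie \<Rightarrow> complex" where
  "psi n = cplx_ext (\<lambda>X. \<i> * of_real (pi * Re (X $$ (n - 2, n - 1))))"

definition mat_trace :: "complex mat \<Rightarrow> complex" where
  "mat_trace A = (\<Sum>i<dim_row A. A $$ (i, i))"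

text \<open>The differential of \<open>\<bar>det\<bar>\<^bsup>-1/2\<^esup>\<close>, where the bars denote the usual absolute value on \<open>F\<close>.\<close>

definition det_twist :: "lie \<Rightarrow> complex" where
  "det_twist = cplx_ext (\<lambda>X. of_real (- (1/2) * Re (mat_trace X)))"


section \<open>Harish-Chandra modules\<close>

text \<open>
  Representations live on a complex vector space given by a type \<open>'v\<close> together with a scalar
  multiplication \<open>sm\<close>.
\<close>

definition finite_dim_in :: "(complex \<Rightarrow> 'v::ab_group_add \<Rightarrow> 'v) \<Rightarrow> 'v set \<Rightarrow> bool" where
  "finite_dim_in sm W \<longleftrightarrow> (\<exists>B. finite B \<and> W \<subseteq> module.span sm B)"

definition lie_module ::
  "lie set \<Rightarrow> (complex \<Rightarrow> 'v::ab_group_add \<Rightarrow> 'v) \<Rightarrow> (lie \<Rightarrow> 'v \<Rightarrow> 'v) \<Rightarrow> bool" where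
  "lie_module L sm \<rho> \<longleftrightarrow> vector_space sm \<and>
     (\<forall>x\<in>L. Vector_Spaces.linear sm sm (\<rho> x)) \<and>
     (\<forall>x\<in>L. \<forall>y\<in>L. \<forall>v. \<rho> (lie_add x y) v = \<rho> x v + \<rho> y v) \<and>
     (\<forall>c. \<forall>x\<in>L. \<forall>v. \<rho> (lie_smult c x) v = sm c (\<rho> x v)) \<and>
     (\<forall>x\<in>L. \<forall>y\<in>L. \<forall>v. \<rho> (lie_bracket x y) v = \<rho> x (\<rho> y v) - \<rho> y (\<rho> x v))"

text \<open>
  The space has no topology; as the action of \<open>K\<close> is locally finite, continuity and
  differentiability of orbit maps may be tested on all linear functionals.
\<close>

definition gK_module ::
  "complex set \<Rightarrow> nat \<Rightarrow> complex mat set \<Rightarrow> (complex \<Rightarrow> 'v::ab_group_add \<Rightarrow> 'v) \<Rightarrow>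
   (lie \<Rightarrow> 'v \<Rightarrow> 'v) \<Rightarrow> (complex mat \<Rightarrow> 'v \<Rightarrow> 'v) \<Rightarrow> bool" where
  "gK_module F n K sm \<rho> \<kappa> \<longleftrightarrow>
     lie_module (cplx (gl F n)) sm \<rho> \<and>
     (\<forall>k\<in>K. Vector_Spaces.linear sm sm (\<kappa> k)) \<and>
     (\<forall>v. \<kappa> (1\<^sub>m n) v = v) \<and>
     (\<forall>k\<in>K. \<forall>k'\<in>K. \<forall>v. \<kappa> (k * k') v = \<kappa> k (\<kappa> k' v)) \<and>
     (\<forall>v. finite_dim_in sm {\<kappa> k v | k. k \<in> K}) \<and>
     (\<forall>v \<xi>. Vector_Spaces.linear sm (*) \<xi> \<longrightarrow>
        continuous_map (subtopology (mat_topology n) K) euclidean (\<lambda>k. \<xi> (\<kappa> k v))) \<and>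
     (\<forall>k\<in>K. \<forall>x\<in>cplx (gl F n). \<forall>v. \<kappa> k (\<rho> x v) = \<rho> (lie_Ad F n k x) (\<kappa> k v)) \<and>
     (\<forall>Y\<in>lie_of_subgroup F n K. \<forall>v \<xi>. Vector_Spaces.linear sm (*) \<xi> \<longrightarrow>
        ((\<lambda>t::real. \<xi> (\<kappa> (mat_exp n (of_real t \<cdot>\<^sub>m Y)) v))
           has_vector_derivative \<xi> (\<rho> (Y, 0\<^sub>m n n) v)) (at 0))"

definition finitely_generated_gK ::
  "complex set \<Rightarrow> nat \<Rightarrow> complex mat set \<Rightarrow> (complex \<Rightarrow> 'v::ab_group_add \<Rightarrow> 'v) \<Rightarrow>
   (lie \<Rightarrow> 'v \<Rightarrow> 'v) \<Rightarrow> (complex mat \<Rightarrow> 'v \<Rightarrow> 'v) \<Rightarrow> bool" where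
  "finitely_generated_gK F n K sm \<rho> \<kappa> \<longleftrightarrow>
     (\<exists>S. finite S \<and>
        (\<forall>W. module.subspace sm W \<and> S \<subseteq> W \<and> (\<forall>x\<in>cplx (gl F n). \<rho> x ` W \<subseteq> W) \<and>
             (\<forall>k\<in>K. \<kappa> k ` W \<subseteq> W) \<longrightarrow> W = UNIV))"

definition K_submodule ::
  "complex mat set \<Rightarrow> (complex \<Rightarrow> 'v::ab_group_add \<Rightarrow> 'v) \<Rightarrow> (complex mat \<Rightarrow> 'v \<Rightarrow> 'v) \<Rightarrow>
   'v set \<Rightarrow> bool" where
  "K_submodule K sm \<kappa> W \<longleftrightarrow> module.subspace sm W \<and> (\<forall>k\<in>K. \<kappa> k ` W \<subseteq> W)"

definition K_irreducible ::
  "complex mat set \<Rightarrow> (complex \<Rightarrow> 'v::ab_group_add \<Rightarrow> 'v) \<Rightarrow> (complex mat \<Rightarrow> 'v \<Rightarrow> 'v) \<Rightarrow>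
   'v set \<Rightarrow> bool" where
  "K_irreducible K sm \<kappa> W \<longleftrightarrow> K_submodule K sm \<kappa> W \<and> W \<noteq> {0} \<and>
     (\<forall>W'. K_submodule K sm \<kappa> W' \<and> W' \<subseteq> W \<longrightarrow> W' = {0} \<or> W' = W)"

definition K_isomorphic ::
  "complex mat set \<Rightarrow> (complex \<Rightarrow> 'v::ab_group_add \<Rightarrow> 'v) \<Rightarrow> (complex mat \<Rightarrow> 'v \<Rightarrow> 'v) \<Rightarrow>
   'v set \<Rightarrow> 'v set \<Rightarrow> bool" where
  "K_isomorphic K sm \<kappa> W W' \<longleftrightarrow>
     (\<exists>T. Vector_Spaces.linear sm sm T \<and> bij_betw T W W' \<and>
          (\<forall>k\<in>K. \<forall>w\<in>W. T (\<kappa> k w) = \<kappa> k (T w)))"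

text \<open>Every \<open>K\<close>-type that occurs does so with a finite-dimensional isotypic component.\<close>

definition admissible ::
  "complex mat set \<Rightarrow> (complex \<Rightarrow> 'v::ab_group_add \<Rightarrow> 'v) \<Rightarrow> (complex mat \<Rightarrow> 'v \<Rightarrow> 'v) \<Rightarrow> bool" where
  "admissible K sm \<kappa> \<longleftrightarrow>
     (\<forall>W. K_irreducible K sm \<kappa> W \<longrightarrow>
        finite_dim_in sm (\<Union>{W'. K_submodule K sm \<kappa> W' \<and> K_isomorphic K sm \<kappa> W W'}))"

definition harish_chandra_module ::
  "complex set \<Rightarrow> nat \<Rightarrow> complex mat set \<Rightarrow> (complex \<Rightarrow> 'v::ab_group_add \<Rightarrow> 'v) \<Rightarrow>
   (lie \<Rightarrow> 'v \<Rightarrow> 'v) \<Rightarrow> (complex mat \<Rightarrow> 'v \<Rightarrow> 'v) \<Rightarrow> bool" where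
  "harish_chandra_module F n K sm \<rho> \<kappa> \<longleftrightarrow>
     gK_module F n K sm \<rho> \<kappa> \<and> finitely_generated_gK F n K sm \<rho> \<kappa> \<and> admissible K sm \<kappa>"


section \<open>Enveloping algebra, symbols and annihilator variety\<close>

text \<open>
  The free associative algebra on a set is the monoid algebra of the free monoid; the latter is
  written additively in order to use the multiplication of \<^typ>\<open>'a \<Rightarrow>\<^sub>0 'b\<close>.
\<close>

datatype 'a word = Word (letters: "'a list")

instantiation word :: (type) monoid_add
begin

definition zero_word :: "'a word" where "0 = Word []"

definition plus_word :: "'a word \<Rightarrow> 'a word \<Rightarrow> 'a word" where
  "v + w = Word (letters v @ letters w)"

instance by standard (auto simp: zero_word_def plus_word_def)

end

type_synonym 'a free_alg = "'a word \<Rightarrow>\<^sub>0 complex"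

definition gen :: "'a \<Rightarrow> 'a free_alg" where
  "gen x = Poly_Mapping.single (Word [x]) 1"

definition free_algebra :: "'a set \<Rightarrow> 'a free_alg ring" where
  "free_algebra L = \<lparr>carrier = {t. \<forall>w\<in>Poly_Mapping.keys t. set (letters w) \<subseteq> L},
     monoid.mult = (*), one = 1, zero = 0, add = (+)\<rparr>"

definition free_filtration :: "'a set \<Rightarrow> nat \<Rightarrow> 'a free_alg set" where
  "free_filtration L d =
     {t \<in> carrier (free_algebra L). \<forall>w\<in>Poly_Mapping.keys t. length (letters w) \<le> d}"

definition degree_part :: "nat \<Rightarrow> 'a free_alg \<Rightarrow> 'a free_alg" where
  "degree_part d t =
     (\<Sum>w\<in>{w \<in> Poly_Mapping.keys t. length (letters w) = d}.
        Poly_Mapping.single w (Poly_Mapping.lookup t w))"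

text \<open>Modulo these relations the free algebra on \<open>L\<close> is the tensor algebra of \<open>L\<close>.\<close>

definition linear_rels :: "lie set \<Rightarrow> lie free_alg set" where
  "linear_rels L =
     {gen (lie_add x y) - gen x - gen y | x y. x \<in> L \<and> y \<in> L} \<union>
     {gen (lie_smult c x) - Poly_Mapping.single 0 c * gen x | c x. x \<in> L}"

definition env_ideal :: "lie set \<Rightarrow> lie free_alg set" where
  "env_ideal L = Idl\<^bsub>free_algebra L\<^esub> (linear_rels L \<union>
     {gen x * gen y - gen y * gen x - gen (lie_bracket x y) | x y. x \<in> L \<and> y \<in> L})"

definition sym_ideal :: "lie set \<Rightarrow> lie free_alg set" where
  "sym_ideal L = Idl\<^bsub>free_algebra L\<^esub> (linear_rels L \<union>
     {gen x * gen y - gen y * gen x | x y. x \<in> L \<and> y \<in> L})"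

definition env_algebra :: "lie set \<Rightarrow> lie free_alg set ring" where
  "env_algebra L = free_algebra L Quot env_ideal L"

definition sym_algebra :: "lie set \<Rightarrow> lie free_alg set ring" where
  "sym_algebra L = free_algebra L Quot sym_ideal L"

definition env_class :: "lie set \<Rightarrow> lie free_alg \<Rightarrow> lie free_alg set" where
  "env_class L t = env_ideal L +>\<^bsub>free_algebra L\<^esub> t"

definition sym_class :: "lie set \<Rightarrow> lie free_alg \<Rightarrow> lie free_alg set" where
  "sym_class L t = sym_ideal L +>\<^bsub>free_algebra L\<^esub> t"

definition env_filtration :: "lie set \<Rightarrow> nat \<Rightarrow> lie free_alg set set" where
  "env_filtration L d = env_class L ` free_filtration L d"

text \<open>
  \<open>s\<close> is the symbol of \<open>u\<close>: if \<open>u\<close> has exact filtration degree \<open>d\<close>, then its image in the degree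
  \<open>d\<close> part of the associated graded algebra, identified with the \<open>d\<close>-th symmetric power, is the
  class of the degree \<open>d\<close> part of any representative of degree at most \<open>d\<close>
  (independence of the representative is the PBW theorem).  The symbol of \<open>0\<close> is \<open>0\<close>.
\<close>

definition is_symbol :: "lie set \<Rightarrow> lie free_alg set \<Rightarrow> lie free_alg set \<Rightarrow> bool" where
  "is_symbol L u s \<longleftrightarrow>
     (\<exists>d. \<exists>t \<in> free_filtration L d. u = env_class L t \<and>
        (\<forall>e<d. u \<notin> env_filtration L e) \<and> s = sym_class L (degree_part d t))"

definition free_act ::
  "(complex \<Rightarrow> 'v::ab_group_add \<Rightarrow> 'v) \<Rightarrow> (lie \<Rightarrow> 'v \<Rightarrow> 'v) \<Rightarrow> lie free_alg \<Rightarrow> 'v \<Rightarrow> 'v" where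
  "free_act sm \<rho> t v =
     (\<Sum>w\<in>Poly_Mapping.keys t. sm (Poly_Mapping.lookup t w) (foldr \<rho> (letters w) v))"

definition annihilator ::
  "lie set \<Rightarrow> (complex \<Rightarrow> 'v::ab_group_add \<Rightarrow> 'v) \<Rightarrow> (lie \<Rightarrow> 'v \<Rightarrow> 'v) \<Rightarrow> lie free_alg set set" where
  "annihilator L sm \<rho> = {u \<in> carrier (env_algebra L). \<forall>t\<in>u. \<forall>v. free_act sm \<rho> t v = 0}"

definition lie_dual :: "lie set \<Rightarrow> (lie \<Rightarrow> complex) set" where
  "lie_dual L = {\<xi> \<in> extensional L.
     (\<forall>x\<in>L. \<forall>y\<in>L. \<xi> (lie_add x y) = \<xi> x + \<xi> y) \<and> (\<forall>c. \<forall>x\<in>L. \<xi> (lie_smult c x) = c * \<xi> x)}"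

definition free_eval :: "(lie \<Rightarrow> complex) \<Rightarrow> lie free_alg \<Rightarrow> complex" where
  "free_eval \<xi> t =
     (\<Sum>w\<in>Poly_Mapping.keys t. Poly_Mapping.lookup t w * prod_list (map \<xi> (letters w)))"

definition annihilator_variety ::
  "lie set \<Rightarrow> (complex \<Rightarrow> 'v::ab_group_add \<Rightarrow> 'v) \<Rightarrow> (lie \<Rightarrow> 'v \<Rightarrow> 'v) \<Rightarrow> (lie \<Rightarrow> complex) set" where
  "annihilator_variety L sm \<rho> = {\<xi> \<in> lie_dual L.
     \<forall>s \<in> Idl\<^bsub>sym_algebra L\<^esub> {s. \<exists>u\<in>annihilator L sm \<rho>. is_symbol L u s}.
       \<forall>t\<in>s. free_eval \<xi> t = 0}"

text \<open>
  For \<open>F = \<real>\<close> the map \<open>proj_hol\<close> identifies the complexification of \<open>gl(n,\<real>)\<close> with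
  \<open>gl(n,\<complex>)\<close>; for \<open>F = UNIV\<close> the pair \<open>(proj_hol, proj_antihol)\<close> identifies the complexification
  of \<open>gl(n,\<complex>)\<close> with \<open>gl(n,\<complex>) \<oplus> gl(n,\<complex>)\<close>.  Dual spaces are identified through the trace form.
\<close>

definition proj_hol :: "lie \<Rightarrow> complex mat" where
  "proj_hol z = fst z + \<i> \<cdot>\<^sub>m snd z"

definition proj_antihol :: "lie \<Rightarrow> complex mat" where
  "proj_antihol z = map_mat cnj (fst z) + \<i> \<cdot>\<^sub>m map_mat cnj (snd z)"

definition nilpotent_functional :: "complex set \<Rightarrow> nat \<Rightarrow> nat \<Rightarrow> (lie \<Rightarrow> complex) \<Rightarrow> bool" where
  "nilpotent_functional F n d \<xi> \<longleftrightarrow>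
     (if F = \<real> then
        \<forall>A\<in>carrier_mat n n.
          (\<forall>z\<in>cplx (gl F n). \<xi> z = mat_trace (A * proj_hol z)) \<longrightarrow> A ^\<^sub>m d = 0\<^sub>m n n
      else
        \<forall>A\<in>carrier_mat n n. \<forall>B\<in>carrier_mat n n.
          (\<forall>z\<in>cplx (gl F n). \<xi> z = mat_trace (A * proj_hol z) + mat_trace (B * proj_antihol z)) \<longrightarrow>
          A ^\<^sub>m d = 0\<^sub>m n n \<and> B ^\<^sub>m d = 0\<^sub>m n n)"

text \<open>The value is \<open>\<infinity>\<close> if no power works.\<close>

definition depth ::
  "complex set \<Rightarrow> nat \<Rightarrow> (complex \<Rightarrow> 'v::ab_group_add \<Rightarrow> 'v) \<Rightarrow> (lie \<Rightarrow> 'v \<Rightarrow> 'v) \<Rightarrow> enat" where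
  "depth F n sm \<rho> = Inf (enat `
     {d. \<forall>\<xi> \<in> annihilator_variety (cplx (gl F n)) sm \<rho>. nilpotent_functional F n d \<xi>})"


section \<open>Derivatives\<close>

text \<open>
  All modules below are quotients of the given space, so they can be described by a subspace \<open>rels\<close>
  and an action \<open>act\<close> on the whole space preserving \<open>rels\<close>: the record stands for the module
  \<open>'v / rels\<close>.  This allows the functor \<open>\<Phi>\<close> to be iterated without changing the type.
\<close>

record 'v quot_pres =
  rels :: "'v set"
  act :: "lie \<Rightarrow> 'v \<Rightarrow> 'v"

record 'e lie_mod =
  mcarrier :: "'e set"
  mzero :: 'e
  madd :: "'e \<Rightarrow> 'e \<Rightarrow> 'e"
  msmult :: "complex \<Rightarrow> 'e \<Rightarrow> 'e"
  mact :: "lie \<Rightarrow> 'e \<Rightarrow> 'e"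

definition coset :: "'v::ab_group_add set \<Rightarrow> 'v \<Rightarrow> 'v set" where
  "coset N v = (+) v ` N"

definition quot_module ::
  "(complex \<Rightarrow> 'v::ab_group_add \<Rightarrow> 'v) \<Rightarrow> 'v quot_pres \<Rightarrow> 'v set lie_mod" where
  "quot_module sm M = \<lparr>
     mcarrier = range (coset (rels M)),
     mzero = rels M,
     madd = (\<lambda>A B. \<Union>a\<in>A. \<Union>b\<in>B. coset (rels M) (a + b)),
     msmult = (\<lambda>c A. \<Union>a\<in>A. coset (rels M) (sm c a)),
     mact = (\<lambda>x A. \<Union>a\<in>A. coset (rels M) (act M x a))\<rparr>"

definition zero_module :: "'e lie_mod \<Rightarrow> bool" where
  "zero_module M \<longleftrightarrow> mcarrier M = {mzero M}"

definition lie_mod_iso :: "lie set \<Rightarrow> 'e lie_mod \<Rightarrow> 'f lie_mod \<Rightarrow> ('e \<Rightarrow> 'f) \<Rightarrow> bool" where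
  "lie_mod_iso L M M' f \<longleftrightarrow> bij_betw f (mcarrier M) (mcarrier M') \<and>
     (\<forall>a\<in>mcarrier M. \<forall>b\<in>mcarrier M. f (madd M a b) = madd M' (f a) (f b)) \<and>
     (\<forall>c. \<forall>a\<in>mcarrier M. f (msmult M c a) = msmult M' c (f a)) \<and>
     (\<forall>x\<in>L. \<forall>a\<in>mcarrier M. f (mact M x a) = mact M' x (f a))"

text \<open>Restriction of a \<open>\<pp>\<^sub>m\<close>-module to \<open>\<gg>\<^bsub>m-1\<^esub>\<close>.\<close>

definition restrict_gl :: "'v quot_pres \<Rightarrow> 'v quot_pres" where
  "restrict_gl M = M\<lparr>act := \<lambda>x. act M (lie_embed x)\<rparr>"

text \<open>\<open>\<Phi>\<close> on \<open>\<pp>\<^sub>m\<close>-modules.\<close>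

definition Phi ::
  "complex set \<Rightarrow> (complex \<Rightarrow> 'v::ab_group_add \<Rightarrow> 'v) \<Rightarrow> nat \<Rightarrow> 'v quot_pres \<Rightarrow> 'v quot_pres" where
  "Phi F sm m M = \<lparr>
     rels = module.span sm (rels M \<union>
       {act M \<alpha> v - sm (psi m \<alpha>) v | \<alpha> v. \<alpha> \<in> cplx (mirabolic_rad F m)}),
     act = (\<lambda>x v. act M (lie_embed x) v + sm (det_twist x) v)\<rparr>"

text \<open>
  \<open>Psi_level F sm m M l\<close> is the quotient of a \<open>\<pp>\<^sub>m\<close>-module by the span of all \<open>\<beta> v\<close> with \<open>\<beta>\<close> an
  \<open>l\<close>-fold tensor over \<open>\<vv>\<^sub>m\<close>, as a \<open>\<gg>\<^bsub>m-1\<^esub>\<close>-module; pure tensors, i.e. lists of length \<open>l\<close>, suffice.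
\<close>

definition Psi_level ::
  "complex set \<Rightarrow> (complex \<Rightarrow> 'v::ab_group_add \<Rightarrow> 'v) \<Rightarrow> nat \<Rightarrow> 'v quot_pres \<Rightarrow> nat \<Rightarrow> 'v quot_pres" where
  "Psi_level F sm m M l = restrict_gl (M\<lparr>rels := module.span sm (rels M \<union>
     {foldr (act M) \<beta> v | \<beta> v. length \<beta> = l \<and> set \<beta> \<subseteq> cplx (mirabolic_rad F m)})\<rparr>)"

definition Psi0 ::
  "complex set \<Rightarrow> (complex \<Rightarrow> 'v::ab_group_add \<Rightarrow> 'v) \<Rightarrow> nat \<Rightarrow> 'v quot_pres \<Rightarrow> 'v quot_pres" where
  "Psi0 F sm m M = restrict_gl (M\<lparr>rels := module.span sm (rels M \<union>
     {act M \<alpha> v | \<alpha> v. \<alpha> \<in> cplx (mirabolic_rad F m)})\<rparr>)"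

text \<open>
  The projective limit: the transition map from level \<open>l + 1\<close> to level \<open>l\<close> sends a coset to the
  coset containing it.
\<close>

definition Psi ::
  "complex set \<Rightarrow> (complex \<Rightarrow> 'v::ab_group_add \<Rightarrow> 'v) \<Rightarrow> nat \<Rightarrow> 'v quot_pres \<Rightarrow>
   (nat \<Rightarrow> 'v set) lie_mod" where
  "Psi F sm m M = (let Q = (\<lambda>l. quot_module sm (Psi_level F sm m M l)) in \<lparr>
     mcarrier = {a. (\<forall>l. a l \<in> mcarrier (Q l)) \<and> (\<forall>l. a (Suc l) \<subseteq> a l)},
     mzero = (\<lambda>l. mzero (Q l)),
     madd = (\<lambda>a b l. madd (Q l) (a l) (b l)),
     msmult = (\<lambda>c a l. msmult (Q l) c (a l)),
     mact = (\<lambda>x a l. mact (Q l) x (a l))\<rparr>)"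

definition to_Psi ::
  "complex set \<Rightarrow> (complex \<Rightarrow> 'v::ab_group_add \<Rightarrow> 'v) \<Rightarrow> nat \<Rightarrow> 'v quot_pres \<Rightarrow>
   'v set \<Rightarrow> nat \<Rightarrow> 'v set" where
  "to_Psi F sm m M A = (\<lambda>l. \<Union>a\<in>A. coset (rels (Psi_level F sm m M l)) a)"

text \<open>
  Starting with a \<open>\<pp>\<^sub>n\<close>-module, the \<open>j\<close>-fold iterate of \<open>\<Phi>\<close> is a \<open>\<pp>\<^bsub>n-j\<^esub>\<close>-module.
\<close>

primrec Phi_iter ::
  "complex set \<Rightarrow> (complex \<Rightarrow> 'v::ab_group_add \<Rightarrow> 'v) \<Rightarrow> nat \<Rightarrow> nat \<Rightarrow> 'v quot_pres \<Rightarrow> 'v quot_pres" where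
  "Phi_iter F sm n 0 M = M"
| "Phi_iter F sm n (Suc j) M = Phi F sm (n - j) (Phi_iter F sm n j M)"

definition E_pres ::
  "complex set \<Rightarrow> nat \<Rightarrow> nat \<Rightarrow> (complex \<Rightarrow> 'v::ab_group_add \<Rightarrow> 'v) \<Rightarrow> (lie \<Rightarrow> 'v \<Rightarrow> 'v) \<Rightarrow>
   'v quot_pres" where
  "E_pres F n k sm \<rho> = Phi_iter F sm n (k - 1) \<lparr>rels = {0}, act = \<rho>\<rparr>"

text \<open>
  \<open>E_der\<close> is a \<open>\<pp>\<^bsub>n-k+1\<^esub>\<close>-module, the other derivatives are \<open>\<gg>\<^bsub>n-k\<^esub>\<close>-modules (for \<open>1 \<le> k \<le> n\<close>);
  \<open>E_der_gl\<close> is the restriction of \<open>E_der\<close> to \<open>\<gg>\<^bsub>n-k\<^esub>\<close>.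
\<close>

definition E_der ::
  "complex set \<Rightarrow> nat \<Rightarrow> nat \<Rightarrow> (complex \<Rightarrow> 'v::ab_group_add \<Rightarrow> 'v) \<Rightarrow> (lie \<Rightarrow> 'v \<Rightarrow> 'v) \<Rightarrow>
   'v set lie_mod" where
  "E_der F n k sm \<rho> = quot_module sm (E_pres F n k sm \<rho>)"

definition E_der_gl ::
  "complex set \<Rightarrow> nat \<Rightarrow> nat \<Rightarrow> (complex \<Rightarrow> 'v::ab_group_add \<Rightarrow> 'v) \<Rightarrow> (lie \<Rightarrow> 'v \<Rightarrow> 'v) \<Rightarrow>
   'v set lie_mod" where
  "E_der_gl F n k sm \<rho> = quot_module sm (restrict_gl (E_pres F n k sm \<rho>))"

definition D_der ::
  "complex set \<Rightarrow> nat \<Rightarrow> nat \<Rightarrow> (complex \<Rightarrow> 'v::ab_group_add \<Rightarrow> 'v) \<Rightarrow> (lie \<Rightarrow> 'v \<Rightarrow> 'v) \<Rightarrow>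
   (nat \<Rightarrow> 'v set) lie_mod" where
  "D_der F n k sm \<rho> = Psi F sm (n - k + 1) (E_pres F n k sm \<rho>)"

definition B_der ::
  "complex set \<Rightarrow> nat \<Rightarrow> nat \<Rightarrow> (complex \<Rightarrow> 'v::ab_group_add \<Rightarrow> 'v) \<Rightarrow> (lie \<Rightarrow> 'v \<Rightarrow> 'v) \<Rightarrow>
   'v set lie_mod" where
  "B_der F n k sm \<rho> = quot_module sm (Psi0 F sm (n - k + 1) (E_pres F n k sm \<rho>))"

definition E_to_D ::
  "complex set \<Rightarrow> nat \<Rightarrow> nat \<Rightarrow> (complex \<Rightarrow> 'v::ab_group_add \<Rightarrow> 'v) \<Rightarrow> (lie \<Rightarrow> 'v \<Rightarrow> 'v) \<Rightarrow>
   'v set \<Rightarrow> nat \<Rightarrow> 'v set" where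
  "E_to_D F n k sm \<rho> = to_Psi F sm (n - k + 1) (E_pres F n k sm \<rho>)"

end

theory Submission
  imports Defs "HOL-Analysis.Continuum_Not_Denumerable" "Jordan_Normal_Form.Char_Poly"
begin

text \<open>The relations of E^d form a subspace that is not stable under \<gg>. It contains the
  whole image of each operator of weight at least 2, so such a letter helps only where it is applied
  last. A commutator shortens a word and keeps its weight; the weight then exceeds the length, so
  another letter of weight at least 2 must occur. Hence the induction on the length.

  Functionals are matrices through the trace form, tr(A e_ij) = A_ji, which is why f sits in the
  last row of A^d. Give the index a (from 1) the height max(0, a - (n - d)), so that e_ab has weight
  height b - height a. A term of f is a path of d steps from the index n, of height d, to i, of
  height 0. A step of weight one descends by exactly one, so a single path remains once the end
  point i is prescribed.

  Over the complex field every matrix unit occurs in two commuting copies, told apart by a boolean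
  index, and f is formed for each copy separately. The result concerns one root vector of \<vv> at a
  time; as \<vv> is commutative, the pigeonhole principle extends it to long products of arbitrary
  elements.\<close>

text \<open>
  Only the annihilator of \<open>\<pi>\<close> matters.  Let \<open>f\<close> be the function \<open>A \<mapsto> (A^d)\<^bsub>n,i\<^esub>\<close> with \<open>i \<le> n - d\<close>.  It
  vanishes on the annihilator variety, so by the Nullstellensatz some \<open>f^k\<close> lies in the ideal of
  symbols and is therefore the symbol of some \<open>u\<close> of order at most \<open>dk\<close> annihilating \<open>\<pi>\<close>.  Grade
  \<open>\<gg>\<^sub>n\<close> such that the matrix entries \<open>e\<^bsub>i,n-d+1\<^esub>\<close> and \<open>e\<^bsub>j,j+1\<^esub>\<close> with \<open>j > n - d\<close> have weight \<open>1\<close>.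
  The annihilator is stable under the adjoint action, so \<open>u\<close> may be replaced by its component of
  weight \<open>dk\<close>.  A monomial of length at most \<open>dk\<close> and weight \<open>dk\<close> either consists of \<open>dk\<close> letters of
  weight \<open>1\<close>, or it contains a letter of weight at least \<open>2\<close>; such letters lie in the kernel of the
  character defining \<open>E^d\<close>, and moving one to the left produces only shorter monomials of the same
  weight.  Hence modulo the relations of \<open>E^d\<close> the operator \<open>u\<close> acts through the weight one part of
  \<open>f^k\<close>, which is the single monomial \<open>(e\<^bsub>i,n-d+1\<^esub> e\<^bsub>n-d+1,n-d+2\<^esub> \<dots> e\<^bsub>n-1,n\<^esub>)^k\<close>, that is, as a nonzero multiple
  of \<open>(e\<^bsub>i,n-d+1\<^esub>)^k\<close>.  So \<open>\<vv>\<^bsub>n-d+1\<^esub>\<close> acts nilpotently on \<open>E^d(\<pi>)\<close>: the system defining \<open>D^d\<close> becomes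
  stationary, and \<open>E^{d+1} = \<Phi>(E^d)\<close> vanishes because on it a nilpotent element acts by a nonzero
  scalar.
\<close>

section \<open>Linear extension from the basis of a monoid algebra\<close>

text \<open>Evaluation at a point, top symbols, homogeneous and weight parts, and the action of
  words on vectors are all instances, so they share additivity and one induction over
  monomials.\<close>

definition linear_ext ::
  "(complex \<Rightarrow> 'b \<Rightarrow> 'b) \<Rightarrow> ('a \<Rightarrow> 'b) \<Rightarrow> ('a \<Rightarrow>\<^sub>0 complex) \<Rightarrow> 'b::ab_group_add" where
  "linear_ext sm f t = (\<Sum>w\<in>Poly_Mapping.keys t. sm (Poly_Mapping.lookup t w) (f w))"

lemma poly_mapping_eq_sum_single:
  "t = (\<Sum>w\<in>Poly_Mapping.keys t. Poly_Mapping.single w (Poly_Mapping.lookup t w))"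
proof (rule poly_mapping_eqI)
  fix k
  have "(\<Sum>w\<in>Poly_Mapping.keys t. Poly_Mapping.lookup (Poly_Mapping.single w (Poly_Mapping.lookup t w)) k)
     = (\<Sum>w\<in>Poly_Mapping.keys t. if w = k then Poly_Mapping.lookup t k else 0)"
    by (rule sum.cong) (auto simp: lookup_single when_def)
  then show "Poly_Mapping.lookup t k = Poly_Mapping.lookup
      (\<Sum>w\<in>Poly_Mapping.keys t. Poly_Mapping.single w (Poly_Mapping.lookup t w)) k"
    by (auto simp: lookup_sum sum.delta in_keys_iff)
qed

lemma poly_mapping_single_induct [case_names zero add]:
  assumes "P 0" and "\<And>t w c. P t \<Longrightarrow> P (t + Poly_Mapping.single w c)"
  shows "P (t :: 'a \<Rightarrow>\<^sub>0 'b::comm_monoid_add)"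
proof -
  have "P (\<Sum>w\<in>A. Poly_Mapping.single w (c w))" if "finite A" for A and c :: "'a \<Rightarrow> 'b"
    using that
  proof induction
    case (insert x A)
    then show ?case using assms(2)[OF insert.IH] by (metis add.commute sum.insert)
  qed (simp add: assms(1))
  then show ?thesis by (metis finite_keys poly_mapping_eq_sum_single)
qed

locale linear_ext_target = vector_space sm for sm :: "complex \<Rightarrow> 'b::ab_group_add \<Rightarrow> 'b"
begin

abbreviation "lext \<equiv> linear_ext sm"

lemma linear_ext_superset:
  assumes "finite A" and "Poly_Mapping.keys t \<subseteq> A"
  shows "lext f t = (\<Sum>w\<in>A. sm (Poly_Mapping.lookup t w) (f w))"
  unfolding linear_ext_def using assms
  by (intro sum.mono_neutral_left) (auto simp: in_keys_iff)

lemma linear_ext_0 [simp]: "lext f 0 = 0"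
  by (simp add: linear_ext_def)

lemma linear_ext_single [simp]: "lext f (Poly_Mapping.single w c) = sm c (f w)"
  by (simp add: linear_ext_def)

lemma linear_ext_add: "lext f (s + t) = lext f s + lext f t"
proof -
  have "Poly_Mapping.keys (s + t) \<subseteq> Poly_Mapping.keys s \<union> Poly_Mapping.keys t"
    by (rule Poly_Mapping.keys_add)
  then show ?thesis
    by (simp add: linear_ext_superset[of "Poly_Mapping.keys s \<union> Poly_Mapping.keys t"]
        lookup_add scale_left_distrib sum.distrib)
qed

lemma linear_ext_sum: "lext f (sum g A) = (\<Sum>x\<in>A. lext f (g x))"
  by (induction A rule: infinite_finite_induct) (auto simp: linear_ext_add)

lemma linear_ext_diff: "lext f (s - t) = lext f s - lext f t"
  using linear_ext_add[of f "s - t" t] by simp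

lemma linear_ext_fun_add: "lext (\<lambda>w. f w + g w) t = lext f t + lext g t"
  by (simp add: linear_ext_def scale_right_distrib sum.distrib)

lemma linear_ext_cong:
  "(\<And>w. w \<in> Poly_Mapping.keys t \<Longrightarrow> f w = g w) \<Longrightarrow> lext f t = lext g t"
  by (simp add: linear_ext_def)

lemma linear_ext_linear:
  assumes "Vector_Spaces.linear sm sm' h"
  shows "h (lext f t) = linear_ext sm' (\<lambda>w. h (f w)) t"
proof -
  interpret l: Vector_Spaces.linear sm sm' h by fact
  show ?thesis by (simp add: linear_ext_def l.sum l.scale)
qed

lemma linear_ext_in_subspace:
  assumes "subspace R" and "\<And>w. w \<in> Poly_Mapping.keys t \<Longrightarrow> f w \<in> R"
  shows "lext f t \<in> R"
  unfolding linear_ext_def using assms by (intro subspace_sum subspace_scale) auto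

end

text \<open>Polynomials are elements of the monoid algebra of the free commutative monoid.\<close>

type_synonym 'i polyn = "'i multiset \<Rightarrow>\<^sub>0 complex"

abbreviation pscale :: "complex \<Rightarrow> ('a::monoid_add \<Rightarrow>\<^sub>0 complex) \<Rightarrow> ('a \<Rightarrow>\<^sub>0 complex)" where
  "pscale c p \<equiv> Poly_Mapping.single 0 c * p"

lemma vector_space_pscale: "vector_space pscale"
  by standard (auto simp: algebra_simps single_add mult_single simp flip: mult.assoc)

lemma vector_space_complex: "vector_space ((*) :: complex \<Rightarrow> complex \<Rightarrow> complex)"
  by standard (auto simp: algebra_simps)

lemma linear_ext_mult:
  fixes s t :: "'a::monoid_add \<Rightarrow>\<^sub>0 complex" and f :: "'a \<Rightarrow> 'b::ring_1"
  assumes "vector_space sm"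
    and "\<And>c x y. sm c x * y = sm c (x * y)" and "\<And>c x y. x * sm c y = sm c (x * y)"
    and f: "\<And>u v. f (u + v) = f u * f v"
  shows "linear_ext sm f (s * t) = linear_ext sm f s * linear_ext sm f t"
proof -
  interpret linear_ext_target sm using assms by (simp add: linear_ext_target_def)
  show ?thesis
  proof (induction s rule: poly_mapping_single_induct)
    case (add s w c)
    have "lext f (Poly_Mapping.single w c * t) = lext f (Poly_Mapping.single w c) * lext f t"
      by (induction t rule: poly_mapping_single_induct)
        (auto simp: linear_ext_add distrib_left mult_single assms f)
    then show ?case using add by (simp add: linear_ext_add distrib_right)
  qed simp
qed

definition poly_eval :: "('i \<Rightarrow> complex) \<Rightarrow> 'i polyn \<Rightarrow> complex" where
  "poly_eval x = linear_ext (*) (\<lambda>m. prod_mset (image_mset x m))"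

interpretation poly_eval: linear_ext_target "(*) :: complex \<Rightarrow> complex \<Rightarrow> complex"
  by (simp add: linear_ext_target_def vector_space_complex)

interpretation polyn_ext: linear_ext_target "pscale :: complex \<Rightarrow> ('a::monoid_add \<Rightarrow>\<^sub>0 complex) \<Rightarrow> ('a \<Rightarrow>\<^sub>0 complex)"
  by (simp add: linear_ext_target_def vector_space_pscale)

lemma poly_eval_simps [simp]:
  "poly_eval x 0 = 0" "poly_eval x 1 = 1" "poly_eval x (p + q) = poly_eval x p + poly_eval x q"
  "poly_eval x (p - q) = poly_eval x p - poly_eval x q"
  "poly_eval x (p * q) = poly_eval x p * poly_eval x q"
  "poly_eval x (sum g A) = (\<Sum>i\<in>A. poly_eval x (g i))"
  "poly_eval x (Poly_Mapping.single m c) = c * prod_mset (image_mset x m)"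
  "poly_eval x (p ^ k) = poly_eval x p ^ k"
proof -
  show m: "poly_eval x (p * q) = poly_eval x p * poly_eval x q" for p q
    unfolding poly_eval_def by (intro linear_ext_mult) (auto simp: vector_space_complex)
  show "poly_eval x (p ^ k) = poly_eval x p ^ k"
    by (induction k) (auto simp: m, simp add: poly_eval_def flip: single_one)
qed (auto simp: poly_eval_def poly_eval.linear_ext_add poly_eval.linear_ext_diff
    poly_eval.linear_ext_sum simp flip: single_one)

section \<open>Nullstellensatz\<close>

definition pideal :: "'a::comm_ring_1 set \<Rightarrow> bool" where
  "pideal J \<longleftrightarrow> 0 \<in> J \<and> (\<forall>x\<in>J. \<forall>y\<in>J. x + y \<in> J) \<and> (\<forall>x. \<forall>y\<in>J. x * y \<in> J)"

lemma pidealD: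
  assumes "pideal J"
  shows "0 \<in> J" "x \<in> J \<Longrightarrow> y \<in> J \<Longrightarrow> x + y \<in> J" "y \<in> J \<Longrightarrow> x * y \<in> J" "y \<in> J \<Longrightarrow> y * x \<in> J"
    "x \<in> J \<Longrightarrow> y \<in> J \<Longrightarrow> x - y \<in> J" "(\<And>i. i \<in> A \<Longrightarrow> h i \<in> J) \<Longrightarrow> sum h A \<in> J"
proof -
  show 1: "0 \<in> J" and 2: "\<And>x y. x \<in> J \<Longrightarrow> y \<in> J \<Longrightarrow> x + y \<in> J" and 3: "\<And>x y. y \<in> J \<Longrightarrow> x * y \<in> J"
    using assms by (auto simp: pideal_def)
  show "y * x \<in> J" if "y \<in> J" using 3[OF that] by (simp add: mult.commute)
  show "x - y \<in> J" if "x \<in> J" "y \<in> J" using 2[OF that(1) 3[OF that(2), of "-1"]] by simp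
  show "sum h A \<in> J" if "\<And>i. i \<in> A \<Longrightarrow> h i \<in> J"
    using that by (induction A rule: infinite_finite_induct) (auto simp: 1 2)
qed

text \<open>Such an \<open>M\<close> is the trace of a maximal ideal of the localisation at
  \<open>f\<close>: the last clause says that everything outside \<open>M\<close> becomes a unit
  modulo \<open>M\<close> once \<open>f\<close> is inverted. This takes the place of the
  Rabinowitsch trick.\<close>

lemma ex_maximal_ideal_avoiding_powers:
  fixes f :: "'a::comm_ring_1"
  assumes "pideal J" and "\<And>k. f ^ k \<notin> J"
  shows "\<exists>M. pideal M \<and> J \<subseteq> M \<and> (\<forall>k. f ^ k \<notin> M) \<and>
    (\<forall>x. x \<notin> M \<longrightarrow> (\<exists>q k. \<exists>y\<in>M. f ^ k = y + q * x))"
proof -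
  define C where "C = {I. pideal I \<and> J \<subseteq> I \<and> (\<forall>k. f ^ k \<notin> I)}"
  have "\<exists>M\<in>C. \<forall>X\<in>C. M \<subseteq> X \<longrightarrow> X = M"
  proof (rule subset_Zorn_nonempty)
    show "C \<noteq> {}" using assms by (auto simp: C_def)
    fix \<C> assume C: "\<C> \<noteq> {}" "subset.chain C \<C>"
    have sub: "I \<in> C" if "I \<in> \<C>" for I using C that by (auto simp: subset_chain_def)
    have tot: "I \<subseteq> I' \<or> I' \<subseteq> I" if "I \<in> \<C>" "I' \<in> \<C>" for I I'
      using C that by (auto simp: subset_chain_def)
    have "x + y \<in> \<Union>\<C>" if "x \<in> I" "I \<in> \<C>" "y \<in> I'" "I' \<in> \<C>" for x y I I'
    proof -
      from tot[OF that(2,4)] have "\<exists>I''\<in>\<C>. x \<in> I'' \<and> y \<in> I''" using that by blast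
      then obtain I'' where "I'' \<in> \<C>" "x \<in> I''" "y \<in> I''" by blast
      then show ?thesis using sub[of I''] by (auto simp: C_def intro: pidealD)
    qed
    moreover have "x * y \<in> \<Union>\<C>" if "y \<in> I" "I \<in> \<C>" for x y I
      using that sub[of I] by (auto simp: C_def intro: pidealD)
    moreover obtain I0 where "I0 \<in> \<C>" using C by auto
    ultimately have "pideal (\<Union>\<C>)"
      using sub[of I0] by (auto simp: pideal_def C_def)
    then show "\<Union>\<C> \<in> C" using C sub unfolding C_def by auto
  qed
  then obtain M where M: "M \<in> C" "\<And>X. X \<in> C \<Longrightarrow> M \<subseteq> X \<Longrightarrow> X = M" by blast
  have idM: "pideal M" using M by (auto simp: C_def)
  have "\<exists>q k. \<exists>y\<in>M. f ^ k = y + q * x" if "x \<notin> M" for x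
  proof (rule ccontr)
    assume no: "\<not> ?thesis"
    define X where "X = {y + q * x | y q. y \<in> M}"
    have "pideal X" unfolding pideal_def
    proof (intro conjI ballI allI)
      show "0 \<in> X" unfolding X_def using pidealD(1)[OF idM] by (intro CollectI exI[of _ 0]) auto
      fix a assume "a \<in> X"
      then obtain y q where a: "a = y + q * x" "y \<in> M" by (auto simp: X_def)
      show "b * a \<in> X" for b unfolding X_def a
        using pidealD(3)[OF idM a(2), of b]
        by (intro CollectI exI[of _ "b * y"] exI[of _ "b * q"]) (auto simp: algebra_simps)
      fix b assume "b \<in> X"
      then obtain y' q' where b: "b = y' + q' * x" "y' \<in> M" by (auto simp: X_def)
      show "a + b \<in> X" unfolding X_def a b
        using pidealD(2)[OF idM a(2) b(2)]
        by (intro CollectI exI[of _ "y + y'"] exI[of _ "q + q'"]) (auto simp: algebra_simps)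
    qed
    moreover have MX: "M \<subseteq> X"
  proof
    fix y assume "y \<in> M"
    then show "y \<in> X" unfolding X_def by (intro CollectI exI[of _ y] exI[of _ 0]) auto
  qed
    moreover have "x \<in> X" unfolding X_def using pidealD(1)[OF idM]
      by (intro CollectI exI[of _ 0] exI[of _ 1]) auto
    moreover have "\<forall>k. f ^ k \<notin> X" using no unfolding X_def by blast
    ultimately have "X \<in> C" using M(1) by (auto simp: C_def)
    with M(2) MX \<open>x \<in> X\<close> that show False by blast
  qed
  with idM M(1) show ?thesis unfolding C_def by blast
qed

lemma prime_if_maximal_avoiding_powers:
  fixes f :: "'a::comm_ring_1"
  assumes M: "pideal M" "\<And>k. f ^ k \<notin> M"
    and max: "\<And>x. x \<notin> M \<Longrightarrow> \<exists>q k. \<exists>y\<in>M. f ^ k = y + q * x"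
    and xy: "x * y \<in> M"
  shows "x \<in> M \<or> y \<in> M"
proof (rule ccontr)
  assume "\<not> ?thesis"
  then obtain q k a q' k' a' where *: "a \<in> M" "f ^ k = a + q * x" "a' \<in> M" "f ^ k' = a' + q' * y"
    using max by meson
  have "f ^ (k + k') = a * (f ^ k') + a' * (q * x) + (q * q') * (x * y)"
    by (simp add: power_add *(2) *(4) algebra_simps)
  also have "\<dots> \<in> M" by (intro pidealD(2)[OF M(1)] pidealD(3,4)[OF M(1)] * xy)
  finally show False using M by simp
qed

abbreviation pconst :: "complex \<Rightarrow> 'i polyn" where "pconst \<equiv> Poly_Mapping.single 0"

lemma pconst_hom: "comm_ring_hom (pconst :: complex \<Rightarrow> 'i polyn)"
  by standard (auto simp: single_add mult_single)

text \<open>The complex polynomial \<open>g\<close> splits into linear factors, and primeness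
  selects one of them. An algebraic element of the residue ring is therefore a constant.\<close>

lemma factor_in_prime:
  fixes p :: "'i polyn" and g :: "complex poly"
  assumes M: "pideal M" and prime: "\<And>x y. x * y \<in> M \<Longrightarrow> x \<in> M \<or> y \<in> M" and "1 \<notin> M"
    and "poly (map_poly pconst g) p \<in> M" and "g \<noteq> 0"
  shows "\<exists>r. p - pconst r \<in> M"
  using assms(4,5)
proof (induction "degree g" arbitrary: g)
  case 0
  then obtain c where g: "g = [:c:]" "c \<noteq> 0" by (metis degree_eq_zeroE pCons_0_0)
  with 0 have "pconst c \<in> M" by simp
  from pidealD(3)[OF M this, of "pconst (inverse c)"] g \<open>1 \<notin> M\<close> show ?case
    by (simp add: mult_single)
next
  case (Suc n)
  interpret c: comm_ring_hom "pconst :: complex \<Rightarrow> 'i polyn" by (rule pconst_hom)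
  interpret mp: map_poly_comm_ring_hom "pconst :: complex \<Rightarrow> 'i polyn" ..
  have "\<not> constant (poly g)" using Suc by (simp add: constant_degree)
  then obtain r where "poly g r = 0" using fundamental_theorem_of_algebra by blast
  then obtain h where h: "g = [:-r, 1:] * h" by (auto simp: poly_eq_0_iff_dvd elim: dvdE)
  with Suc have h0: "h \<noteq> 0" by auto
  have "poly (map_poly pconst g) p = (p - pconst r) * poly (map_poly pconst h) p"
    unfolding h mp.hom_mult by (simp add: single_uminus left_diff_distrib)
  with Suc.prems prime have "p - pconst r \<in> M \<or> poly (map_poly pconst h) p \<in> M" by metis
  moreover have "n = degree h" using Suc(2) h0 unfolding h by (subst (asm) degree_mult_eq) auto
  ultimately show ?case using Suc.hyps(1) h0 by blast
qed

text \<open>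
  The residue ring is spanned by countably many monomials, while the elements \<open>1 / (p - c)\<close>
  with \<open>c\<close> complex would be linearly independent if \<open>p\<close> were not congruent to a constant.
\<close>

lemma congruent_const_mod_maximal:
  fixes f p :: "'i::countable polyn"
  assumes M: "pideal M" "\<And>k. f ^ k \<notin> M"
    and max: "\<And>x. x \<notin> M \<Longrightarrow> \<exists>q k. \<exists>y\<in>M. f ^ k = y + q * x"
  shows "\<exists>r. p - pconst r \<in> M"
proof (rule ccontr)
  assume no: "\<not> ?thesis"
  note prime = prime_if_maximal_avoiding_powers[OF M max]
  have one: "1 \<notin> M" using M(2)[of 0] by simp
  \<comment> \<open>In the localised residue ring \<open>q c / f ^ k c\<close> is the inverse of
    \<open>p - c\<close>.\<close>
  have "\<forall>c. \<exists>q k. \<exists>y\<in>M. f ^ k = y + q * (p - pconst c)" using max no by blast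
  then obtain q k y where qk: "\<And>c. y c \<in> M" "\<And>c. f ^ k c = y c + q c * (p - pconst c)" by metis
  have "countable (range (mset :: 'i list \<Rightarrow> _))" by simp
  moreover have "range (mset :: 'i list \<Rightarrow> _) = UNIV" by (metis ex_mset surj_def)
  ultimately have "countable (UNIV :: 'i multiset set)" by simp
  then obtain e :: "'i multiset \<Rightarrow> nat" where e: "inj e" by (auto simp: countable_def)
  \<comment> \<open>A bound for the codes of the monomials in \<open>q c\<close>; a fixed bound
    confines \<open>q c\<close> to a finite-dimensional space.\<close>
  define N where "N c = Max (insert 0 (e ` Poly_Mapping.keys (q c)))" for c
  have N: "e m \<le> N c" if "m \<in> Poly_Mapping.keys (q c)" for m c
    unfolding N_def using that by (intro Max_ge) auto
  \<comment> \<open>Uncountably many constants are distributed over countably many pairs of exponent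
    and bound.\<close>
  have "\<exists>kn. infinite ((\<lambda>c. (k c, N c)) -` {kn})"
  proof (rule ccontr)
    assume "\<not> ?thesis"
    then have "countable (\<Union>kn. (\<lambda>c. (k c, N c)) -` {kn})"
      by (intro countable_UN) (auto simp: countable_finite)
    moreover have "(\<Union>kn. (\<lambda>c. (k c, N c)) -` {kn}) = (UNIV :: complex set)" by auto
    ultimately have "countable (UNIV :: complex set)" by simp
    then have "countable (Re ` UNIV)" by (rule countable_image)
    moreover have "Re ` UNIV = UNIV" by (metis Re_complex_of_real surj_def)
    ultimately show False using uncountable_UNIV_real by simp
  qed
  then obtain k0 N0 where inf: "infinite {c. k c = k0 \<and> N c = N0}" by (auto simp: vimage_def)
  define B where "B = {c. k c = k0 \<and> N c = N0}"
  have inj: "inj_on q B"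
  proof (rule inj_onI)
    fix c c' assume c: "c \<in> B" "c' \<in> B" "q c = q c'"
    show "c = c'"
    proof (rule ccontr)
      assume ne: "c \<noteq> c'"
      have "y c - y c' = q c * (pconst c - pconst c')"
      proof -
        have "y c + q c * (p - pconst c) = y c' + q c * (p - pconst c')"
          using qk(2)[of c] qk(2)[of c'] c by (simp add: B_def)
        then show ?thesis by (simp add: algebra_simps)
      qed
      also have "\<dots> = q c * pconst (c - c')" by (simp add: single_diff)
      finally have "q c * pconst (c - c') \<in> M" using pidealD(5)[OF M(1) qk(1) qk(1)] by metis
      from pidealD(4)[OF M(1) this, of "pconst (inverse (c - c'))"]
      have "q c \<in> M" using ne by (simp add: mult.assoc mult_single)
      then have "f ^ k c \<in> M" unfolding qk(2) by (intro pidealD(2)[OF M(1)] pidealD(4)[OF M(1)] qk)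
      then show False using M by simp
    qed
  qed
  define mons :: "'i polyn set" where "mons = (\<lambda>m. Poly_Mapping.single m 1) ` (e -` {..N0})"
  have "finite mons" unfolding mons_def by (intro finite_imageI finite_vimageI) (auto simp: e)
  have "q ` B \<subseteq> polyn_ext.span mons"
  proof safe
    fix c assume "c \<in> B"
    then have "m \<in> e -` {..N0}" if "m \<in> Poly_Mapping.keys (q c)" for m
      using N[OF that] by (auto simp: B_def)
    then have "pscale (Poly_Mapping.lookup (q c) m) (Poly_Mapping.single m 1) \<in> polyn_ext.span mons"
      if "m \<in> Poly_Mapping.keys (q c)" for m
      using that by (intro polyn_ext.span_scale polyn_ext.span_base) (auto simp: mons_def)
    then have "(\<Sum>m\<in>Poly_Mapping.keys (q c).
        pscale (Poly_Mapping.lookup (q c) m) (Poly_Mapping.single m 1)) \<in> polyn_ext.span mons"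
      by (intro polyn_ext.span_sum) auto
    then show "q c \<in> polyn_ext.span mons"
      by (subst poly_mapping_eq_sum_single) (simp add: mult_single)
  qed
  moreover have "infinite (q ` B)" using inf inj by (simp add: B_def finite_image_iff)
  ultimately have "polyn_ext.dependent (q ` B)"
    using polyn_ext.independent_span_bound[OF \<open>finite mons\<close>] by blast
  then obtain t u v where t: "finite t" "t \<subseteq> q ` B" "(\<Sum>v\<in>t. pscale (u v) v) = 0" "v \<in> t" "u v \<noteq> 0"
    unfolding polyn_ext.dependent_explicit by blast
  then obtain S where S: "S \<subseteq> B" "finite S" "t = q ` S" using finite_subset_image[OF t(1,2)] by blast
  have injS: "inj_on q S" using inj S by (meson inj_on_subset)
  define a where "a c = u (q c)" for c
  have sum0: "(\<Sum>c\<in>S. pscale (a c) (q c)) = 0"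
    using t(3) by (simp add: S(3) sum.reindex injS a_def)
  obtain c0 where c0: "c0 \<in> S" "a c0 \<noteq> 0" using t S by (auto simp: a_def)
  \<comment> \<open>The numerator of the sum of the fractions \<open>a c / (X - c)\<close> over the
    common denominator. At \<open>c0\<close> only one summand survives, so \<open>g\<close> is not
    zero.\<close>
  define g :: "complex poly" where
    "g = (\<Sum>c\<in>S. Polynomial.smult (a c) (\<Prod>c'\<in>S - {c}. [:- c', 1:]))"
  have "poly g c0 = (\<Sum>c\<in>S. if c = c0 then a c0 * (\<Prod>c'\<in>S - {c0}. c0 - c') else 0)"
    unfolding g_def poly_sum using S(2) c0 by (intro sum.cong) (auto simp: poly_prod)
  also have "\<dots> = a c0 * (\<Prod>c'\<in>S - {c0}. c0 - c')" using S(2) c0 by simp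
  also have "\<dots> \<noteq> 0" using c0 S(2) by auto
  finally have g0: "g \<noteq> 0" by auto
  interpret c: comm_ring_hom "pconst :: complex \<Rightarrow> 'i polyn" by (rule pconst_hom)
  interpret mp: map_poly_comm_ring_hom "pconst :: complex \<Rightarrow> 'i polyn" ..
  have gp: "poly (map_poly pconst g) p = (\<Sum>c\<in>S. pconst (a c) * (\<Prod>c'\<in>S - {c}. p - pconst c'))"
    unfolding g_def mp.hom_sum poly_sum
    by (intro sum.cong refl) (simp add: c.map_poly_hom_smult mp.hom_prod poly_prod single_uminus)
  have ring_id: "A * ((Y + Q * Z) * R) = A * (Y * R) + A * Q * (Z * R)" for A Y Q Z R :: "'i polyn"
    by (simp add: algebra_simps)
  \<comment> \<open>Replacing \<open>f ^ k0\<close> by \<open>q c * (p - c)\<close> modulo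
    \<open>M\<close> turns every summand into \<open>a c * q c\<close> times the full product, and
    the coefficients add up to zero by linear dependence.\<close>
  have "f ^ k0 * poly (map_poly pconst g) p =
     (\<Sum>c\<in>S. pconst (a c) * ((f ^ k0) * (\<Prod>c'\<in>S - {c}. p - pconst c')))"
    unfolding gp by (simp add: sum_distrib_left mult.left_commute)
  also have "\<dots> = (\<Sum>c\<in>S. pconst (a c) * (y c * (\<Prod>c'\<in>S - {c}. p - pconst c')) +
      pscale (a c) (q c) * (\<Prod>c'\<in>S. p - pconst c'))"
  proof (intro sum.cong refl)
    fix c assume c: "c \<in> S"
    then have "(\<Prod>c'\<in>S. p - pconst c') = (p - pconst c) * (\<Prod>c'\<in>S - {c}. p - pconst c')"
      using S(2) by (simp add: prod.remove)
    moreover have "f ^ k0 = y c + q c * (p - pconst c)" using c S qk(2)[of c] by (auto simp: B_def)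
    ultimately show "pconst (a c) * (f ^ k0 * (\<Prod>c'\<in>S - {c}. p - pconst c')) =
      pconst (a c) * (y c * (\<Prod>c'\<in>S - {c}. p - pconst c')) +
      pscale (a c) (q c) * (\<Prod>c'\<in>S. p - pconst c')"
      by (simp only: ring_id)
  qed
  also have "\<dots> = (\<Sum>c\<in>S. pconst (a c) * (y c * (\<Prod>c'\<in>S - {c}. p - pconst c')))"
    using sum0 by (simp add: sum.distrib flip: sum_distrib_right)
  also have "\<dots> \<in> M"
    by (intro pidealD(6)[OF M(1)] pidealD(3)[OF M(1)] pidealD(4)[OF M(1)] qk)
  finally have "poly (map_poly pconst g) p \<in> M" using prime M(2) by blast
  from factor_in_prime[OF M(1) prime one this g0] no show False by blast
qed

lemma poly_eval_congruent:
  fixes p :: "'i polyn"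
  assumes M: "pideal M" and x: "\<And>i. Poly_Mapping.single {#i#} 1 - pconst (x i) \<in> M"
  shows "p - pconst (poly_eval x p) \<in> M"
proof -
  have m: "Poly_Mapping.single m 1 - pconst (prod_mset (image_mset x m)) \<in> M" for m
  proof (induction m)
    case (add i m)
    have "Poly_Mapping.single (add_mset i m) 1 = Poly_Mapping.single {#i#} (1::complex) * Poly_Mapping.single m 1"
      by (simp add: mult_single)
    then have "Poly_Mapping.single (add_mset i m) 1 - pconst (prod_mset (image_mset x (add_mset i m))) =
       (Poly_Mapping.single {#i#} 1 - pconst (x i)) * Poly_Mapping.single m 1 +
       pconst (x i) * (Poly_Mapping.single m 1 - pconst (prod_mset (image_mset x m)))"
      by (simp add: algebra_simps mult_single)
    also have "\<dots> \<in> M" by (intro pidealD(2)[OF M] pidealD(3)[OF M add] pidealD(4)[OF M x])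
    finally show ?case .
  qed (simp add: pidealD(1)[OF M] flip: single_one)
  show ?thesis
  proof (induction p rule: poly_mapping_single_induct)
    case (add p w c)
    have "p + Poly_Mapping.single w c - pconst (poly_eval x (p + Poly_Mapping.single w c)) =
       (p - pconst (poly_eval x p)) +
       pconst c * (Poly_Mapping.single w 1 - pconst (prod_mset (image_mset x w)))"
      by (simp add: algebra_simps mult_single single_add)
    also have "\<dots> \<in> M" by (intro pidealD(2)[OF M add] pidealD(3)[OF M m])
    finally show ?case .
  qed (simp add: pidealD(1)[OF M])
qed

text \<open>The dimension \<open>n\<close> is a term and not a type, so the variables are indexed by
  an infinite countable type. Their countability against the uncountability of the complex numbers
  makes the residue field argument work.\<close>

theorem Nullstellensatz:
  fixes f :: "'i::countable polyn"
  assumes J: "pideal J"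
    and f: "\<And>x. (\<And>p. p \<in> J \<Longrightarrow> poly_eval x p = 0) \<Longrightarrow> poly_eval x f = 0"
  shows "\<exists>k. f ^ k \<in> J"
proof (rule ccontr)
  assume "\<nexists>k. f ^ k \<in> J"
  then have "\<And>k. f ^ k \<notin> J" by blast
  then obtain M where M: "pideal M" "J \<subseteq> M" "\<And>k. f ^ k \<notin> M"
    and max: "\<And>x. x \<notin> M \<Longrightarrow> \<exists>q k. \<exists>y\<in>M. f ^ k = y + q * x"
    using ex_maximal_ideal_avoiding_powers[OF J, of f] by auto
  have "\<forall>i. \<exists>r. Poly_Mapping.single {#i#} 1 - pconst r \<in> M"
    by (intro allI congruent_const_mod_maximal[OF M(1,3) max])
  then obtain x where x: "\<And>i. Poly_Mapping.single {#i#} 1 - pconst (x i) \<in> M" by metis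
  note cong = poly_eval_congruent[OF M(1) x]
  have one: "1 \<notin> M" using M(3)[of 0] by simp
  have "poly_eval x p = 0" if "p \<in> J" for p
  proof (rule ccontr)
    assume ne: "poly_eval x p \<noteq> 0"
    have "p - (p - pconst (poly_eval x p)) \<in> M" using that M(2) by (intro pidealD(5)[OF M(1) _ cong[of p]]) blast
    from pidealD(3)[OF M(1) this, of "pconst (inverse (poly_eval x p))"] one ne
    show False by (simp add: mult_single)
  qed
  from f[OF this] cong[of f] M(3)[of 1] show False by simp
qed

section \<open>Top symbols of relations between operators\<close>

lemma linear_compose_foldr:
  assumes "vector_space sm" and "\<And>i. i \<in> set ws \<Longrightarrow> Vector_Spaces.linear sm sm (T i)"
  shows "Vector_Spaces.linear sm sm (foldr T ws)"
  using assms(2)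
proof (induction ws)
  case Nil
  interpret vector_space sm by fact
  show ?case using linear_id by (simp add: id_def)
next
  case (Cons i ws)
  then have "Vector_Spaces.linear sm sm (T i \<circ> foldr T ws)"
    by (intro Vector_Spaces.linear_compose[of sm sm _ sm]) auto
  then show ?case by (simp add: comp_def)
qed

definition word_op ::
  "(complex \<Rightarrow> 'v::ab_group_add \<Rightarrow> 'v) \<Rightarrow> ('i \<Rightarrow> 'v \<Rightarrow> 'v) \<Rightarrow> 'i free_alg \<Rightarrow> 'v \<Rightarrow> 'v" where
  "word_op sm T t v = linear_ext sm (\<lambda>w. foldr T (letters w) v) t"

definition top_symbol :: "nat \<Rightarrow> 'i free_alg \<Rightarrow> 'i polyn" where
  "top_symbol D = linear_ext pscale
     (\<lambda>w. if length (letters w) = D then Poly_Mapping.single (mset (letters w)) 1 else 0)"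

text \<open>The degree \<open>D\<close> part of the associated graded ideal of the annihilator,
  written in the coordinates of a family of operators. A relation of order less than
  \<open>D\<close> contributes 0.\<close>

definition relation_symbols ::
  "(complex \<Rightarrow> 'v::ab_group_add \<Rightarrow> 'v) \<Rightarrow> ('i \<Rightarrow> 'v \<Rightarrow> 'v) \<Rightarrow> nat \<Rightarrow> 'i polyn set" where
  "relation_symbols sm T D = {top_symbol D t | t. (\<forall>w\<in>Poly_Mapping.keys t. length (letters w) \<le> D) \<and>
     (\<forall>v. word_op sm T t v = 0)}"

definition hom_part :: "nat \<Rightarrow> 'i polyn \<Rightarrow> 'i polyn" where
  "hom_part D = linear_ext pscale (\<lambda>m. if size m = D then Poly_Mapping.single m 1 else 0)"

text \<open>Graded by construction: each homogeneous part of a member is the symbol of one relation,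
  not merely a combination of multiples of symbols.\<close>

definition symbol_ideal ::
  "(complex \<Rightarrow> 'v::ab_group_add \<Rightarrow> 'v) \<Rightarrow> ('i \<Rightarrow> 'v \<Rightarrow> 'v) \<Rightarrow> 'i polyn set" where
  "symbol_ideal sm T = {p. \<forall>D. hom_part D p \<in> relation_symbols sm T D}"

lemma hom_part_simps [simp]:
  "hom_part D 0 = 0"
  "hom_part D (p + q) = hom_part D p + hom_part D q"
  "hom_part D (Poly_Mapping.single m c) = (if size m = D then Poly_Mapping.single m c else 0)"
  by (auto simp: hom_part_def polyn_ext.linear_ext_add mult_single)

lemma top_symbol_simps [simp]:
  "top_symbol D 0 = 0"
  "top_symbol D (s + t) = top_symbol D s + top_symbol D t"
  "top_symbol D (Poly_Mapping.single w c) =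
     (if length (letters w) = D then Poly_Mapping.single (mset (letters w)) c else 0)"
  by (auto simp: top_symbol_def polyn_ext.linear_ext_add mult_single)

lemma hom_part_single_mult:
  "hom_part D (Poly_Mapping.single m c * p) =
     (if size m \<le> D then Poly_Mapping.single m c * hom_part (D - size m) p else 0)"
  by (induction p rule: poly_mapping_single_induct) (auto simp: mult_single distrib_left)

lemma letters_simps [simp]: "letters 0 = []" "letters (u + w) = letters u @ letters w"
  by (auto simp: zero_word_def plus_word_def)

lemma keys_single_mult:
  fixes t :: "'a::monoid_add \<Rightarrow>\<^sub>0 complex"
  shows "Poly_Mapping.keys (Poly_Mapping.single u c * t) \<subseteq> (+) u ` Poly_Mapping.keys t"
  using keys_mult[of "Poly_Mapping.single u c" t] by (auto split: if_splits)

lemma top_symbol_single_mult: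
  "top_symbol D (Poly_Mapping.single u c * t) = (if length (letters u) \<le> D
     then Poly_Mapping.single (mset (letters u)) c * top_symbol (D - length (letters u)) t else 0)"
  by (induction t rule: poly_mapping_single_induct) (auto simp: mult_single distrib_left)

locale linear_operators =
  fixes sm :: "complex \<Rightarrow> 'v::ab_group_add \<Rightarrow> 'v" and T :: "'i \<Rightarrow> 'v \<Rightarrow> 'v"
  assumes vs: "vector_space sm" and lin: "Vector_Spaces.linear sm sm (T i)"
begin

sublocale linear_ext_target sm using vs by (simp add: linear_ext_target_def)

lemma linear_foldr: "Vector_Spaces.linear sm sm (foldr T ws)"
  by (rule linear_compose_foldr[OF vs lin])

lemma foldr_simps [simp]:
  "foldr T ws 0 = 0" "foldr T ws (u + v) = foldr T ws u + foldr T ws v"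
  "foldr T ws (u - v) = foldr T ws u - foldr T ws v" "foldr T ws (sm c v) = sm c (foldr T ws v)"
  "foldr T ws (sum g A) = (\<Sum>x\<in>A. foldr T ws (g x))" "foldr T ws (- v) = - foldr T ws v"
proof -
  interpret l: Vector_Spaces.linear sm sm "foldr T ws" by (rule linear_foldr)
  show "foldr T ws 0 = 0" "foldr T ws (u + v) = foldr T ws u + foldr T ws v"
    "foldr T ws (u - v) = foldr T ws u - foldr T ws v" "foldr T ws (sm c v) = sm c (foldr T ws v)"
    "foldr T ws (sum g A) = (\<Sum>x\<in>A. foldr T ws (g x))" "foldr T ws (- v) = - foldr T ws v"
    by (simp_all add: l.add l.neg l.diff l.scale l.sum l.zero)
qed

lemma word_op_simps [simp]:
  "word_op sm T 0 v = 0" "word_op sm T (s + t) v = word_op sm T s v + word_op sm T t v"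
  "word_op sm T (Poly_Mapping.single w c) v = sm c (foldr T (letters w) v)"
  by (auto simp: word_op_def linear_ext_add)

lemma word_op_single_mult:
  "word_op sm T (Poly_Mapping.single u c * t) v = sm c (foldr T (letters u) (word_op sm T t v))"
  by (induction t rule: poly_mapping_single_induct)
    (auto simp: mult_single distrib_left scale_right_distrib)

lemma word_op_mult: "word_op sm T (s * t) v = word_op sm T s (word_op sm T t v)"
  by (induction s rule: poly_mapping_single_induct)
    (auto simp: distrib_right word_op_single_mult)

lemma relation_symbols_closed:
  shows "0 \<in> relation_symbols sm T D"
    and "p \<in> relation_symbols sm T D \<Longrightarrow> q \<in> relation_symbols sm T D \<Longrightarrow> p + q \<in> relation_symbols sm T D"
    and "p \<in> relation_symbols sm T D \<Longrightarrow>
      Poly_Mapping.single m c * p \<in> relation_symbols sm T (size m + D)"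
proof -
  show "0 \<in> relation_symbols sm T D" unfolding relation_symbols_def
    by (intro CollectI exI[of _ 0]) auto
  {
    assume "p \<in> relation_symbols sm T D" "q \<in> relation_symbols sm T D"
    then obtain s t where "p = top_symbol D s" "q = top_symbol D t"
      "\<forall>w\<in>Poly_Mapping.keys s. length (letters w) \<le> D" "\<forall>w\<in>Poly_Mapping.keys t. length (letters w) \<le> D"
      "\<forall>v. word_op sm T s v = 0" "\<forall>v. word_op sm T t v = 0"
      by (auto simp: relation_symbols_def)
    then show "p + q \<in> relation_symbols sm T D" unfolding relation_symbols_def
      using Poly_Mapping.keys_add[of s t] by (intro CollectI exI[of _ "s + t"]) auto
  }
  assume "p \<in> relation_symbols sm T D"
  then obtain s where s: "p = top_symbol D s" "\<forall>w\<in>Poly_Mapping.keys s. length (letters w) \<le> D"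
    "\<forall>v. word_op sm T s v = 0"
    by (auto simp: relation_symbols_def)
  \<comment> \<open>Any order of the letters will do, since the top symbol forgets it.\<close>
  obtain ws where ws: "mset ws = m" by (metis ex_mset)
  then have len: "size m = length ws" by auto
  show "Poly_Mapping.single m c * p \<in> relation_symbols sm T (size m + D)"
    unfolding relation_symbols_def
  proof (intro CollectI exI[of _ "Poly_Mapping.single (Word ws) c * s"] conjI ballI allI)
    fix w assume "w \<in> Poly_Mapping.keys (Poly_Mapping.single (Word ws) c * s)"
    then show "length (letters w) \<le> size m + D"
      using keys_single_mult[of "Word ws" c s] s(2) len by auto
  qed (use s len ws in \<open>auto simp: top_symbol_single_mult word_op_single_mult\<close>)
qed

lemma pideal_symbol_ideal: "pideal (symbol_ideal sm T)"
proof -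
  have mult: "x * y \<in> symbol_ideal sm T" if y: "y \<in> symbol_ideal sm T" for x y
  proof (induction x rule: poly_mapping_single_induct)
    case zero
    show ?case by (simp add: symbol_ideal_def relation_symbols_closed)
  next
    case (add x m c)
    have "hom_part D (Poly_Mapping.single m c * y) \<in> relation_symbols sm T D" for D
    proof (cases "size m \<le> D")
      case True
      have "hom_part (D - size m) y \<in> relation_symbols sm T (D - size m)"
        using y by (auto simp: symbol_ideal_def)
      from relation_symbols_closed(3)[OF this, of m c] True show ?thesis
        by (simp add: hom_part_single_mult)
    qed (simp add: hom_part_single_mult relation_symbols_closed)
    with add show ?case
      by (auto simp: symbol_ideal_def distrib_right intro: relation_symbols_closed)
  qed
  show ?thesis unfolding pideal_def using mult
    by (auto simp: symbol_ideal_def intro: relation_symbols_closed)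
qed

lemma top_symbol_in_symbol_ideal:
  assumes "\<forall>w\<in>Poly_Mapping.keys t. length (letters w) \<le> D" and "\<forall>v. word_op sm T t v = 0"
  shows "top_symbol D t \<in> symbol_ideal sm T"
proof -
  have "hom_part E (top_symbol D t) = (if E = D then top_symbol D t else 0)" for E
    by (induction t rule: poly_mapping_single_induct) auto
  then show ?thesis using assms
    by (auto simp: symbol_ideal_def relation_symbols_closed) (auto simp: relation_symbols_def)
qed

end

section \<open>Reordering words of high weight\<close>

definition word_weight :: "('i \<Rightarrow> int) \<Rightarrow> 'i list \<Rightarrow> int" where
  "word_weight wt ws = sum_list (map wt ws)"

lemma word_weight_simps [simp]:
  "word_weight wt [] = 0" "word_weight wt (i # ws) = wt i + word_weight wt ws"
  "word_weight wt (us @ ws) = word_weight wt us + word_weight wt ws"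
  by (auto simp: word_weight_def)

lemma word_weight_bound:
  assumes "\<And>i. i \<in> set ws \<Longrightarrow> wt i \<le> 1"
  shows "word_weight wt ws \<le> int (length ws)"
    and "word_weight wt ws = int (length ws) \<Longrightarrow> i \<in> set ws \<Longrightarrow> wt i = 1"
proof -
  have "word_weight wt ws \<le> int (length ws) \<and>
    (word_weight wt ws = int (length ws) \<longrightarrow> (\<forall>i\<in>set ws. wt i = 1))"
    using assms
  proof (induction ws)
    case (Cons a ws)
    then show ?case using Cons.prems[of a] by fastforce
  qed simp
  then show "word_weight wt ws \<le> int (length ws)"
    and "word_weight wt ws = int (length ws) \<Longrightarrow> i \<in> set ws \<Longrightarrow> wt i = 1" by auto
qed

text \<open>\<open>H\<close> is the element defining the grading and \<open>R\<close> stands for the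
  relations of E^d. Only linear closure is demanded of \<open>R\<close>; \<open>high\<close>
  therefore speaks about a letter that is applied last.\<close>

locale weighted_operators = linear_operators sm T
  for sm :: "complex \<Rightarrow> 'v::ab_group_add \<Rightarrow> 'v" and T :: "'i \<Rightarrow> 'v \<Rightarrow> 'v" +
  fixes wt :: "'i \<Rightarrow> int" and H :: "'v \<Rightarrow> 'v" and R :: "'v set"
  assumes R: "subspace R"
    and linH: "Vector_Spaces.linear sm sm H"
    and H: "H (T i v) - T i (H v) = sm (of_int (wt i)) (T i v)"
    and comm: "\<exists>K c. finite K \<and> (\<forall>k\<in>K. wt k = wt i + wt j) \<and>
      (\<forall>v. T i (T j v) - T j (T i v) = (\<Sum>k\<in>K. sm (c k) (T k v)))"
    and high: "wt i \<ge> 2 \<Longrightarrow> T i v \<in> R"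
begin

lemma R_trans: "u - v \<in> R \<Longrightarrow> v - w \<in> R \<Longrightarrow> u - w \<in> R"
  using subspace_add[OF R, of "u - v" "v - w"] by simp

lemma R_cong: "u - v \<in> R \<Longrightarrow> u \<in> R \<longleftrightarrow> v \<in> R"
  using subspace_add[OF R, of "u - v" v] subspace_diff[OF R, of u "u - v"] by auto

definition heavy_words_in_R :: "nat \<Rightarrow> bool" where
  "heavy_words_in_R s \<longleftrightarrow>
     (\<forall>ws v. length ws = s \<and> word_weight wt ws > int s \<longrightarrow> foldr T ws v \<in> R)"

text \<open>The commutator replaces two letters by one of the same total weight. The remaining words
  are one letter shorter, so their weight exceeds their length.\<close>

lemma swap_mod_R:
  assumes "heavy_words_in_R (Suc (length xs + length ys))"
    and "word_weight wt (xs @ i # j # ys) \<ge> int (length (xs @ i # j # ys))"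
  shows "foldr T (xs @ i # j # ys) v - foldr T (xs @ j # i # ys) v \<in> R"
proof -
  obtain K c where K: "finite K" "\<And>k. k \<in> K \<Longrightarrow> wt k = wt i + wt j"
    "\<And>v. T i (T j v) - T j (T i v) = (\<Sum>k\<in>K. sm (c k) (T k v))"
    using comm[of i j] by blast
  have "foldr T (xs @ i # j # ys) v - foldr T (xs @ j # i # ys) v =
      foldr T xs (T i (T j (foldr T ys v)) - T j (T i (foldr T ys v)))" by simp
  also have "\<dots> = (\<Sum>k\<in>K. sm (c k) (foldr T (xs @ k # ys) v))" unfolding K(3) by simp
  also have "\<dots> \<in> R"
  proof (intro subspace_sum[OF R] subspace_scale[OF R])
    fix k assume "k \<in> K"
    then have "word_weight wt (xs @ k # ys) > int (length (xs @ k # ys))"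
      using assms(2) K(2) by simp
    then show "foldr T (xs @ k # ys) v \<in> R"
      using assms(1) unfolding heavy_words_in_R_def by (metis add_Suc_right length_Cons length_append)
  qed
  finally show ?thesis .
qed

text \<open>The prefix \<open>pre\<close> stays in place so that \<open>permute_mod_R_aux\<close>
  can assemble the target word from the left, letter by letter.\<close>

lemma move_front_mod_R:
  assumes "heavy_words_in_R (length pre + length xs + length ys)"
    and "word_weight wt (pre @ xs @ i # ys) \<ge> int (length (pre @ xs @ i # ys))"
  shows "foldr T (pre @ xs @ i # ys) v - foldr T (pre @ i # xs @ ys) v \<in> R"
  using assms
proof (induction xs arbitrary: ys rule: rev_induct)
  case Nil
  show ?case using subspace_0[OF R] by simp
next
  case (snoc x xs)
  have "foldr T ((pre @ xs) @ x # i # ys) v - foldr T ((pre @ xs) @ i # x # ys) v \<in> R"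
    using snoc.prems by (intro swap_mod_R) auto
  moreover have "foldr T (pre @ xs @ i # (x # ys)) v - foldr T (pre @ i # xs @ (x # ys)) v \<in> R"
    using snoc.prems by (intro snoc.IH) auto
  ultimately show ?case using R_trans by simp
qed

lemma permute_mod_R_aux:
  assumes "heavy_words_in_R (length (pre @ us) - 1)" and "mset us = mset ws"
    and "word_weight wt (pre @ us) \<ge> int (length (pre @ us))"
  shows "foldr T (pre @ us) v - foldr T (pre @ ws) v \<in> R"
  using assms
proof (induction ws arbitrary: pre us)
  case Nil
  then show ?case using subspace_0[OF R] by simp
next
  case (Cons i zs)
  then have "i \<in> set us" by (metis list.set_intros(1) set_mset_mset)
  then obtain a b where us: "us = a @ i # b" by (meson split_list)
  with Cons.prems have m: "mset (a @ b) = mset zs" by simp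
  have "foldr T (pre @ a @ i # b) v - foldr T (pre @ i # a @ b) v \<in> R"
    using Cons.prems us by (intro move_front_mod_R) (auto simp: add.assoc)
  moreover have "foldr T ((pre @ [i]) @ (a @ b)) v - foldr T ((pre @ [i]) @ zs) v \<in> R"
    using Cons.prems us m by (intro Cons.IH) auto
  ultimately show ?case using R_trans us by simp
qed

lemma heavy_words: "heavy_words_in_R s"
proof (induction s)
  case 0
  show ?case by (simp add: heavy_words_in_R_def)
next
  case (Suc s)
  show ?case unfolding heavy_words_in_R_def
  proof safe
    fix ws v assume ws: "length ws = Suc s" "int (Suc s) < word_weight wt ws"
    then obtain i where i: "i \<in> set ws" "wt i \<ge> 2"
      using word_weight_bound(1)[of ws wt] by force
    then obtain a b where ab: "ws = a @ i # b" by (meson split_list)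
    have "foldr T ([] @ a @ i # b) v - foldr T ([] @ i # a @ b) v \<in> R"
      using Suc ws ab by (intro move_front_mod_R) auto
    \<comment> \<open>With \<open>foldr\<close> the head of the list is the operator applied
      last.\<close>
    moreover have "foldr T ([] @ i # a @ b) v \<in> R" using high i by simp
    ultimately show "foldr T ws v \<in> R" using R_cong ab by simp
  qed
qed

lemma permute_mod_R:
  assumes "mset us = mset ws" and "word_weight wt us \<ge> int (length us)"
  shows "foldr T us v - foldr T ws v \<in> R"
  using permute_mod_R_aux[of "[]" us ws v] assms heavy_words by simp

lemma heavy_word_in_R:
  assumes "word_weight wt us \<ge> int (length us)" and "\<not> (\<forall>i\<in>set us. wt i = 1)"
  shows "foldr T us v \<in> R"
proof -
  obtain i where i: "i \<in> set us" "wt i \<ge> 2"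
    using word_weight_bound[of us wt] assms by force
  then obtain a b where ab: "us = a @ i # b" by (meson split_list)
  have "foldr T us v - foldr T (i # a @ b) v \<in> R"
    using assms ab by (intro permute_mod_R) auto
  moreover have "foldr T (i # a @ b) v \<in> R" using high i by simp
  ultimately show ?thesis using R_cong by blast
qed

section \<open>Weight components of relations\<close>

lemma H_foldr: "H (foldr T ws v) - foldr T ws (H v) = sm (of_int (word_weight wt ws)) (foldr T ws v)"
proof (induction ws)
  case (Cons i ws)
  interpret Ti: Vector_Spaces.linear sm sm "T i" by (rule lin)
  have "H (foldr T (i # ws) v) - foldr T (i # ws) (H v) =
    (H (T i (foldr T ws v)) - T i (H (foldr T ws v))) + T i (H (foldr T ws v) - foldr T ws (H v))"
    by (simp add: Ti.diff)
  then show ?case unfolding H Cons by (simp add: Ti.scale scale_left_distrib)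
qed simp

text \<open>Relations are stable under ad \<open>H\<close>, which multiplies a word by its weight. A
  product of factors ad \<open>H\<close> - a over the other weights that occur isolates the
  component of weight \<open>D\<close>, as in Lagrange interpolation.\<close>

lemma weight_projection:
  assumes "\<And>v. word_op sm T t v = 0"
  shows "lext (\<lambda>w. if word_weight wt (letters w) = D then foldr T (letters w) v else 0) t = 0"
proof -
  let ?w = "\<lambda>w. word_weight wt (letters w)"
  interpret H: Vector_Spaces.linear sm sm H by (rule linH)
  have *: "lext (\<lambda>w. sm (of_int (\<Prod>a\<in>W. ?w w - a)) (foldr T (letters w) v)) t = 0"
    if "finite W" for W v
    using that
  proof (induction W arbitrary: v)
    case empty
    show ?case using assms[of v] by (simp add: word_op_def)
  next
    case (insert a W)
    \<comment> \<open>The factor ad \<open>H\<close> - a splits into three terms, each of which sums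
      to zero over \<open>t\<close> by the induction hypothesis. The vector must be arbitrary there
      because \<open>H v\<close> occurs as an argument.\<close>
    define g where "g w v = sm (of_int (\<Prod>a\<in>W. ?w w - a)) (foldr T (letters w) v)" for w v
    have g: "sm (of_int (\<Prod>a\<in>insert a W. ?w w - a)) (foldr T (letters w) v) =
        (H (g w v) + g w (- H v)) + g w (sm (- of_int a) v)" for w
    proof -
      have "H (g w v) + g w (- H v) =
        sm (of_int (\<Prod>a\<in>W. ?w w - a)) (H (foldr T (letters w) v) - foldr T (letters w) (H v))"
        unfolding g_def by (simp add: H.scale scale_right_diff_distrib)
      then show ?thesis
        unfolding H_foldr g_def using insert.hyps
        by (simp add: scale_right_diff_distrib scale_left_diff_distrib algebra_simps)
    qed
    have "lext (\<lambda>w. H (g w v)) t = H (lext (\<lambda>w. g w v) t)"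
      by (rule linear_ext_linear[OF linH, symmetric])
    moreover have "lext (\<lambda>w. g w u) t = 0" for u
      unfolding g_def by (rule insert.IH)
    ultimately show ?case unfolding g by (simp add: linear_ext_fun_add H.zero)
  qed
  \<comment> \<open>The other weights that occur; the product over \<open>W\<close> vanishes at each
    of them and not at \<open>D\<close>.\<close>
  define W where "W = ?w ` Poly_Mapping.keys t - {D}"
  have W: "finite W" "D \<notin> W" by (auto simp: W_def)
  have "sm (of_int (\<Prod>a\<in>W. D - a)) (lext (\<lambda>w. if ?w w = D then foldr T (letters w) v else 0) t) =
    lext (\<lambda>w. sm (of_int (\<Prod>a\<in>W. D - a)) (if ?w w = D then foldr T (letters w) v else 0)) t"
    by (rule linear_ext_linear) (rule linear_scale_self)
  also have "\<dots> = lext (\<lambda>w. sm (of_int (\<Prod>a\<in>W. ?w w - a)) (foldr T (letters w) v)) t"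
  proof (rule linear_ext_cong)
    fix w assume "w \<in> Poly_Mapping.keys t"
    then have "?w w = D \<or> ?w w \<in> W" by (auto simp: W_def)
    then show "sm (of_int (\<Prod>a\<in>W. D - a)) (if ?w w = D then foldr T (letters w) v else 0) =
      sm (of_int (\<Prod>a\<in>W. ?w w - a)) (foldr T (letters w) v)"
      using W by (auto simp: prod_zero_iff)
  qed
  also have "\<dots> = 0" by (rule *[OF W(1)])
  finally show ?thesis using W by (auto simp: scale_eq_0_iff prod_zero_iff)
qed

text \<open>The substitution of 0 for all variables of weight different from 1. It is a ring
  homomorphism, so it passes through matrix powers.\<close>

definition weight_one_part :: "'i polyn \<Rightarrow> 'i polyn" where
  "weight_one_part = linear_ext pscale
     (\<lambda>m. if \<forall>i\<in>#m. wt i = 1 then Poly_Mapping.single m 1 else 0)"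

text \<open>A monomial in commuting variables acts only after its letters are ordered. For letters
  of weight 1 the choice does not matter modulo \<open>R\<close>, by
  \<open>permute_mod_R\<close>.\<close>

definition weight_one_op :: "'v \<Rightarrow> 'i polyn \<Rightarrow> 'v" where
  "weight_one_op v = lext
     (\<lambda>m. if \<forall>i\<in>#m. wt i = 1 then foldr T (SOME ws. mset ws = m) v else 0)"

lemma weight_one_op_top_symbol:
  assumes len: "\<forall>w\<in>Poly_Mapping.keys t. length (letters w) \<le> D" and zero: "\<And>v. word_op sm T t v = 0"
  shows "weight_one_op v (top_symbol D t) \<in> R"
proof -
  \<comment> \<open>\<open>f\<close> is the weight \<open>D\<close> component of the relation in the
    given order of letters, and \<open>g\<close> the weight one part of its symbol in the chosen
    order. They agree modulo \<open>R\<close> word by word: a word shorter than \<open>D\<close> but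
    of weight \<open>D\<close> is heavy, and so is one of length \<open>D\<close> with a letter of
    weight other than 1.\<close>
  define f where "f w = (if word_weight wt (letters w) = int D then foldr T (letters w) v else 0)" for w
  define g where "g w = weight_one_op v
    (if length (letters w) = D then Poly_Mapping.single (mset (letters w)) 1 else 0)" for w
  have "weight_one_op v (top_symbol D t) = lext g t"
    by (induction t rule: poly_mapping_single_induct)
      (auto simp: linear_ext_add g_def weight_one_op_def)
  moreover have "lext f t = 0" unfolding f_def by (rule weight_projection[OF zero])
  moreover have "lext (\<lambda>w. f w - g w) t \<in> R"
  proof (rule linear_ext_in_subspace[OF R])
    fix w assume w: "w \<in> Poly_Mapping.keys t"
    show "f w - g w \<in> R"
    proof (cases "length (letters w) = D")
      case False
      then have "length (letters w) < D" using len w by force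
      then have "f w \<in> R"
        using heavy_words[of "length (letters w)"] subspace_0[OF R]
        by (auto simp: f_def heavy_words_in_R_def)
      then show ?thesis using False by (simp add: g_def weight_one_op_def)
    next
      case len: True
      show ?thesis
      proof (cases "\<forall>i\<in>set (letters w). wt i = 1")
        case True
        then have "word_weight wt (letters w) = int (length (letters w))"
          unfolding word_weight_def by (induction "letters w" rule: list.induct) (auto simp: map_idI sum_list_triv cong: map_cong)
        moreover have "mset (SOME ws. mset ws = mset (letters w)) = mset (letters w)"
          by (rule someI_ex) auto
        ultimately show ?thesis
          using permute_mod_R[of "letters w" "SOME ws. mset ws = mset (letters w)" v] True len
          by (simp add: f_def g_def weight_one_op_def)
      next
        case False
        then have "g w = 0" using len by (auto simp: g_def weight_one_op_def)
        moreover have "f w \<in> R"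
          using heavy_word_in_R[of "letters w" v] False len subspace_0[OF R] by (auto simp: f_def)
        ultimately show ?thesis by simp
      qed
    qed
  qed
  moreover have "lext (\<lambda>w. f w - g w) t = lext f t - lext g t"
    by (simp add: linear_ext_def scale_right_diff_distrib sum_subtractf)
  ultimately show ?thesis using subspace_neg[OF R, of "- lext g t"] by simp
qed

lemma weight_one_part_simps [simp]:
  "weight_one_part 0 = 0" "weight_one_part (p + q) = weight_one_part p + weight_one_part q"
  "weight_one_part (Poly_Mapping.single m c) =
     (if \<forall>i\<in>#m. wt i = 1 then Poly_Mapping.single m c else 0)"
  by (auto simp: weight_one_part_def polyn_ext.linear_ext_add mult_single)

lemma weight_one_part_mult: "weight_one_part (p * q) = weight_one_part p * weight_one_part q"
proof -
  have "weight_one_part (Poly_Mapping.single m c * q) =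
      weight_one_part (Poly_Mapping.single m c) * weight_one_part q" for m c
    by (induction q rule: poly_mapping_single_induct) (auto simp: mult_single distrib_left)
  then show ?thesis
    by (induction p rule: poly_mapping_single_induct) (simp_all add: distrib_right)
qed

lemma weight_one_part_1 [simp]: "weight_one_part 1 = 1"
  by (simp flip: single_one)

lemma weight_one_op_part: "weight_one_op v (weight_one_part p) = weight_one_op v p"
  by (induction p rule: poly_mapping_single_induct) (auto simp: weight_one_op_def linear_ext_add)

lemma hom_part_weight_one_part: "hom_part D (weight_one_part p) = weight_one_part (hom_part D p)"
  by (induction p rule: poly_mapping_single_induct) auto

theorem power_in_symbol_ideal:
  assumes "f ^ k \<in> symbol_ideal sm T" and "weight_one_part f = Poly_Mapping.single m 1"
    and one: "\<forall>i\<in>#m. wt i = 1" and ws: "mset ws = repeat_mset k m"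
  shows "foldr T ws v \<in> R"
proof -
  have pow: "weight_one_part (f ^ k) = Poly_Mapping.single (repeat_mset k m) 1"
    by (induction k) (auto simp: weight_one_part_mult assms(2) mult_single simp flip: single_one)
  define D where "D = size (repeat_mset k m)"
  have sub: "set_mset (repeat_mset k m) \<subseteq> set_mset m" by (induction k) auto
  \<comment> \<open>Gradedness yields a single relation of order at most \<open>D\<close> whose
    symbol has the wanted weight one part.\<close>
  have "hom_part D (f ^ k) \<in> relation_symbols sm T D" using assms(1) by (auto simp: symbol_ideal_def)
  then have "weight_one_op v (hom_part D (f ^ k)) \<in> R"
    unfolding relation_symbols_def using weight_one_op_top_symbol by auto
  also have "weight_one_op v (hom_part D (f ^ k)) =
      weight_one_op v (hom_part D (weight_one_part (f ^ k)))"
    by (simp add: hom_part_weight_one_part weight_one_op_part)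
  also have "\<dots> = foldr T (SOME us. mset us = mset ws) v"
  proof -
    have "\<forall>i\<in>#repeat_mset k m. wt i = 1" using one sub by blast
    then show ?thesis using ws by (simp add: pow D_def weight_one_op_def)
  qed
  finally have in_R: "foldr T (SOME us. mset us = mset ws) v \<in> R" .
  have "wt i = 1" if "i \<in> set ws" for i
    using that one ws sub by (metis set_mset_mset subsetD)
  then have "word_weight wt ws = int (length ws)"
    unfolding word_weight_def by (simp add: sum_list_triv cong: map_cong)
  moreover have "mset (SOME us. mset us = mset ws) = mset ws" by (rule someI_ex) auto
  ultimately show ?thesis using permute_mod_R[of ws "SOME us. mset us = mset ws" v] in_R R_cong by simp
qed

end

section \<open>Coordinates on the complexified Lie algebra\<close>

locale ground_field =
  fixes F :: "complex set"
  assumes F: "F = \<real> \<or> F = UNIV"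
begin

lemma F_closed [simp, intro]:
  "0 \<in> F" "1 \<in> F" "of_real r \<in> F" "of_int k \<in> F" "1 / 2 \<in> F"
  "x \<in> F \<Longrightarrow> y \<in> F \<Longrightarrow> x + y \<in> F" "x \<in> F \<Longrightarrow> y \<in> F \<Longrightarrow> x - y \<in> F"
  "x \<in> F \<Longrightarrow> y \<in> F \<Longrightarrow> x * y \<in> F"
  using F by auto

lemma F_sum [intro]: "(\<And>i. i \<in> A \<Longrightarrow> f i \<in> F) \<Longrightarrow> sum f A \<in> F"
  using F by auto

lemma gl_iff: "X \<in> gl F n \<longleftrightarrow> X \<in> carrier_mat n n \<and> (\<forall>i<n. \<forall>j<n. X $$ (i, j) \<in> F)"
  unfolding gl_def by (auto dest!: elements_matD)

lemma gl_closed: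
  assumes "X \<in> gl F n" "Y \<in> gl F n"
  shows "X + Y \<in> gl F n" "X - Y \<in> gl F n" "c \<in> F \<Longrightarrow> c \<cdot>\<^sub>m X \<in> gl F n"
    "commutator X Y \<in> gl F n"
  using assms
  by (auto simp: gl_iff commutator_def scalar_prod_def intro!: F_closed(7) F_sum F_closed(8))

lemma lie_closed:
  assumes "x \<in> cplx (gl F n)" "y \<in> cplx (gl F n)"
  shows "lie_add x y \<in> cplx (gl F n)" "lie_smult c x \<in> cplx (gl F n)"
    "lie_bracket x y \<in> cplx (gl F n)"
  using assms by (cases x; cases y; auto simp: cplx_def gl_closed)+

definition elem_mat :: "nat \<Rightarrow> nat \<Rightarrow> nat \<Rightarrow> complex \<Rightarrow> complex mat" where
  "elem_mat n a b x = mat n n (\<lambda>(i, j). if i = a \<and> j = b then x else 0)"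

lemma elem_mat_index [simp]:
  "i < n \<Longrightarrow> j < n \<Longrightarrow> elem_mat n a b x $$ (i, j) = (if i = a \<and> j = b then x else 0)"
  "dim_row (elem_mat n a b x) = n" "dim_col (elem_mat n a b x) = n"
  "elem_mat n a b x \<in> carrier_mat n n"
  by (auto simp: elem_mat_def)

text \<open>
  For \<open>F = UNIV\<close> the elements \<open>basis_elt n (s, a, b)\<close> with \<open>s = False\<close> and \<open>s = True\<close> are the
  matrix units of the two summands of \<open>gl(n,\<complex>) \<oplus> gl(n,\<complex>)\<close>; for \<open>F = \<real>\<close> those with
  \<open>s = True\<close> vanish.  All of them vanish if an index is out of range.
\<close>

definition basis_re :: "bool \<Rightarrow> real" where
  "basis_re s = (if F = \<real> then (if s then 0 else 1) else 1 / 2)"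

definition basis_im :: "bool \<Rightarrow> complex" where
  "basis_im s = (if F = \<real> then 0 else if s then \<i> / 2 else - \<i> / 2)"

definition basis_elt :: "nat \<Rightarrow> bool \<times> nat \<times> nat \<Rightarrow> lie" where
  "basis_elt n = (\<lambda>(s, a, b). (elem_mat n a b (of_real (basis_re s)), elem_mat n a b (basis_im s)))"

text \<open>These are the entries of \<open>proj_hol\<close> and \<open>proj_antihol\<close>, the
  coefficients with respect to \<open>basis_elt\<close>. Over the reals both families agree, but the
  second one multiplies basis elements that vanish.\<close>

definition coord :: "lie \<Rightarrow> bool \<times> nat \<times> nat \<Rightarrow> complex" where
  "coord z = (\<lambda>(s, a, b). if s then cnj (fst z $$ (a, b)) + \<i> * cnj (snd z $$ (a, b))
     else fst z $$ (a, b) + \<i> * snd z $$ (a, b))"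

lemma basis_elt_in [simp]: "basis_elt n i \<in> cplx (gl F n)"
  using F by (cases i) (auto simp: basis_elt_def cplx_def gl_iff basis_im_def)

lemma coord_add:
  assumes "x \<in> cplx (gl F n)" "y \<in> cplx (gl F n)" "a < n" "b < n"
  shows "coord (lie_add x y) (s, a, b) = coord x (s, a, b) + coord y (s, a, b)"
  using assms by (cases x; cases y; auto simp: coord_def cplx_def gl_iff algebra_simps)

lemma coord_smult:
  assumes "x \<in> cplx (gl F n)" "a < n" "b < n"
  shows "coord (lie_smult c x) (s, a, b) = c * coord x (s, a, b)"
  using assms by (cases x; auto simp: coord_def cplx_def gl_iff complex_eq_iff algebra_simps)

end

locale gl_module = ground_field F for F +
  fixes n :: nat and sm :: "complex \<Rightarrow> 'v::ab_group_add \<Rightarrow> 'v" and \<rho> :: "lie \<Rightarrow> 'v \<Rightarrow> 'v"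
  assumes lie_module: "lie_module (cplx (gl F n)) sm \<rho>"
begin

abbreviation L where "L \<equiv> cplx (gl F n)"

definition T :: "bool \<times> nat \<times> nat \<Rightarrow> 'v \<Rightarrow> 'v" where "T i = \<rho> (basis_elt n i)"

lemma vs: "vector_space sm" and lin_rho: "x \<in> L \<Longrightarrow> Vector_Spaces.linear sm sm (\<rho> x)"
  and rho_add: "x \<in> L \<Longrightarrow> y \<in> L \<Longrightarrow> \<rho> (lie_add x y) v = \<rho> x v + \<rho> y v"
  and rho_smult: "x \<in> L \<Longrightarrow> \<rho> (lie_smult c x) v = sm c (\<rho> x v)"
  and rho_bracket: "x \<in> L \<Longrightarrow> y \<in> L \<Longrightarrow> \<rho> (lie_bracket x y) v = \<rho> x (\<rho> y v) - \<rho> y (\<rho> x v)"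
  using lie_module by (auto simp: lie_module_def)

sublocale linear_operators sm T
proof (rule linear_operators.intro)
  show "Vector_Spaces.linear sm sm (T i)" for i unfolding T_def by (rule lin_rho) simp
qed (rule vs)

lemma rho_0: "\<rho> (0\<^sub>m n n, 0\<^sub>m n n) v = 0"
proof -
  have "(0\<^sub>m n n, 0\<^sub>m n n) \<in> L" by (auto simp: cplx_def gl_iff)
  then have "\<rho> (lie_smult 0 (0\<^sub>m n n, 0\<^sub>m n n)) v = 0" by (subst rho_smult) auto
  moreover have "lie_smult 0 (0\<^sub>m n n, 0\<^sub>m n n) = (0\<^sub>m n n, 0\<^sub>m n n)"
    by (auto intro!: eq_matI)
  ultimately show ?thesis by metis
qed

text \<open>The operator locales quantify over the whole index type; indices out of range and the
  second copy over the reals are represented there by zero operators.\<close>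

lemma T_zero:
  assumes "n \<le> a \<or> n \<le> b \<or> (F = \<real> \<and> s)"
  shows "T (s, a, b) v = 0"
proof -
  have "basis_elt n (s, a, b) = (0\<^sub>m n n, 0\<^sub>m n n)"
    using assms by (auto simp: basis_elt_def basis_re_def basis_im_def intro!: eq_matI)
  then show ?thesis by (simp add: T_def rho_0)
qed

lemma rho_elem:
  assumes "x \<in> F" "y \<in> F"
  shows "\<rho> (elem_mat n a b x, elem_mat n a b y) v =
    sm (x + \<i> * y) (T (False, a, b) v) + sm (cnj x + \<i> * cnj y) (T (True, a, b) v)"
proof (cases "F = \<real>")
  case True
  then obtain p q where "x = of_real p" "y = of_real q" using assms by (auto elim!: Reals_cases)
  moreover have "basis_re False = 1" "basis_im False = 0"
    unfolding basis_re_def basis_im_def using True by auto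
  ultimately have "(elem_mat n a b x, elem_mat n a b y) = lie_smult (x + \<i> * y) (basis_elt n (False, a, b))"
    by (auto simp: basis_elt_def intro!: eq_matI)
  moreover have "T (True, a, b) v = 0" using True by (intro T_zero) auto
  ultimately show ?thesis by (simp add: rho_smult T_def)
next
  case False
  have basis: "basis_re s = 1 / 2" "basis_im s = (if s then \<i> / 2 else - \<i> / 2)" for s
    unfolding basis_re_def basis_im_def using False by auto
  let ?c = "x + \<i> * y" and ?c' = "cnj x + \<i> * cnj y"
  have "of_real (Re ?c) * (1 / 2) - of_real (Im ?c) * (- \<i> / 2) +
      (of_real (Re ?c') * (1 / 2) - of_real (Im ?c') * (\<i> / 2)) = x"
    "of_real (Im ?c) * (1 / 2) + of_real (Re ?c) * (- \<i> / 2) +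
      (of_real (Im ?c') * (1 / 2) + of_real (Re ?c') * (\<i> / 2)) = y"
    by (rule complex_eqI;
        simp add: add_divide_distrib[symmetric] diff_divide_distrib[symmetric])+
  then have "(elem_mat n a b x, elem_mat n a b y) =
      lie_add (lie_smult ?c (basis_elt n (False, a, b))) (lie_smult ?c' (basis_elt n (True, a, b)))"
    unfolding basis_elt_def lie_smult.simps lie_add.simps prod.case basis
    by (intro arg_cong2[of _ _ _ _ Pair] eq_matI) simp_all
  then show ?thesis by (simp add: rho_smult T_def rho_add lie_closed(2)[OF basis_elt_in basis_elt_in])
qed

lemma rho_expand:
  assumes "z \<in> L"
  shows "\<rho> z v = (\<Sum>i\<in>UNIV \<times> {..<n} \<times> {..<n}. sm (coord z i) (T i v))"
proof -
  obtain X Y where z: "z = (X, Y)" by (cases z)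
  with assms have XY: "X \<in> carrier_mat n n" "Y \<in> carrier_mat n n"
    and mem: "\<And>i j. i < n \<Longrightarrow> j < n \<Longrightarrow> X $$ (i, j) \<in> F" "\<And>i j. i < n \<Longrightarrow> j < n \<Longrightarrow> Y $$ (i, j) \<in> F"
    by (auto simp: cplx_def gl_iff)
  \<comment> \<open>The entries outside the set \<open>A\<close> of positions are erased, so that
    the expansion can be built up one position at a time.\<close>
  define r where "r A Z = mat n n (\<lambda>p. if p \<in> A then Z $$ p else 0)" for A and Z :: "complex mat"
  let ?t = "\<lambda>(a, b). sm (coord z (False, a, b)) (T (False, a, b) v) + sm (coord z (True, a, b)) (T (True, a, b) v)"
  have "\<rho> (r A X, r A Y) v = sum ?t A" if "finite A" "A \<subseteq> {..<n} \<times> {..<n}" for A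
    using that
  proof induction
    case empty
    have "(r {} X, r {} Y) = (0\<^sub>m n n, 0\<^sub>m n n)" by (auto simp: r_def intro!: eq_matI)
    then show ?case using rho_0 by simp
  next
    case (insert p A)
    obtain a b where p: "p = (a, b)" by (cases p)
    have ab: "a < n" "b < n" using insert.prems p by auto
    have "(r (insert p A) X, r (insert p A) Y) =
       lie_add (r A X, r A Y) (elem_mat n a b (X $$ p), elem_mat n a b (Y $$ p))"
      using insert.hyps p by (auto simp: r_def intro!: eq_matI)
    moreover have "(r A X, r A Y) \<in> L" using mem by (auto simp: cplx_def gl_iff r_def)
    moreover have "(elem_mat n a b (X $$ p), elem_mat n a b (Y $$ p)) \<in> L"
      using mem ab p by (auto simp: cplx_def gl_iff)
    ultimately have "\<rho> (r (insert p A) X, r (insert p A) Y) v =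
      \<rho> (r A X, r A Y) v + \<rho> (elem_mat n a b (X $$ p), elem_mat n a b (Y $$ p)) v"
      using rho_add by metis
    then show ?case using insert mem ab p z by (simp add: rho_elem coord_def add.commute)
  qed
  from this[of "{..<n} \<times> {..<n}"] have "\<rho> (r ({..<n} \<times> {..<n}) X, r ({..<n} \<times> {..<n}) Y) v =
    sum ?t ({..<n} \<times> {..<n})" by simp
  moreover have "r ({..<n} \<times> {..<n}) X = X" "r ({..<n} \<times> {..<n}) Y = Y"
    using XY by (auto simp: r_def intro!: eq_matI)
  moreover have "sum ?t ({..<n} \<times> {..<n}) =
     (\<Sum>s\<in>UNIV. \<Sum>p\<in>{..<n} \<times> {..<n}. sm (coord z (s, p)) (T (s, p) v))"
    by (simp add: UNIV_bool sum.distrib split_def)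
  ultimately show ?thesis by (simp add: z sum.cartesian_product split_def)
qed

end

section \<open>Weights\<close>

text \<open>
  The weight is \<open>1\<close> on the root vectors on which the iterated character is nontrivial and on those
  of the next radical \<open>V\<^bsub>n-d+1\<^esub>\<close>, which occupy column \<open>n - d\<close> (counted from 0).
\<close>

definition height :: "nat \<Rightarrow> nat \<Rightarrow> nat \<Rightarrow> int" where
  "height n d a = int (Suc a - (n - d))"

definition weight :: "nat \<Rightarrow> nat \<Rightarrow> bool \<times> nat \<times> nat \<Rightarrow> int" where
  "weight n d = (\<lambda>(s, a, b). height n d b - height n d a)"

context ground_field
begin

text \<open>The sign makes the eigenvalue on e_ab equal to height b - height a.\<close>

definition grading_elt :: "nat \<Rightarrow> nat \<Rightarrow> lie" where
  "grading_elt n d = (mat n n (\<lambda>(i, j). if i = j then - of_int (height n d i) else 0), 0\<^sub>m n n)"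

lemma grading_elt_in: "grading_elt n d \<in> cplx (gl F n)"
  by (auto simp: grading_elt_def cplx_def gl_iff simp flip: of_int_minus)

lemma mat_mult_entry:
  assumes "A \<in> carrier_mat n n" "B \<in> carrier_mat n n" "i < n" "j < n"
  shows "(A * B) $$ (i, j) = (\<Sum>k<n. A $$ (i, k) * B $$ (k, j))"
  using assms by (auto simp: scalar_prod_def atLeast0LessThan intro!: sum.cong)

lemma elem_mat_mult:
  "elem_mat n a b x * elem_mat n c d y = (if b = c \<and> b < n then elem_mat n a d (x * y) else 0\<^sub>m n n)"
proof (rule eq_matI)
  fix i j assume "i < dim_row (if b = c \<and> b < n then elem_mat n a d (x * y) else 0\<^sub>m n n)"
    "j < dim_col (if b = c \<and> b < n then elem_mat n a d (x * y) else 0\<^sub>m n n)"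
  then have ij: "i < n" "j < n" by (auto split: if_splits)
  have "(elem_mat n a b x * elem_mat n c d y) $$ (i, j) =
    (\<Sum>k<n. if k = b then (if i = a \<and> b = c \<and> j = d then x * y else 0) else 0)"
    unfolding mat_mult_entry[OF elem_mat_index(4) elem_mat_index(4) ij]
    using ij by (intro sum.cong) auto
  then show "(elem_mat n a b x * elem_mat n c d y) $$ (i, j) =
    (if b = c \<and> b < n then elem_mat n a d (x * y) else 0\<^sub>m n n) $$ (i, j)"
    using ij by auto
qed auto

lemma grading_bracket:
  "lie_bracket (grading_elt n d) (basis_elt n i) = lie_smult (of_int (weight n d i)) (basis_elt n i)"
proof -
  obtain s a b where i: "i = (s, a, b)" by (cases i)
  let ?D = "fst (grading_elt n d)"
  have D: "?D \<in> carrier_mat n n" by (auto simp: grading_elt_def)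
  have "commutator ?D (elem_mat n a b x) = of_int (weight n d i) \<cdot>\<^sub>m elem_mat n a b x" for x
  proof (rule eq_matI)
    fix p q assume "p < dim_row (of_int (weight n d i) \<cdot>\<^sub>m elem_mat n a b x)"
      "q < dim_col (of_int (weight n d i) \<cdot>\<^sub>m elem_mat n a b x)"
    then have pq: "p < n" "q < n" by auto
    have "(\<Sum>k<n. ?D $$ (p, k) * elem_mat n a b x $$ (k, q)) =
      (\<Sum>k<n. if k = p then - of_int (height n d p) * elem_mat n a b x $$ (p, q) else 0)"
      using pq by (intro sum.cong) (auto simp: grading_elt_def)
    moreover have "(\<Sum>k<n. elem_mat n a b x $$ (p, k) * ?D $$ (k, q)) =
      (\<Sum>k<n. if k = q then elem_mat n a b x $$ (p, q) * - of_int (height n d q) else 0)"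
      using pq by (intro sum.cong) (auto simp: grading_elt_def)
    ultimately show "commutator ?D (elem_mat n a b x) $$ (p, q) =
       (of_int (weight n d i) \<cdot>\<^sub>m elem_mat n a b x) $$ (p, q)"
      using pq D unfolding commutator_def
      by (simp del: index_mult_mat(1) add: index_mult_mat(2,3) mat_mult_entry[OF D elem_mat_index(4)]
          mat_mult_entry[OF elem_mat_index(4) D]) (auto simp: i weight_def algebra_simps)
  qed (use D in \<open>auto simp: commutator_def\<close>)
  moreover have "commutator (0\<^sub>m n n) (elem_mat n a b x) = 0\<^sub>m n n" for x
    by (auto simp: commutator_def intro!: eq_matI)
  ultimately show ?thesis
    using D by (auto simp: i basis_elt_def grading_elt_def intro!: eq_matI)
qed

text \<open>A product e_ab e_ce is nonzero only for b = c, and then the differences of heights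
  telescope.\<close>

lemma bracket_weight:
  assumes "coord (lie_bracket (basis_elt n i) (basis_elt n j)) (s, p, q) \<noteq> 0" "p < n" "q < n"
  shows "weight n d (s, p, q) = weight n d i + weight n d j"
proof -
  obtain s1 a b s2 c e where ij: "i = (s1, a, b)" "j = (s2, c, e)" by (cases i; cases j)
  have "commutator (elem_mat n a b x) (elem_mat n c e y) $$ (p, q) = 0"
    if "weight n d (s, p, q) \<noteq> weight n d i + weight n d j" for x y
    using that assms(2,3) by (auto simp: commutator_def elem_mat_mult ij weight_def)
  moreover have [simp]: "dim_row (commutator (elem_mat n a b x) (elem_mat n c e y)) = n"
    "dim_col (commutator (elem_mat n a b x) (elem_mat n c e y)) = n" for x y
    by (auto simp: commutator_def)
  ultimately show ?thesis using assms
    by (cases "weight n d (s, p, q) = weight n d i + weight n d j")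
      (auto simp: coord_def ij basis_elt_def split: if_splits)
qed

end

context gl_module
begin

lemma weighted_operators_T:
  assumes "subspace R" and "\<And>i v. weight n d i \<ge> 2 \<Longrightarrow> T i v \<in> R"
  shows "weighted_operators sm T (weight n d) (\<rho> (grading_elt n d)) R"
proof (intro weighted_operators.intro weighted_operators_axioms.intro)
  show "linear_operators sm T" by (rule linear_operators_axioms)
  show "subspace R" "Vector_Spaces.linear sm sm (\<rho> (grading_elt n d))"
    using assms lin_rho grading_elt_in by auto
  show "T i v \<in> R" if "2 \<le> weight n d i" for i v using assms that by blast
  show "\<rho> (grading_elt n d) (T i v) - T i (\<rho> (grading_elt n d) v) = sm (of_int (weight n d i)) (T i v)"
    for i v
    using rho_bracket[OF grading_elt_in basis_elt_in, of d i v]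
    by (simp add: T_def grading_bracket rho_smult)
  show "\<exists>K c. finite K \<and> (\<forall>k\<in>K. weight n d k = weight n d i + weight n d j) \<and>
      (\<forall>v. T i (T j v) - T j (T i v) = (\<Sum>k\<in>K. sm (c k) (T k v)))" for i j
  proof -
    define c where "c = coord (lie_bracket (basis_elt n i) (basis_elt n j))"
    let ?U = "UNIV \<times> {..<n} \<times> {..<n}"
    have "T i (T j v) - T j (T i v) = (\<Sum>k\<in>?U. sm (c k) (T k v))" for v
    proof -
      have "T i (T j v) - T j (T i v) = \<rho> (lie_bracket (basis_elt n i) (basis_elt n j)) v"
        by (simp add: T_def rho_bracket)
      also have "\<dots> = (\<Sum>k\<in>?U. sm (c k) (T k v))"
        unfolding c_def by (rule rho_expand[OF lie_closed(3)[OF basis_elt_in basis_elt_in]])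
      finally show ?thesis .
    qed
    \<comment> \<open>The set of indices must be cut down to the nonzero coefficients, since only
      these are known to have the right weight.\<close>
    moreover have "(\<Sum>k\<in>?U. sm (c k) (T k v)) = (\<Sum>k\<in>{k\<in>?U. c k \<noteq> 0}. sm (c k) (T k v))" for v
      by (intro sum.mono_neutral_right) auto
    ultimately show ?thesis
      using bracket_weight[of n i j] unfolding c_def[symmetric]
      by (intro exI[of _ "{k\<in>?U. c k \<noteq> 0}"] exI[of _ c]) auto
  qed
qed

end

section \<open>Points of the annihilator variety\<close>

lemma linear_ext_compose:
  assumes "vector_space sm'" and "\<And>p q. h (p + q) = h p + h q" and "\<And>c p. h (pscale c p) = sm' c (h p)"
  shows "h (linear_ext pscale f t) = linear_ext sm' (\<lambda>w. h (f w)) t"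
proof -
  interpret linear_ext_target sm' using assms by (simp add: linear_ext_target_def)
  have "h 0 = 0" using assms(2)[of 0 0] by simp
  then show ?thesis
    by (induction t rule: poly_mapping_single_induct)
      (auto simp: linear_ext_add polyn_ext.linear_ext_add assms)
qed

section \<open>The free algebra as a ring, its ideals and evaluation at a functional\<close>

lemma free_algebra_ops:
  "x \<otimes>\<^bsub>free_algebra L\<^esub> y = x * y" "x \<oplus>\<^bsub>free_algebra L\<^esub> y = x + y"
  "\<zero>\<^bsub>free_algebra L\<^esub> = 0" "\<one>\<^bsub>free_algebra L\<^esub> = 1"
  by (simp_all add: free_algebra_def)

lemma ring_free_algebra: "ring (free_algebra L)"
proof -
  have add: "s + t \<in> carrier (free_algebra L)"
    if "s \<in> carrier (free_algebra L)" "t \<in> carrier (free_algebra L)" for s t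
    using that Poly_Mapping.keys_add[of s t] by (auto simp: free_algebra_def)
  have mult: "s * t \<in> carrier (free_algebra L)"
    if "s \<in> carrier (free_algebra L)" "t \<in> carrier (free_algebra L)" for s t
    using that keys_mult[of s t] by (fastforce simp: free_algebra_def)
  have inv: "\<exists>y\<in>carrier (free_algebra L). y + x = 0" if "x \<in> carrier (free_algebra L)" for x
  proof (rule bexI[of _ "- x"])
    show "- x \<in> carrier (free_algebra L)" using that by (auto simp: free_algebra_def in_keys_iff)
  qed simp
  have "0 \<in> carrier (free_algebra L)" "1 \<in> carrier (free_algebra L)"
    by (auto simp: free_algebra_def)
  with add mult inv show ?thesis
    by (intro ringI abelian_groupI monoidI)
      (auto simp: free_algebra_ops distrib_left distrib_right mult.assoc add.assoc add.commute)
qed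

lemma gen_in_free_algebra: "x \<in> L \<Longrightarrow> gen x \<in> carrier (free_algebra L)"
  and const_in_free_algebra: "Poly_Mapping.single 0 c \<in> carrier (free_algebra L)"
  by (auto simp: free_algebra_def gen_def)

lemma free_algebra_closed:
  assumes "s \<in> carrier (free_algebra L)" "t \<in> carrier (free_algebra L)"
  shows "s + t \<in> carrier (free_algebra L)" "s * t \<in> carrier (free_algebra L)"
    "- t \<in> carrier (free_algebra L)" "s - t \<in> carrier (free_algebra L)"
proof -
  interpret ring "free_algebra L" by (rule ring_free_algebra)
  show "s + t \<in> carrier (free_algebra L)" "s * t \<in> carrier (free_algebra L)"
    using a_closed[OF assms] m_closed[OF assms] by (simp_all add: free_algebra_def)
  show m: "- t \<in> carrier (free_algebra L)"
    using assms by (auto simp: free_algebra_def in_keys_iff)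
  have "s + (- t) \<in> carrier (free_algebra L)"
    using a_closed[OF assms(1) m] by (simp add: free_algebra_def)
  then show "s - t \<in> carrier (free_algebra L)" by simp
qed

lemma free_eval_linear_ext: "free_eval \<xi> t = linear_ext (*) (\<lambda>w. prod_list (map \<xi> (letters w))) t"
  by (simp add: free_eval_def linear_ext_def)

lemma free_eval_simps [simp]:
  "free_eval \<xi> 0 = 0" "free_eval \<xi> (s + t) = free_eval \<xi> s + free_eval \<xi> t"
  "free_eval \<xi> (s - t) = free_eval \<xi> s - free_eval \<xi> t"
  "free_eval \<xi> (s * t) = free_eval \<xi> s * free_eval \<xi> t"
  "free_eval \<xi> (gen x) = \<xi> x" "free_eval \<xi> (Poly_Mapping.single w c) = c * prod_list (map \<xi> (letters w))"
proof -
  show "free_eval \<xi> (s * t) = free_eval \<xi> s * free_eval \<xi> t"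
    unfolding free_eval_linear_ext by (rule linear_ext_mult) (auto simp: vector_space_complex)
qed (auto simp: free_eval_linear_ext poly_eval.linear_ext_add poly_eval.linear_ext_diff gen_def)

context ground_field
begin

lemma ideal_free_eval_kernel:
  "ideal {t \<in> carrier (free_algebra L). free_eval \<xi> t = 0} (free_algebra L)" (is "ideal ?K _")
proof (rule idealI[OF ring_free_algebra])
  interpret ring "free_algebra L" by (rule ring_free_algebra)
  show "subgroup ?K (add_monoid (free_algebra L))"
  proof (rule add.subgroupI)
    have "0 \<in> ?K" using zero_closed by (auto simp: free_algebra_ops)
    then show "?K \<noteq> {}" by blast
    fix a assume a: "a \<in> ?K"
    then have "\<ominus>\<^bsub>free_algebra L\<^esub> a = - a"
      by (intro minus_equality) (use free_algebra_closed(3)[of a L a] in \<open>auto simp: free_algebra_def\<close>)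
    then show "\<ominus>\<^bsub>free_algebra L\<^esub> a \<in> ?K"
      using a free_algebra_closed(3)[of a L a] free_eval_simps(3)[of \<xi> 0 a] by auto
    fix b assume b: "b \<in> ?K"
    then show "a \<oplus>\<^bsub>free_algebra L\<^esub> b \<in> ?K"
      using a free_algebra_closed(1)[of a L b] by (auto simp: free_algebra_def)
  qed auto
  fix a x assume "a \<in> ?K" "x \<in> carrier (free_algebra L)"
  then show "x \<otimes>\<^bsub>free_algebra L\<^esub> a \<in> ?K" "a \<otimes>\<^bsub>free_algebra L\<^esub> x \<in> ?K"
    using free_algebra_closed(2)[of a L x] free_algebra_closed(2)[of x L a]
    by (auto simp: free_algebra_def)
qed

lemma linear_rels_carrier: "linear_rels (cplx (gl F n)) \<subseteq> carrier (free_algebra (cplx (gl F n)))"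
  unfolding linear_rels_def
  by (intro Un_least subsetI; elim CollectE exE conjE; hypsubst;
      intro free_algebra_closed gen_in_free_algebra const_in_free_algebra lie_closed; assumption)

lemma env_ideal_ideal: "ideal (env_ideal (cplx (gl F n))) (free_algebra (cplx (gl F n)))"
  unfolding env_ideal_def
  by (intro ring.genideal_ideal ring_free_algebra Un_least linear_rels_carrier subsetI;
      elim CollectE exE conjE; hypsubst;
      intro free_algebra_closed gen_in_free_algebra lie_closed; assumption)

lemma sym_ideal_ideal: "ideal (sym_ideal (cplx (gl F n))) (free_algebra (cplx (gl F n)))"
  unfolding sym_ideal_def
  by (intro ring.genideal_ideal ring_free_algebra Un_least linear_rels_carrier subsetI;
      elim CollectE exE conjE; hypsubst; intro free_algebra_closed gen_in_free_algebra; assumption)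

lemma free_eval_sym_ideal:
  assumes "\<xi> \<in> lie_dual (cplx (gl F n))" and "t \<in> sym_ideal (cplx (gl F n))"
  shows "free_eval \<xi> t = 0"
proof -
  let ?L = "cplx (gl F n)"
  interpret ring "free_algebra ?L" by (rule ring_free_algebra)
  have "sym_ideal ?L \<subseteq> {t \<in> carrier (free_algebra ?L). free_eval \<xi> t = 0}"
    unfolding sym_ideal_def
  proof (rule genideal_minimal[OF ideal_free_eval_kernel], intro Un_least)
    have "free_eval \<xi> t = 0" if "t \<in> linear_rels ?L" for t
      using that assms(1) unfolding linear_rels_def lie_dual_def
      by (elim UnE CollectE exE conjE) simp_all
    then show "linear_rels ?L \<subseteq> {t \<in> carrier (free_algebra ?L). free_eval \<xi> t = 0}"
      using linear_rels_carrier by blast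
    show "{gen x * gen y - gen y * gen x |x y. x \<in> ?L \<and> y \<in> ?L}
        \<subseteq> {t \<in> carrier (free_algebra ?L). free_eval \<xi> t = 0}"
      by (auto intro!: free_algebra_closed gen_in_free_algebra)
  qed
  then show ?thesis using assms(2) by auto
qed

text \<open>The kernel of evaluation at \<xi> descends to an ideal of the symmetric algebra. It
  contains the generated ideal as soon as it contains the symbols, and these can be tested on
  representatives in the free algebra.\<close>

lemma annihilator_varietyI:
  fixes sm :: "complex \<Rightarrow> 'v::ab_group_add \<Rightarrow> 'v" and n :: nat
  defines "L \<equiv> cplx (gl F n)"
  assumes dual: "\<xi> \<in> lie_dual L"
    and sym: "\<And>e t. t \<in> free_filtration L e \<Longrightarrow> (\<And>v. free_act sm \<rho> t v = 0) \<Longrightarrow>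
      free_eval \<xi> (degree_part e t) = 0"
  shows "\<xi> \<in> annihilator_variety L sm \<rho>"
proof -
  interpret A: ring "free_algebra L" by (rule ring_free_algebra)
  interpret E: ideal "env_ideal L" "free_algebra L" unfolding L_def by (rule env_ideal_ideal)
  interpret S: ideal "sym_ideal L" "free_algebra L" unfolding L_def by (rule sym_ideal_ideal)
  interpret Q: ring "sym_algebra L" unfolding sym_algebra_def by (rule S.quotient_is_ring)
  define K where "K = {t \<in> carrier (free_algebra L). free_eval \<xi> t = 0}"
  have "Idl\<^bsub>sym_algebra L\<^esub> {s. \<exists>u\<in>annihilator L sm \<rho>. is_symbol L u s} \<subseteq> sym_class L ` K"
  proof (rule Q.genideal_minimal)
    show "ideal (sym_class L ` K) (sym_algebra L)"
      unfolding sym_class_def sym_algebra_def K_def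
      by (rule A.ring_ideal_imp_quot_ideal[OF S.ideal_axioms ideal_free_eval_kernel])
    show "{s. \<exists>u\<in>annihilator L sm \<rho>. is_symbol L u s} \<subseteq> sym_class L ` K"
    proof safe
      fix u s assume u: "u \<in> annihilator L sm \<rho>" "is_symbol L u s"
      then obtain d t where t: "t \<in> free_filtration L d" "u = env_class L t"
        "s = sym_class L (degree_part d t)" by (auto simp: is_symbol_def)
      have tc: "t \<in> carrier (free_algebra L)" using t by (auto simp: free_filtration_def)
      have "0 \<in> env_ideal L" using E.zero_closed by (simp add: free_algebra_ops)
      then have "t \<in> u" unfolding t env_class_def
        by (force simp: a_r_coset_def r_coset_def free_algebra_def)
      then have "free_eval \<xi> (degree_part d t) = 0"
        using u by (intro sym[OF t(1)]) (auto simp: annihilator_def)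
      moreover have "degree_part d t \<in> carrier (free_algebra L)"
      proof -
        have "Poly_Mapping.keys (degree_part d t) \<subseteq> Poly_Mapping.keys t"
          unfolding degree_part_def
          by (rule subset_trans[OF Poly_Mapping.keys_sum]) auto
        then show ?thesis using tc by (auto simp: free_algebra_def)
      qed
      ultimately show "s \<in> sym_class L ` K" unfolding t K_def by auto
    qed
  qed
  moreover have "free_eval \<xi> t = 0" if "k \<in> K" "t \<in> sym_class L k" for k t
  proof -
    have "\<exists>j\<in>sym_ideal L. t = j + k"
      using that by (auto simp: sym_class_def a_r_coset_def r_coset_def free_algebra_def)
    then show ?thesis
      using free_eval_sym_ideal[OF dual[unfolded L_def]] that by (auto simp: K_def L_def)
  qed
  ultimately show ?thesis using dual unfolding annihilator_variety_def by blast
qed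

end

section \<open>Points and relations in coordinates\<close>

context gl_module
begin

abbreviation U where "U \<equiv> (UNIV :: bool set) \<times> {..<n} \<times> {..<n}"

definition point :: "(bool \<times> nat \<times> nat \<Rightarrow> complex) \<Rightarrow> lie \<Rightarrow> complex" where
  "point c = restrict (\<lambda>z. \<Sum>i\<in>U. c i * coord z i) L"

definition letter_expansion :: "lie \<Rightarrow> (bool \<times> nat \<times> nat) free_alg" where
  "letter_expansion x = (\<Sum>i\<in>U. Poly_Mapping.single (Word [i]) (coord x i))"

text \<open>A homomorphism from the free algebra on all elements of the Lie algebra to the free
  algebra on the basis indices. A letter becomes a combination of single letters, so the length
  filtration is respected.\<close>

definition expansion :: "lie free_alg \<Rightarrow> (bool \<times> nat \<times> nat) free_alg" where
  "expansion = linear_ext pscale (\<lambda>w. prod_list (map letter_expansion (letters w)))"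

lemma point_in_dual: "point c \<in> lie_dual L"
proof -
  have "point c (lie_add x y) = point c x + point c y" if "x \<in> L" "y \<in> L" for x y
    using that lie_closed[OF that]
    by (auto simp: point_def coord_add distrib_left sum.distrib intro!: sum.cong
        simp flip: sum.distrib)
  moreover have "point c (lie_smult b x) = b * point c x" if "x \<in> L" for x b
    using that lie_closed(2)[OF that that]
    by (auto simp: point_def coord_smult sum_distrib_left intro!: sum.cong)
  ultimately show ?thesis by (auto simp: lie_dual_def point_def)
qed

lemma word_op_sum: "word_op sm T (sum g A) v = (\<Sum>i\<in>A. word_op sm T (g i) v)"
  by (induction A rule: infinite_finite_induct) auto

lemma word_op_letter_expansion:
  assumes "x \<in> L"
  shows "word_op sm T (letter_expansion x) v = \<rho> x v"
  unfolding letter_expansion_def word_op_sum rho_expand[OF assms] by simp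

lemma word_op_expansion:
  assumes "t \<in> carrier (free_algebra L)"
  shows "word_op sm T (expansion t) v = free_act sm \<rho> t v"
proof -
  have 1: "word_op sm T (prod_list (map letter_expansion xs)) v = foldr \<rho> xs v" if "set xs \<subseteq> L" for xs
    using that
  proof (induction xs)
    case Nil
    show ?case by (simp flip: single_one)
  qed (auto simp: word_op_mult word_op_letter_expansion)
  have "word_op sm T (expansion t) v =
      lext (\<lambda>w. word_op sm T (prod_list (map letter_expansion (letters w))) v) t"
    unfolding expansion_def
    by (rule linear_ext_compose) (auto simp: vs word_op_single_mult)
  also have "\<dots> = lext (\<lambda>w. foldr \<rho> (letters w) v) t"
    using assms by (intro linear_ext_cong 1) (auto simp: free_algebra_def)
  finally show ?thesis by (simp add: free_act_def linear_ext_def)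
qed

lemma top_symbol_letter_expansion_mult:
  "top_symbol e (letter_expansion x * t) =
     (if e = 0 then 0 else (\<Sum>i\<in>U. Poly_Mapping.single {#i#} (coord x i)) * top_symbol (e - 1) t)"
proof -
  have "top_symbol e (sum g A) = (\<Sum>i\<in>A. top_symbol e (g i))" 
    for g :: "_ \<Rightarrow> (bool \<times> nat \<times> nat) free_alg" and A :: "(bool \<times> nat \<times> nat) set"
    by (induction A rule: infinite_finite_induct) auto
  then show ?thesis
    by (auto simp: letter_expansion_def sum_distrib_right top_symbol_single_mult)
qed

lemma expansion_filtration:
  assumes "\<forall>w\<in>Poly_Mapping.keys t. length (letters w) \<le> e"
  shows "\<forall>w\<in>Poly_Mapping.keys (expansion t). length (letters w) \<le> e"
proof -
  have 1: "length (letters w) = length xs"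
    if "w \<in> Poly_Mapping.keys (prod_list (map letter_expansion xs))" for xs w
    using that
  proof (induction xs arbitrary: w)
    case Nil
    then show ?case by simp
  next
    case (Cons x xs)
    then obtain a b where w: "w = a + b" "a \<in> Poly_Mapping.keys (letter_expansion x)"
      "b \<in> Poly_Mapping.keys (prod_list (map letter_expansion xs))"
      using keys_mult by fastforce
    have "Poly_Mapping.keys (letter_expansion x) \<subseteq> (\<lambda>i. Word [i]) ` UNIV"
      unfolding letter_expansion_def by (rule subset_trans[OF Poly_Mapping.keys_sum]) auto
    with w Cons.IH show ?case by auto
  qed
  have "Poly_Mapping.keys (expansion t) \<subseteq>
      (\<Union>w\<in>Poly_Mapping.keys t. Poly_Mapping.keys (prod_list (map letter_expansion (letters w))))"
    unfolding expansion_def linear_ext_def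
    by (rule subset_trans[OF Poly_Mapping.keys_sum]) (use keys_single_mult in \<open>fastforce\<close>)
  then show ?thesis using 1 assms by fastforce
qed

text \<open>The value of the degree \<open>e\<close> part at \<open>point c\<close> equals the value
  at \<open>c\<close> of the top symbol of the expansion, and that symbol belongs to
  \<open>symbol_ideal\<close>.\<close>

lemma free_eval_degree_part:
  assumes c: "\<And>p. p \<in> symbol_ideal sm T \<Longrightarrow> poly_eval c p = 0"
    and t: "t \<in> free_filtration L e" and zero: "\<And>v. free_act sm \<rho> t v = 0"
  shows "free_eval (point c) (degree_part e t) = 0"
proof -
  have tc: "t \<in> carrier (free_algebra L)" and len: "\<forall>w\<in>Poly_Mapping.keys t. length (letters w) \<le> e"
    using t by (auto simp: free_filtration_def)
  have "top_symbol e (expansion t) \<in> symbol_ideal sm T"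
    using expansion_filtration[OF len] zero
    by (intro top_symbol_in_symbol_ideal) (auto simp: word_op_expansion[OF tc])
  from c[OF this] have "0 = poly_eval c (top_symbol e (expansion t))" ..
  also have "\<dots> = linear_ext (*)
      (\<lambda>w. poly_eval c (top_symbol e (prod_list (map letter_expansion (letters w))))) t"
    unfolding expansion_def
    by (rule linear_ext_compose) (auto simp: vector_space_complex top_symbol_single_mult)
  also have "\<dots> = linear_ext (*)
      (\<lambda>w. if length (letters w) = e then prod_list (map (point c) (letters w)) else 0) t"
  proof (rule poly_eval.linear_ext_cong)
    fix w assume "w \<in> Poly_Mapping.keys t"
    then have "set (letters w) \<subseteq> L" using tc by (auto simp: free_algebra_def)
    moreover have "poly_eval c (top_symbol e (prod_list (map letter_expansion xs))) =
        (if length xs = e then prod_list (map (point c) xs) else 0)" if "set xs \<subseteq> L" for xs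
      using that
    proof (induction xs arbitrary: e)
      case Nil
      show ?case by (auto simp flip: single_one)
    next
      case (Cons x xs)
      then have "point c x = poly_eval c (\<Sum>i\<in>U. Poly_Mapping.single {#i#} (coord x i))"
        by (simp add: point_def mult.commute)
      then show ?case
        using Cons by (cases e) (simp_all add: top_symbol_letter_expansion_mult del: poly_eval_simps(6))
    qed
    ultimately show "poly_eval c (top_symbol e (prod_list (map letter_expansion (letters w)))) =
      (if length (letters w) = e then prod_list (map (point c) (letters w)) else 0)" by blast
  qed
  also have "\<dots> = (\<Sum>w\<in>{w \<in> Poly_Mapping.keys t. length (letters w) = e}.
      Poly_Mapping.lookup t w * prod_list (map (point c) (letters w)))"
    unfolding linear_ext_def by (rule sum.mono_neutral_cong_right) auto
  also have "\<dots> = free_eval (point c) (degree_part e t)"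
  proof -
    have "free_eval \<xi> (sum g A) = (\<Sum>i\<in>A. free_eval \<xi> (g i))" for \<xi> g and A :: "lie word set"
      by (induction A rule: infinite_finite_induct) auto
    then show ?thesis by (simp add: degree_part_def)
  qed
  finally show ?thesis by simp
qed

lemma point_in_annihilator_variety:
  assumes "\<And>p. p \<in> symbol_ideal sm T \<Longrightarrow> poly_eval c p = 0"
  shows "point c \<in> annihilator_variety L sm \<rho>"
  using free_eval_degree_part[OF assms] by (intro annihilator_varietyI point_in_dual) auto

section \<open>Nilpotency of the radical\<close>

text \<open>The transposition comes from the trace form. The entry type is left open because the
  matrix of variables, \<open>generic_mat\<close>, is built the same way.\<close>

definition point_mat :: "(bool \<times> nat \<times> nat \<Rightarrow> 'b) \<Rightarrow> bool \<Rightarrow> 'b mat" where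
  "point_mat c s = mat n n (\<lambda>(i, j). c (s, j, i))"

lemma trace_point_mat:
  assumes "Z \<in> carrier_mat n n"
  shows "mat_trace (point_mat c s * Z) = (\<Sum>(a, b)\<in>{..<n} \<times> {..<n}. c (s, a, b) * Z $$ (a, b))"
proof -
  have A: "point_mat c s \<in> carrier_mat n n" by (simp add: point_mat_def)
  have "mat_trace (point_mat c s * Z) = (\<Sum>b<n. \<Sum>a<n. c (s, a, b) * Z $$ (a, b))"
    unfolding mat_trace_def
  proof (rule sum.cong)
    show "{..<dim_row (point_mat c s * Z)} = {..<n}" using A by auto
    fix b assume "b \<in> {..<n}"
    then show "(point_mat c s * Z) $$ (b, b) = (\<Sum>a<n. c (s, a, b) * Z $$ (a, b))"
      by (subst mat_mult_entry[OF A assms]) (auto simp: point_mat_def)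
  qed
  also have "\<dots> = (\<Sum>a<n. \<Sum>b<n. c (s, a, b) * Z $$ (a, b))" by (rule sum.swap)
  finally show ?thesis by (simp add: sum.cartesian_product)
qed

lemma point_mat_nilpotent:
  assumes c: "\<And>p. p \<in> symbol_ideal sm T \<Longrightarrow> poly_eval c p = 0"
    and depth: "depth F n sm \<rho> \<le> enat d" and s: "F = \<real> \<longrightarrow> \<not> s"
  shows "point_mat c s ^\<^sub>m d = 0\<^sub>m n n"
proof -
  define D where "D = {d. \<forall>\<xi> \<in> annihilator_variety L sm \<rho>. nilpotent_functional F n d \<xi>}"
  have Inf: "Inf (enat ` D) \<le> enat d" using depth by (simp add: depth_def D_def)
  \<comment> \<open>The infimum of the empty set is infinite. Otherwise the infimum is attained at
    some \<open>d'\<close>, and nilpotency passes from \<open>d'\<close> up to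
    \<open>d\<close>.\<close>
  then have "D \<noteq> {}" by (auto simp: top_enat_def)
  then have "Inf (enat ` D) \<in> enat ` D" by (auto intro: wellorder_InfI)
  then obtain d' where d': "d' \<in> D" "d' \<le> d" using Inf by auto
  then have nil: "nilpotent_functional F n d' (point c)"
    using point_in_annihilator_variety[OF c] by (auto simp: D_def)
  have carrier: "point_mat c s \<in> carrier_mat n n" for s by (simp add: point_mat_def)
  have proj: "proj_hol z \<in> carrier_mat n n" "proj_antihol z \<in> carrier_mat n n" if "z \<in> L" for z
    using that by (cases z; auto simp: proj_hol_def proj_antihol_def cplx_def gl_iff)+
  have val: "point c z = mat_trace (point_mat c False * proj_hol z) +
      mat_trace (point_mat c True * proj_antihol z)" if "z \<in> L" for z
  proof -
    have "point c z = (\<Sum>s\<in>UNIV. \<Sum>p\<in>{..<n} \<times> {..<n}. c (s, p) * coord z (s, p))"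
      using that by (simp add: point_def sum.cartesian_product split_def)
    also have "\<dots> = (\<Sum>(a, b)\<in>{..<n} \<times> {..<n}. c (False, a, b) * proj_hol z $$ (a, b)) +
       (\<Sum>(a, b)\<in>{..<n} \<times> {..<n}. c (True, a, b) * proj_antihol z $$ (a, b))"
      unfolding UNIV_bool using that
      by (cases z) (auto simp: coord_def proj_hol_def proj_antihol_def cplx_def gl_iff add.commute
          intro!: arg_cong2[of _ _ _ _ "(+)"] sum.cong)
    finally show ?thesis by (simp only: trace_point_mat proj[OF that])
  qed
  have "point_mat c s ^\<^sub>m d' = 0\<^sub>m n n"
  proof (cases "F = \<real>")
    case True
    \<comment> \<open>Over the reals a letter of the second copy acts by zero, hence the variable
      itself lies in \<open>symbol_ideal\<close>.\<close>
    have "c (True, a, b) = 0" for a b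
    proof -
      have "T (True, a, b) v = 0" for v using True by (intro T_zero) auto
      then have "top_symbol 1 (gen (True, a, b)) \<in> symbol_ideal sm T"
        by (intro top_symbol_in_symbol_ideal) (simp_all add: gen_def)
      from c[OF this] show ?thesis by (simp add: gen_def)
    qed
    then have "mat_trace (point_mat c True * Z) = 0" if "Z \<in> carrier_mat n n" for Z
      unfolding trace_point_mat[OF that] by (intro sum.neutral) auto
    then have "\<forall>z\<in>L. point c z = mat_trace (point_mat c False * proj_hol z)"
      using val proj by simp
    then show ?thesis using nil True s carrier unfolding nilpotent_functional_def by auto
  next
    case False
    have "point_mat c False ^\<^sub>m d' = 0\<^sub>m n n \<and> point_mat c True ^\<^sub>m d' = 0\<^sub>m n n"
      using nil val carrier unfolding nilpotent_functional_def if_not_P[OF False] by blast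
    then show ?thesis by (cases s) auto
  qed
  then have "point_mat c s ^\<^sub>m (d' + k) = 0\<^sub>m n n" for k
    by (induction k) (simp_all add: left_mult_zero_mat[OF carrier])
  from this[of "d - d'"] d' show ?thesis by simp
qed

end

lemma foldr_replicate: "foldr f (replicate k x) v = (f x ^^ k) v"
  by (induction k) auto

section \<open>The generic matrix and the weight one part of its powers\<close>

context gl_module
begin

definition generic_mat :: "bool \<Rightarrow> (bool \<times> nat \<times> nat) polyn mat" where
  "generic_mat = point_mat (\<lambda>i. Poly_Mapping.single {#i#} 1)"

lemma generic_mat_carrier: "generic_mat s \<in> carrier_mat n n"
  by (simp add: generic_mat_def point_mat_def)

lemma generic_mat_power_in_symbol_ideal:
  assumes "depth F n sm \<rho> \<le> enat d" and "F = \<real> \<longrightarrow> \<not> s" and "i < n" "j < n"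
  shows "\<exists>k. ((generic_mat s ^\<^sub>m d) $$ (i, j)) ^ k \<in> symbol_ideal sm T"
proof (rule Nullstellensatz[OF pideal_symbol_ideal])
  fix c :: "bool \<times> nat \<times> nat \<Rightarrow> complex"
  assume "\<And>p. p \<in> symbol_ideal sm T \<Longrightarrow> poly_eval c p = 0"
  from point_mat_nilpotent[OF this assms(1,2)] have nil: "point_mat c s ^\<^sub>m d = 0\<^sub>m n n" .
  interpret h: semiring_hom "poly_eval c" by unfold_locales auto
  have "map_mat (poly_eval c) (generic_mat s) = point_mat c s"
    by (auto simp: generic_mat_def point_mat_def intro!: eq_matI)
  then have "map_mat (poly_eval c) (generic_mat s ^\<^sub>m d) = 0\<^sub>m n n"
    using nil h.mat_hom_pow[OF generic_mat_carrier] by simp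
  then show "poly_eval c ((generic_mat s ^\<^sub>m d) $$ (i, j)) = 0"
    using assms(3,4) pow_carrier_mat[OF generic_mat_carrier, of s d]
    by (metis carrier_matD index_map_mat(1) index_zero_mat(1))
qed

text \<open>The superdiagonal letters, from the last column backwards: the order in which a path
  leaving row \<open>n - 1\<close> meets them.\<close>

definition chain :: "bool \<Rightarrow> nat \<Rightarrow> (bool \<times> nat \<times> nat) list" where
  "chain s k = map (\<lambda>l. (s, n - 2 - l, n - 1 - l)) [0..<k]"

lemma generic_mat_weight_one_power:
  assumes W: "weighted_operators sm T (weight n d) (\<rho> (grading_elt n d)) R"
    and d: "1 \<le> d" "d \<le> n" and i: "i < n - d"
  shows "weighted_operators.weight_one_part (weight n d) ((generic_mat s ^\<^sub>m d) $$ (n - 1, i)) =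
    Poly_Mapping.single (mset (chain s (d - 1) @ [(s, i, n - d)])) 1"
proof -
  interpret W: weighted_operators sm T "weight n d" "\<rho> (grading_elt n d)" R by fact
  interpret h: semiring_hom W.weight_one_part by unfold_locales (auto simp: W.weight_one_part_mult)
  define A where "A = map_mat W.weight_one_part (generic_mat s)"
  have A: "A \<in> carrier_mat n n" using generic_mat_carrier by (simp add: A_def)
  have entry: "A $$ (r, j) = (if weight n d (s, j, r) = 1 then Poly_Mapping.single {#(s, j, r)#} 1 else 0)"
    if "r < n" "j < n" for r j
    using that by (simp add: A_def generic_mat_def point_mat_def)
  have step: "(A ^\<^sub>m Suc k) $$ (n - 1, j) = Poly_Mapping.single (mset (chain s k)) 1 * A $$ (n - 1 - k, j)"
    if "\<And>r. r < n \<Longrightarrow> (A ^\<^sub>m k) $$ (n - 1, r) =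
      (if r = n - 1 - k then Poly_Mapping.single (mset (chain s k)) 1 else 0)" "j < n" for k j
  proof -
    have "(A ^\<^sub>m Suc k) $$ (n - 1, j) = (\<Sum>r<n. (A ^\<^sub>m k) $$ (n - 1, r) * A $$ (r, j))"
      using that A pow_carrier_mat[OF A, of k]
      by (simp add: scalar_prod_def atLeast0LessThan)
    also have "\<dots> = (\<Sum>r<n. if r = n - 1 - k
        then Poly_Mapping.single (mset (chain s k)) 1 * A $$ (r, j) else 0)"
      using that(1) by (intro sum.cong) auto
    finally show ?thesis using that(2) by simp
  qed
  have row: "(A ^\<^sub>m k) $$ (n - 1, j) =
      (if j = n - 1 - k then Poly_Mapping.single (mset (chain s k)) 1 else 0)" if "k < d" "j < n" for k j
    using that
  proof (induction k arbitrary: j)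
    case 0
    then show ?case using A by (auto simp: chain_def)
  next
    case (Suc k)
    have "(A ^\<^sub>m Suc k) $$ (n - 1, j) = Poly_Mapping.single (mset (chain s k)) 1 * A $$ (n - 1 - k, j)"
      using Suc by (intro step) auto
    \<comment> \<open>Row \<open>n - 1 - k\<close> has height \<open>d - k\<close>, which is at
      least 2 here, and positive heights determine the index.\<close>
    moreover have "weight n d (s, j, n - 1 - k) = 1 \<longleftrightarrow> j = n - 1 - Suc k"
      using Suc.prems d by (auto simp: weight_def height_def)
    moreover have "n - 1 - k < n" using d by simp
    moreover have "n - 1 - Suc k = n - 2 - k" by simp
    ultimately show ?case using Suc.prems by (simp add: entry mult_single chain_def)
  qed
  \<comment> \<open>The last step is separate: it ends at height 0, shared by all indices below
    \<open>n - d\<close>, and the prescribed column \<open>i\<close> makes the choice.\<close>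
  have "(A ^\<^sub>m Suc (d - 1)) $$ (n - 1, i) =
      Poly_Mapping.single (mset (chain s (d - 1))) 1 * A $$ (n - 1 - (d - 1), i)"
    using i d by (intro step row) auto
  moreover have "n - 1 - (d - 1) = n - d" "Suc (d - 1) = d" using d by auto
  moreover have "weight n d (s, i, n - d) = 1" using i by (simp add: weight_def height_def)
  moreover have "W.weight_one_part ((generic_mat s ^\<^sub>m d) $$ (n - 1, i)) = (A ^\<^sub>m d) $$ (n - 1, i)"
    unfolding A_def h.mat_hom_pow[OF generic_mat_carrier, symmetric]
    using i pow_carrier_mat[OF generic_mat_carrier, of s d] by (subst index_map_mat(1)) auto
  ultimately show ?thesis using i d by (simp add: entry mult_single)
qed

text \<open>By \<open>char\<close> every superdiagonal factor of the surviving monomial acts by a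
  nonzero scalar modulo \<open>R\<close>; dividing by these scalars leaves a power of the root
  vector in column \<open>n - d\<close>.\<close>

theorem root_vector_nilpotent:
  assumes depth: "depth F n sm \<rho> \<le> enat d" and s: "F = \<real> \<longrightarrow> \<not> s"
    and d: "1 \<le> d" "d \<le> n" and i: "i < n - d"
    and R: "subspace R"
    and char: "\<And>s a b v. n - d < b \<Longrightarrow> b < n \<Longrightarrow> a < b \<Longrightarrow>
      T (s, a, b) v - sm (if Suc a = b then \<kappa> s else 0) v \<in> R"
    and \<kappa>: "\<kappa> s \<noteq> 0"
  shows "\<exists>k. \<forall>v. (T (s, i, n - d) ^^ k) v \<in> R"
proof -
  \<comment> \<open>Heights of neighbouring indices differ by at most 1, so weight at least 2
    excludes the superdiagonal, and the target height at least 2 means a column beyond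
    \<open>n - d\<close>. There the character is zero.\<close>
  have high: "T x v \<in> R" if "weight n d x \<ge> 2" for x v
  proof -
    obtain s' a b where x: "x = (s', a, b)" by (cases x)
    show ?thesis
    proof (cases "b < n")
      case True
      then have "n - d < b" "a < b" "Suc a \<noteq> b"
        using that by (auto simp: x weight_def height_def)
      then show ?thesis using char[of b a s' v] True by (simp add: x)
    next
      case False
      then have "T x v = 0" unfolding x by (intro T_zero) auto
      then show ?thesis using subspace_0[OF R] by simp
    qed
  qed
  note W = weighted_operators_T[OF R high]
  interpret W: weighted_operators sm T "weight n d" "\<rho> (grading_elt n d)" R by (rule W)
  obtain k where k: "((generic_mat s ^\<^sub>m d) $$ (n - 1, i)) ^ k \<in> symbol_ideal sm T"
    using generic_mat_power_in_symbol_ideal[OF depth s, of "n - 1" i] i by fastforce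
  define c where "c = chain s (d - 1)"
  define us where "us = concat (replicate k c)"
  have c_mem: "\<exists>a. x = (s, a, Suc a) \<and> n - d < Suc a \<and> Suc a < n" if x: "x \<in> set c" for x
  proof -
    obtain l where "l < d - 1" "x = (s, n - 2 - l, n - 1 - l)" using x by (auto simp: c_def chain_def)
    then show ?thesis using d i by (intro exI[of _ "n - 2 - l"]) auto
  qed
  \<comment> \<open>The superdiagonal letters are placed on the left. They are applied last, which
    is where they act as scalars modulo \<open>R\<close>.\<close>
  have "mset (us @ replicate k (s, i, n - d)) = repeat_mset k (mset (c @ [(s, i, n - d)]))"
    unfolding us_def by (induction k) auto
  moreover have "\<forall>x\<in>#mset (c @ [(s, i, n - d)]). weight n d x = 1"
  proof -
    have "weight n d (s, a, Suc a) = 1" if "n - d < Suc a" for a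
      using that by (auto simp: weight_def height_def)
    moreover have "weight n d (s, i, n - d) = 1" using i by (simp add: weight_def height_def)
    ultimately show ?thesis using c_mem by fastforce
  qed
  ultimately have word: "foldr T (us @ replicate k (s, i, n - d)) v \<in> R" for v
    using W.power_in_symbol_ideal[OF k generic_mat_weight_one_power[OF W d i]]
    by (simp only: c_def)
  have scalar: "foldr T xs v - sm (\<kappa> s ^ length xs) v \<in> R" if "set xs \<subseteq> set c" for xs v
    using that
  proof (induction xs)
    case Nil
    then show ?case using subspace_0[OF R] by simp
  next
    case (Cons x xs)
    obtain a where a: "x = (s, a, Suc a)" "n - d < Suc a" "Suc a < n"
      using c_mem[of x] Cons.prems by auto
    have "T x (foldr T xs v) - sm (\<kappa> s) (foldr T xs v) \<in> R"
      using char[of "Suc a" a s] a by auto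
    moreover have "sm (\<kappa> s) (foldr T xs v - sm (\<kappa> s ^ length xs) v) \<in> R"
      using Cons by (intro subspace_scale[OF R]) auto
    ultimately show ?case
      using subspace_add[OF R] by (fastforce simp: scale_right_diff_distrib)
  qed
  have "(T (s, i, n - d) ^^ k) v \<in> R" for v
  proof -
    define u where "u = (T (s, i, n - d) ^^ k) v"
    have "foldr T us u \<in> R" using word[of v] by (simp add: foldr_replicate u_def)
    moreover have "foldr T us u - sm (\<kappa> s ^ length us) u \<in> R"
      by (rule scalar) (auto simp: us_def)
    ultimately have "sm (\<kappa> s ^ length us) u \<in> R" using W.R_cong by blast
    then have "sm (inverse (\<kappa> s ^ length us)) (sm (\<kappa> s ^ length us) u) \<in> R"
      by (rule subspace_scale[OF R])
    then show ?thesis using \<kappa> by (simp add: u_def)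
  qed
  then show ?thesis by blast
qed

end

section \<open>The modules underlying the derivatives\<close>

definition embed_mat :: "complex mat \<Rightarrow> complex mat" where
  "embed_mat X = diag_block_mat [X, 0\<^sub>m 1 1]"

lemma lie_embed_eq: "lie_embed z = (embed_mat (fst z), embed_mat (snd z))"
  by (cases z) (simp add: embed_mat_def)

lemma embed_mat_eq:
  assumes "X \<in> carrier_mat m m"
  shows "embed_mat X = mat (Suc m) (Suc m) (\<lambda>(i, j). if i < m \<and> j < m then X $$ (i, j) else 0)"
  using assms unfolding embed_mat_def by (intro eq_matI) (auto simp: Let_def)

lemma embed_mat_carrier: "X \<in> carrier_mat m m \<Longrightarrow> embed_mat X \<in> carrier_mat (Suc m) (Suc m)"
  by (simp add: embed_mat_eq)

lemma embed_mat_smult: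
  assumes "X \<in> carrier_mat m m"
  shows "embed_mat (c \<cdot>\<^sub>m X) = c \<cdot>\<^sub>m embed_mat X" and "mat_trace (embed_mat X) = mat_trace X"
proof -
  have cX: "c \<cdot>\<^sub>m X \<in> carrier_mat m m" using assms by auto
  show "embed_mat (c \<cdot>\<^sub>m X) = c \<cdot>\<^sub>m embed_mat X"
    unfolding embed_mat_eq[OF assms] embed_mat_eq[OF cX] using assms by (intro eq_matI) auto
  show "mat_trace (embed_mat X) = mat_trace X"
    unfolding embed_mat_eq[OF assms] using assms by (auto simp: mat_trace_def)
qed

lemma embed_mat_simps:
  assumes "X \<in> carrier_mat m m" "Y \<in> carrier_mat m m"
  shows "embed_mat (X + Y) = embed_mat X + embed_mat Y"
    "embed_mat (X - Y) = embed_mat X - embed_mat Y"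
    "embed_mat (X * Y) = embed_mat X * embed_mat Y"
proof -
  have XY: "X + Y \<in> carrier_mat m m" "X - Y \<in> carrier_mat m m" "X * Y \<in> carrier_mat m m"
    using assms by auto
  note eqs = embed_mat_eq[OF assms(1)] embed_mat_eq[OF assms(2)] embed_mat_eq[OF XY(1)]
    embed_mat_eq[OF XY(2)] embed_mat_eq[OF XY(3)]
  show "embed_mat (X + Y) = embed_mat X + embed_mat Y"
    "embed_mat (X - Y) = embed_mat X - embed_mat Y"
    unfolding eqs using assms by (intro eq_matI; auto)+
  show "embed_mat (X * Y) = embed_mat X * embed_mat Y"
  proof (rule eq_matI)
    fix i j assume "i < dim_row (embed_mat X * embed_mat Y)" "j < dim_col (embed_mat X * embed_mat Y)"
    then have ij: "i < Suc m" "j < Suc m" by (auto simp: eqs)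
    have "(embed_mat X * embed_mat Y) $$ (i, j) =
        (\<Sum>k<Suc m. embed_mat X $$ (i, k) * embed_mat Y $$ (k, j))"
      using ij by (auto simp: eqs scalar_prod_def atLeast0LessThan)
    also have "\<dots> = (if i < m \<and> j < m then (\<Sum>k<m. X $$ (i, k) * Y $$ (k, j)) else 0)"
      using ij by (auto simp: eqs intro!: sum.neutral)
    also have "\<dots> = embed_mat (X * Y) $$ (i, j)"
      using ij assms by (auto simp: embed_mat_eq[OF XY(3)] scalar_prod_def atLeast0LessThan)
    finally show "embed_mat (X * Y) $$ (i, j) = (embed_mat X * embed_mat Y) $$ (i, j)" ..
  qed (auto simp: eqs)
qed

lemma mat_trace_smult: "X \<in> carrier_mat m m \<Longrightarrow> mat_trace (c \<cdot>\<^sub>m X) = c * mat_trace X"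
  by (auto simp: mat_trace_def sum_distrib_left)

lemma mat_trace_simps:
  assumes "X \<in> carrier_mat m m" "Y \<in> carrier_mat m m"
  shows "mat_trace (X + Y) = mat_trace X + mat_trace Y"
    "mat_trace (X - Y) = mat_trace X - mat_trace Y"
    "mat_trace (commutator X Y) = 0"
proof -
  show "mat_trace (X + Y) = mat_trace X + mat_trace Y"
    and "mat_trace (X - Y) = mat_trace X - mat_trace Y"
    using assms by (auto simp: mat_trace_def sum.distrib sum_subtractf)
  have mult: "mat_trace (A * B) = (\<Sum>i<m. \<Sum>k<m. A $$ (i, k) * B $$ (k, i))"
    if "A \<in> carrier_mat m m" "B \<in> carrier_mat m m" for A B
    using that by (auto simp: mat_trace_def scalar_prod_def atLeast0LessThan)
  have "mat_trace (X * Y) = mat_trace (Y * X)"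
    unfolding mult[OF assms] mult[OF assms(2,1)] by (subst sum.swap) (simp add: mult.commute)
  then show "mat_trace (commutator X Y) = 0"
    using assms by (simp add: mat_trace_def commutator_def sum_subtractf)
qed

section \<open>Embeddings, the determinant twist and one application of \<Phi>\<close>

context ground_field
begin

lemma cplx_carrier: "z \<in> cplx (gl F m) \<Longrightarrow> fst z \<in> carrier_mat m m \<and> snd z \<in> carrier_mat m m"
  by (cases z) (auto simp: cplx_def gl_iff)

lemma lie_embed_in: "z \<in> cplx (gl F m) \<Longrightarrow> lie_embed z \<in> cplx (gl F (Suc m))"
  by (cases z) (auto simp: lie_embed_eq cplx_def gl_iff embed_mat_eq)

lemma lie_embed_hom:
  assumes "x \<in> cplx (gl F m)" "y \<in> cplx (gl F m)"
  shows "lie_embed (lie_add x y) = lie_add (lie_embed x) (lie_embed y)"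
    "lie_embed (lie_smult c x) = lie_smult c (lie_embed x)"
    "lie_embed (lie_bracket x y) = lie_bracket (lie_embed x) (lie_embed y)"
proof -
  obtain X Y X' Y' where xy: "x = (X, Y)" "y = (X', Y')" by (cases x; cases y)
  have carrier: "X \<in> carrier_mat m m" "Y \<in> carrier_mat m m" "X' \<in> carrier_mat m m" "Y' \<in> carrier_mat m m"
    using assms by (auto simp: xy cplx_def gl_iff)
  have comm: "commutator A B \<in> carrier_mat m m"
    "embed_mat (commutator A B) = commutator (embed_mat A) (embed_mat B)"
    if "A \<in> carrier_mat m m" "B \<in> carrier_mat m m" for A B
    using that embed_mat_simps(3)[OF that] embed_mat_simps(3)[OF that(2,1)]
      embed_mat_simps(2)[of "A * B" m "B * A"] by (auto simp: commutator_def)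
  note simps = embed_mat_simps(1,2)[where m = m] embed_mat_smult(1)[where m = m]
  show "lie_embed (lie_add x y) = lie_add (lie_embed x) (lie_embed y)"
    "lie_embed (lie_smult c x) = lie_smult c (lie_embed x)"
    "lie_embed (lie_bracket x y) = lie_bracket (lie_embed x) (lie_embed y)"
    by (simp_all add: xy lie_embed_eq simps carrier comm smult_carrier_mat
        del: lie_embed.simps)
qed

lemma det_twist_hom:
  assumes "x \<in> cplx (gl F m)" "y \<in> cplx (gl F m)"
  shows "det_twist (lie_add x y) = det_twist x + det_twist y"
    "det_twist (lie_smult c x) = c * det_twist x"
    "det_twist (lie_bracket x y) = 0"
proof -
  obtain X Y X' Y' where xy: "x = (X, Y)" "y = (X', Y')" by (cases x; cases y)
  have carrier: "X \<in> carrier_mat m m" "Y \<in> carrier_mat m m" "X' \<in> carrier_mat m m" "Y' \<in> carrier_mat m m"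
    using assms by (auto simp: xy cplx_def gl_iff)
  have comm: "commutator A B \<in> carrier_mat m m"
    if "A \<in> carrier_mat m m" "B \<in> carrier_mat m m" for A B
    using that by (auto simp: commutator_def)
  note simps = mat_trace_simps[where m = m] mat_trace_smult[where m = m]
  show "det_twist (lie_add x y) = det_twist x + det_twist y"
    "det_twist (lie_bracket x y) = 0"
    by (simp_all add: xy det_twist_def cplx_ext_def simps carrier comm algebra_simps add_divide_distrib)
  show "det_twist (lie_smult c x) = c * det_twist x"
    unfolding xy det_twist_def cplx_ext_def lie_smult.simps fst_conv snd_conv
    by (simp only: simps carrier smult_carrier_mat)
      (rule complex_eqI; simp; simp add: add_divide_distrib diff_divide_distrib)
qed

text \<open>On the underlying space, before passing to the quotient, the twisted action is one of
  the full general linear Lie algebra, because \<open>det_twist\<close> is a character. Only the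
  stability of the relations is a matter of the mirabolic subalgebra.\<close>

lemma lie_module_Phi:
  assumes "lie_module (cplx (gl F (Suc m))) sm A"
  shows "lie_module (cplx (gl F m)) sm (\<lambda>x v. A (lie_embed x) v + sm (det_twist x) v)"
proof -
  from assms have vs: "vector_space sm"
    and lin: "\<And>x. x \<in> cplx (gl F (Suc m)) \<Longrightarrow> Vector_Spaces.linear sm sm (A x)"
    and add: "\<And>x y v. x \<in> cplx (gl F (Suc m)) \<Longrightarrow> y \<in> cplx (gl F (Suc m)) \<Longrightarrow> A (lie_add x y) v = A x v + A y v"
    and smult: "\<And>c x v. x \<in> cplx (gl F (Suc m)) \<Longrightarrow> A (lie_smult c x) v = sm c (A x v)"
    and bracket: "\<And>x y v. x \<in> cplx (gl F (Suc m)) \<Longrightarrow> y \<in> cplx (gl F (Suc m)) \<Longrightarrow>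
        A (lie_bracket x y) v = A x (A y v) - A y (A x v)"
    by (auto simp: lie_module_def)
  interpret V: vector_space sm by (rule vs)
  interpret P: vector_space_pair sm sm by unfold_locales
  note scale = V.scale_left_distrib V.scale_right_distrib V.scale_scale
  have A_simps: "A (lie_embed x) (u + v) = A (lie_embed x) u + A (lie_embed x) v"
    "A (lie_embed x) (sm c v) = sm c (A (lie_embed x) v)" if "x \<in> cplx (gl F m)" for x u v c
  proof -
    interpret l: Vector_Spaces.linear sm sm "A (lie_embed x)" by (rule lin[OF lie_embed_in[OF that]])
    show "A (lie_embed x) (u + v) = A (lie_embed x) u + A (lie_embed x) v"
      "A (lie_embed x) (sm c v) = sm c (A (lie_embed x) v)" by (simp_all add: l.add l.scale)
  qed
  show ?thesis unfolding lie_module_def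
  proof (intro conjI ballI allI)
    show "vector_space sm" by (rule vs)
    fix x assume x: "x \<in> cplx (gl F m)"
    show "Vector_Spaces.linear sm sm (\<lambda>v. A (lie_embed x) v + sm (det_twist x) v)"
      by (rule P.linear_compose_add[OF lin[OF lie_embed_in[OF x]] V.linear_scale_self])
    show "A (lie_embed (lie_smult c x)) v + sm (det_twist (lie_smult c x)) v =
      sm c (A (lie_embed x) v + sm (det_twist x) v)" for c v
      using lie_embed_in[OF x] lie_embed_hom(2)[OF x x] det_twist_hom(2)[OF x x]
      by (simp add: smult scale)
    fix y assume y: "y \<in> cplx (gl F m)"
    show "A (lie_embed (lie_add x y)) v + sm (det_twist (lie_add x y)) v =
      A (lie_embed x) v + sm (det_twist x) v + (A (lie_embed y) v + sm (det_twist y) v)" for v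
      using lie_embed_in x y lie_embed_hom(1)[OF x y] det_twist_hom(1)[OF x y]
      by (simp add: add scale)
    show "A (lie_embed (lie_bracket x y)) v + sm (det_twist (lie_bracket x y)) v =
      A (lie_embed x) (A (lie_embed y) v + sm (det_twist y) v) +
      sm (det_twist x) (A (lie_embed y) v + sm (det_twist y) v) -
      (A (lie_embed y) (A (lie_embed x) v + sm (det_twist x) v) +
      sm (det_twist y) (A (lie_embed x) v + sm (det_twist x) v))" for v
      using lie_embed_in x y lie_embed_hom(3)[OF x y] det_twist_hom(3)[OF x y]
      by (simp add: bracket A_simps scale mult.commute)
  qed
qed

lemma mirabolic_in_gl: "x \<in> cplx (mirabolic F m) \<Longrightarrow> x \<in> cplx (gl F m)"
  and mirabolic_rad_in_gl: "x \<in> cplx (mirabolic_rad F m) \<Longrightarrow> x \<in> cplx (gl F m)"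
  by (auto simp: cplx_def mirabolic_def mirabolic_rad_def)

lemma lie_embed_in_mirabolic: "x \<in> cplx (gl F m) \<Longrightarrow> lie_embed x \<in> cplx (mirabolic F (Suc m))"
  using lie_embed_in[of x m]
  by (cases x) (auto simp: lie_embed_eq cplx_def mirabolic_def gl_iff embed_mat_eq)

text \<open>The bracket is the matrix \<open>X\<close> applied to the column of \<open>A\<close>.
  The entry seen by the character is the last row of \<open>X\<close> times that column, so the
  mirabolic subalgebra fixes the character.\<close>

lemma commutator_embed_rad:
  assumes X: "X \<in> gl F m" and A: "A \<in> mirabolic_rad F (Suc m)"
  shows "commutator (embed_mat X) A \<in> mirabolic_rad F (Suc m)"
    and "m \<noteq> 0 \<Longrightarrow> \<forall>j<m. X $$ (m - 1, j) = 0 \<Longrightarrow> commutator (embed_mat X) A $$ (m - 1, m) = 0"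
proof -
  have Xc: "X \<in> carrier_mat m m" "embed_mat X \<in> carrier_mat (Suc m) (Suc m)"
    using X by (auto simp: gl_iff embed_mat_carrier)
  have Ac: "A \<in> carrier_mat (Suc m) (Suc m)" and row: "\<And>j. j < Suc m \<Longrightarrow> A $$ (m, j) = 0"
    and col: "\<And>i j. i < Suc m \<Longrightarrow> j < Suc m \<Longrightarrow> j \<noteq> m \<Longrightarrow> A $$ (i, j) = 0"
    using A by (auto simp: mirabolic_rad_def mirabolic_def gl_iff)
  have XF: "embed_mat X \<in> gl F (Suc m)" using X by (auto simp: gl_iff embed_mat_eq)
  have entry: "commutator (embed_mat X) A $$ (i, j) =
     (if i < m \<and> j = m then (\<Sum>k<m. X $$ (i, k) * A $$ (k, m)) else 0)" if "i < Suc m" "j < Suc m" for i j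
  proof -
    have "(\<Sum>k<Suc m. A $$ (i, k) * embed_mat X $$ (k, j)) = 0"
    proof (intro sum.neutral ballI)
      fix k assume "k \<in> {..<Suc m}"
      then show "A $$ (i, k) * embed_mat X $$ (k, j) = 0"
        using that col[of i k] by (cases "k = m") (auto simp: embed_mat_eq[OF Xc(1)])
    qed
    moreover have "(\<Sum>k<Suc m. embed_mat X $$ (i, k) * A $$ (k, j)) =
      (if i < m \<and> j = m then (\<Sum>k<m. X $$ (i, k) * A $$ (k, m)) else 0)"
      using that row[of j] col by (auto simp: embed_mat_eq[OF Xc(1)] intro!: sum.neutral)
    ultimately show ?thesis
      using that Xc Ac mat_mult_entry[OF Xc(2) Ac that] mat_mult_entry[OF Ac Xc(2) that]
      by (simp add: commutator_def del: index_mult_mat(1))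
  qed
  have "A \<in> gl F (Suc m)" using A by (auto simp: mirabolic_rad_def mirabolic_def)
  then have "commutator (embed_mat X) A \<in> gl F (Suc m)" using XF gl_closed(4) by blast
  then show "commutator (embed_mat X) A \<in> mirabolic_rad F (Suc m)"
    by (auto simp: mirabolic_rad_def mirabolic_def entry)
  show "commutator (embed_mat X) A $$ (m - 1, m) = 0" if "m \<noteq> 0" "\<forall>j<m. X $$ (m - 1, j) = 0"
    using that by (subst entry) auto
qed

lemma mirabolic_rad_iff:
  "A \<in> mirabolic_rad F m \<longleftrightarrow>
     A \<in> gl F m \<and> (\<forall>i<m. \<forall>j<m. i = m - 1 \<or> j \<noteq> m - 1 \<longrightarrow> A $$ (i, j) = 0)"
  by (cases m) (auto simp: mirabolic_rad_def mirabolic_def)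

lemma rad_closed:
  assumes "A \<in> mirabolic_rad F m" "B \<in> mirabolic_rad F m"
  shows "A + B \<in> mirabolic_rad F m" "A - B \<in> mirabolic_rad F m"
proof -
  have g: "A \<in> gl F m" "B \<in> gl F m"
    and z: "\<And>i j. i < m \<Longrightarrow> j < m \<Longrightarrow> i = m - 1 \<or> j \<noteq> m - 1 \<Longrightarrow> A $$ (i, j) = 0 \<and> B $$ (i, j) = 0"
    using assms by (auto simp: mirabolic_rad_iff)
  have "dim_row B = m" "dim_col B = m" using g(2) by (auto simp: gl_iff)
  then have "(A + B) $$ (i, j) = A $$ (i, j) + B $$ (i, j)" "(A - B) $$ (i, j) = A $$ (i, j) - B $$ (i, j)"
    if "i < m" "j < m" for i j using that by simp_all
  then show "A + B \<in> mirabolic_rad F m" "A - B \<in> mirabolic_rad F m"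
    using z gl_closed(1,2)[OF g] unfolding mirabolic_rad_iff by simp_all
qed

lemma bracket_embed_rad:
  assumes x: "x \<in> cplx (gl F m)" and a: "\<alpha> \<in> cplx (mirabolic_rad F (Suc m))"
  shows "lie_bracket (lie_embed x) \<alpha> \<in> cplx (mirabolic_rad F (Suc m))"
    and "m \<noteq> 0 \<Longrightarrow> x \<in> cplx (mirabolic F m) \<Longrightarrow> psi (Suc m) (lie_bracket (lie_embed x) \<alpha>) = 0"
proof -
  obtain X Y A B where xy: "x = (X, Y)" "\<alpha> = (A, B)" by (cases x; cases \<alpha>)
  have mem: "X \<in> gl F m" "Y \<in> gl F m" "A \<in> mirabolic_rad F (Suc m)" "B \<in> mirabolic_rad F (Suc m)"
    using x a by (auto simp: xy cplx_def)
  show "lie_bracket (lie_embed x) \<alpha> \<in> cplx (mirabolic_rad F (Suc m))"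
    using mem by (auto simp: xy cplx_def lie_embed_eq simp del: lie_embed.simps
        intro!: rad_closed commutator_embed_rad(1))
  assume m: "m \<noteq> 0" and p: "x \<in> cplx (mirabolic F m)"
  have row: "\<forall>j<m. X $$ (m - 1, j) = 0" "\<forall>j<m. Y $$ (m - 1, j) = 0"
    using p by (auto simp: xy cplx_def mirabolic_def)
  have dims: "commutator (embed_mat Z) C \<in> carrier_mat (Suc m) (Suc m)"
    if "Z \<in> gl F m" "C \<in> mirabolic_rad F (Suc m)" for Z C
    using commutator_embed_rad(1)[OF that] by (auto simp: mirabolic_rad_def mirabolic_def gl_iff)
  note z = commutator_embed_rad(2)[OF _ _ m]
  show "psi (Suc m) (lie_bracket (lie_embed x) \<alpha>) = 0"
    using z[OF mem(1,3) row(1)] z[OF mem(1,4) row(1)] z[OF mem(2,3) row(2)] z[OF mem(2,4) row(2)]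
      dims[OF mem(1,3)] dims[OF mem(1,4)] dims[OF mem(2,3)] dims[OF mem(2,4)] m
    by (simp add: xy lie_embed_eq psi_def cplx_ext_def del: lie_embed.simps)
qed

lemma Phi_stable:
  assumes mod: "lie_module (cplx (gl F (Suc m))) sm (act M)" and "m \<noteq> 0"
    and R: "module.subspace sm (rels M)"
    and stable: "\<And>x v. x \<in> cplx (mirabolic F (Suc m)) \<Longrightarrow> v \<in> rels M \<Longrightarrow> act M x v \<in> rels M"
    and x: "x \<in> cplx (mirabolic F m)" and v: "v \<in> rels (Phi F sm (Suc m) M)"
  shows "act (Phi F sm (Suc m) M) x v \<in> rels (Phi F sm (Suc m) M)"
proof -
  interpret V: vector_space sm using mod by (simp add: lie_module_def)
  let ?G = "rels M \<union> {act M \<alpha> v - sm (psi (Suc m) \<alpha>) v | \<alpha> v. \<alpha> \<in> cplx (mirabolic_rad F (Suc m))}"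
  let ?x = "lie_embed x"
  have xg: "x \<in> cplx (gl F m)" by (rule mirabolic_in_gl[OF x])
  interpret l: Vector_Spaces.linear sm sm "act M ?x"
    using mod lie_embed_in[OF xg] by (simp add: lie_module_def)
  have R': "V.subspace (V.span ?G)" by simp
  have G: "act M \<alpha> u - sm (psi (Suc m) \<alpha>) u \<in> V.span ?G"
    if "\<alpha> \<in> cplx (mirabolic_rad F (Suc m))" for \<alpha> u
    using that by (intro V.span_base) blast
  have "V.span ?G \<subseteq> {u. act M ?x u \<in> V.span ?G}"
  proof (rule V.span_minimal)
    show "V.subspace {u. act M ?x u \<in> V.span ?G}"
      by (auto simp: V.subspace_def l.zero l.add l.scale V.span_zero V.span_add V.span_scale)
    show "?G \<subseteq> {u. act M ?x u \<in> V.span ?G}"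
    proof (intro Un_least subsetI CollectI)
      fix u assume "u \<in> rels M"
      then show "act M ?x u \<in> V.span ?G"
        using stable[OF lie_embed_in_mirabolic[OF xg]] by (intro V.span_base) blast
    next
      fix u assume "u \<in> {act M \<alpha> v - sm (psi (Suc m) \<alpha>) v | \<alpha> v. \<alpha> \<in> cplx (mirabolic_rad F (Suc m))}"
      then obtain \<alpha> w where a: "\<alpha> \<in> cplx (mirabolic_rad F (Suc m))"
        and u: "u = act M \<alpha> w - sm (psi (Suc m) \<alpha>) w" by blast
      have br: "act M (lie_bracket ?x \<alpha>) w = act M ?x (act M \<alpha> w) - act M \<alpha> (act M ?x w)"
        using mod lie_embed_in[OF xg] mirabolic_rad_in_gl[OF a] by (simp add: lie_module_def)
      \<comment> \<open>Moving x past \<alpha> costs the bracket, which again lies in the radical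
        and has character value 0; so it is a relation as well.\<close>
      have "act M ?x u = (act M \<alpha> (act M ?x w) - sm (psi (Suc m) \<alpha>) (act M ?x w)) +
        (act M (lie_bracket ?x \<alpha>) w - sm (psi (Suc m) (lie_bracket ?x \<alpha>)) w)"
        unfolding u br bracket_embed_rad(2)[OF xg a \<open>m \<noteq> 0\<close> x] by (simp add: l.diff l.scale)
      also have "\<dots> \<in> V.span ?G"
        by (intro V.span_add G a bracket_embed_rad(1)[OF xg a])
      finally show "act M ?x u \<in> V.span ?G" .
    qed
  qed
  then have "act M ?x v \<in> V.span ?G" using v by (auto simp: Phi_def)
  then show ?thesis using v by (simp add: Phi_def V.span_add V.span_scale)
qed

end

section \<open>The iterates of \<Phi> in terms of the original operators\<close>

context gl_module
begin

abbreviation iter :: "nat \<Rightarrow> 'v quot_pres" where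
  "iter j \<equiv> Phi_iter F sm n j \<lparr>rels = {0}, act = \<rho>\<rparr>"

lemma lie_module_iter: "j \<le> n \<Longrightarrow> lie_module (cplx (gl F (n - j))) sm (act (iter j))"
proof (induction j)
  case 0
  then show ?case using lie_module by simp
next
  case (Suc j)
  then have "lie_module (cplx (gl F (Suc (n - Suc j)))) sm (act (iter j))"
    by (simp add: Suc_diff_Suc)
  from lie_module_Phi[OF this] show ?case by (simp add: Phi_def)
qed

lemma subspace_iter: "subspace (rels (iter j))"
  by (cases j) (auto simp: Phi_def)

lemma rels_iter_mono: "i \<le> j \<Longrightarrow> rels (iter i) \<subseteq> rels (iter j)"
proof (induction j rule: dec_induct)
  case (step j)
  have "rels (iter j) \<subseteq> rels (iter (Suc j))"
    unfolding Phi_iter.simps Phi_def using span_superset by fastforce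
  then show ?case using step by blast
qed simp

lemma iter_stable:
  assumes "j < n" and "x \<in> cplx (mirabolic F (n - j))" and "v \<in> rels (iter j)"
  shows "act (iter j) x v \<in> rels (iter j)"
  using assms
proof (induction j arbitrary: x v)
  case 0
  interpret l: Vector_Spaces.linear sm sm "\<rho> x" using 0 mirabolic_in_gl by (intro lin_rho) auto
  show ?case using 0 by (simp add: l.zero)
next
  case (Suc j)
  have eq: "n - j = Suc (n - Suc j)" using Suc.prems by simp
  show ?case unfolding Phi_iter.simps eq
  proof (rule Phi_stable)
    show "lie_module (cplx (gl F (Suc (n - Suc j)))) sm (act (iter j))"
      using lie_module_iter[of j] Suc.prems eq by simp
    show "act (iter j) y u \<in> rels (iter j)"
      if "y \<in> cplx (mirabolic F (Suc (n - Suc j)))" "u \<in> rels (iter j)" for y u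
      using Suc.IH[of y u] Suc.prems that eq by simp
    show "v \<in> rels (Phi F sm (Suc (n - Suc j)) (iter j))" using Suc.prems eq by simp
  qed (use Suc.prems subspace_iter in auto)
qed

lemma lie_embed_power:
  assumes "z \<in> cplx (gl F m)"
  shows "(lie_embed ^^ j) z =
    (mat (m + j) (m + j) (\<lambda>(a, b). if a < m \<and> b < m then fst z $$ (a, b) else 0),
     mat (m + j) (m + j) (\<lambda>(a, b). if a < m \<and> b < m then snd z $$ (a, b) else 0))"
proof (induction j)
  case 0
  show ?case using cplx_carrier[OF assms] by (cases z) (auto intro!: eq_matI)
next
  case (Suc j)
  let ?r = "\<lambda>l Z. mat (m + l) (m + l) (\<lambda>(a, b). if a < m \<and> b < m then Z $$ (a, b) else 0)"
  have "embed_mat (?r j Z) = ?r (Suc j) Z" for Z :: "complex mat"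
    by (subst embed_mat_eq[where m = "m + j"]) (auto intro!: eq_matI)
  moreover have "(lie_embed ^^ Suc j) z = (embed_mat (?r j (fst z)), embed_mat (?r j (snd z)))"
    using Suc by (simp add: embed_mat_def)
  ultimately show ?case by simp
qed

text \<open>Each twist adds a scalar that depends only on traces, so the accumulated twists
  disappear on traceless elements, in particular on all radicals.\<close>

lemma act_iter_traceless:
  assumes "j \<le> n" "z \<in> cplx (gl F (n - j))" "mat_trace (fst z) = 0" "mat_trace (snd z) = 0"
  shows "act (iter j) z v = \<rho> ((lie_embed ^^ j) z) v"
  using assms
proof (induction j arbitrary: z)
  case (Suc j)
  have eq: "n - j = Suc (n - Suc j)" using Suc.prems by simp
  have "act (iter (Suc j)) z v = act (iter j) (lie_embed z) v + sm (det_twist z) v"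
    by (simp add: Phi_def)
  also have "det_twist z = 0" using Suc.prems by (simp add: det_twist_def cplx_ext_def)
  also have "act (iter j) (lie_embed z) v = \<rho> ((lie_embed ^^ j) (lie_embed z)) v"
    using Suc.prems lie_embed_in[OF Suc.prems(2)] cplx_carrier[OF Suc.prems(2)] eq
    by (intro Suc.IH) (auto simp: lie_embed_eq embed_mat_smult(2) simp del: lie_embed.simps)
  finally show ?case by (simp add: funpow_swap1)
qed simp

lemma rad_traceless:
  assumes "z \<in> cplx (mirabolic_rad F m)"
  shows "mat_trace (fst z) = 0" "mat_trace (snd z) = 0"
proof -
  have "X $$ (i, i) = 0" if "X \<in> mirabolic_rad F m" "i < m" for X i
    using that by (cases "i = m - 1") (auto simp: mirabolic_rad_def mirabolic_def)
  then show "mat_trace (fst z) = 0" "mat_trace (snd z) = 0"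
    using assms cplx_carrier[OF mirabolic_rad_in_gl[OF assms]]
    by (auto simp: mat_trace_def cplx_def intro!: sum.neutral)
qed

text \<open>The character on a simple root vector of copy \<open>s\<close>. Only
  \<open>basis_re\<close> enters, since \<open>basis_im\<close> is purely imaginary and the
  character takes real parts of entries.\<close>

definition psi_value :: "bool \<Rightarrow> complex" where
  "psi_value s = \<i> * of_real (pi * basis_re s)"

lemma psi_value_nonzero: "F = \<real> \<longrightarrow> \<not> s \<Longrightarrow> psi_value s \<noteq> 0"
  by (simp add: psi_value_def basis_re_def)

lemma basis_elt_rad: "a < m \<Longrightarrow> basis_elt (Suc m) (s, a, m) \<in> cplx (mirabolic_rad F (Suc m))"
  using basis_elt_in[of "Suc m" "(s, a, m)"]
  by (auto simp: basis_elt_def cplx_def mirabolic_rad_def mirabolic_def)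

lemma psi_basis_elt:
  assumes "a < m"
  shows "psi (Suc m) (basis_elt (Suc m) (s, a, m)) = (if Suc a = m then psi_value s else 0)"
proof -
  have "Re (basis_im s) = 0" by (simp add: basis_im_def)
  then show ?thesis using assms
    by (auto simp: psi_def cplx_ext_def basis_elt_def psi_value_def)
qed

lemma act_iter_basis_elt:
  assumes "a < m" "m < n"
  shows "act (iter (n - Suc m)) (basis_elt (Suc m) (s, a, m)) v = T (s, a, m) v"
proof -
  have "act (iter (n - Suc m)) (basis_elt (Suc m) (s, a, m)) v =
      \<rho> ((lie_embed ^^ (n - Suc m)) (basis_elt (Suc m) (s, a, m))) v"
    using assms rad_traceless[OF basis_elt_rad[OF assms(1), of s]] by (intro act_iter_traceless) auto
  also have "(lie_embed ^^ (n - Suc m)) (basis_elt (Suc m) (s, a, m)) = basis_elt n (s, a, m)"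
    unfolding lie_embed_power[OF basis_elt_in] using assms
    by (auto simp: basis_elt_def intro!: eq_matI)
  finally show ?thesis by (simp add: T_def)
qed

text \<open>Column \<open>b\<close>, counted from 0, is the radical of the mirabolic of size
  \<open>b + 1\<close>; its character is imposed by the application of \<Phi> that leads from stage
  \<open>n - b - 1\<close> to stage \<open>n - b\<close>.\<close>

lemma character_relation:
  assumes "a < b" "b < n"
  shows "T (s, a, b) v - sm (if Suc a = b then psi_value s else 0) v \<in> rels (iter (n - b))"
proof -
  have eq: "n - b = Suc (n - Suc b)" "n - (n - Suc b) = Suc b" using assms by auto
  have "act (iter (n - Suc b)) (basis_elt (Suc b) (s, a, b)) v -
      sm (psi (Suc b) (basis_elt (Suc b) (s, a, b))) v \<in> rels (iter (n - b))"
    unfolding eq(1) Phi_iter.simps Phi_def eq(2) quot_pres.simps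
    by (intro span_base UnI2 CollectI exI[of _ "basis_elt (Suc b) (s, a, b)"] exI[of _ v] conjI
        basis_elt_rad[OF assms(1)] refl)
  then show ?thesis using assms by (simp add: act_iter_basis_elt psi_basis_elt)
qed

end

section \<open>Nilpotent action of the radical\<close>

lemma funpow_commute:
  assumes "\<And>v. f (g v) = g (f v)"
  shows "f ((g ^^ k) v) = (g ^^ k) (f v)"
  by (induction k) (auto simp: assms)

lemma foldr_commuting_count:
  assumes comm: "\<And>i j v. i \<in> J \<Longrightarrow> j \<in> J \<Longrightarrow> T i (T j v) = T j (T i v)"
    and "set ws \<subseteq> J" "i \<in> J"
  shows "foldr T ws v = (T i ^^ count_list ws i) (foldr T (removeAll i ws) v)"
  using assms(2)
proof (induction ws)
  case (Cons x ws)
  then show ?case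
    using funpow_commute[of "T x" "T i", OF comm] assms(3) by auto
qed simp

lemma ex_count_list_ge:
  assumes "finite J" "set ws \<subseteq> J" "length ws > card J * K"
  shows "\<exists>i\<in>J. count_list ws i \<ge> K"
proof (rule ccontr)
  assume "\<not> ?thesis"
  then have "sum (count_list ws) J \<le> (\<Sum>i\<in>J. K)" by (intro sum_mono) (auto simp: not_le less_imp_le)
  then show False using assms sum_count_set[OF assms(2,1)] by simp
qed

context gl_module
begin

definition rad_indices :: "nat \<Rightarrow> (bool \<times> nat \<times> nat) set" where
  "rad_indices b = UNIV \<times> {..<b} \<times> {b}"

lemma finite_rad_indices [simp]: "finite (rad_indices b)"
  by (simp add: rad_indices_def)

lemma rad_commute:
  assumes "i \<in> rad_indices b" "j \<in> rad_indices b"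
  shows "T i (T j v) = T j (T i v)"
proof -
  have "commutator (elem_mat n a b x) (elem_mat n c b y) = 0\<^sub>m n n" if "a < b" "c < b" for a c x y
    using that by (auto simp: commutator_def elem_mat_mult intro!: eq_matI)
  then have "lie_bracket (basis_elt n i) (basis_elt n j) = (0\<^sub>m n n, 0\<^sub>m n n)"
    using assms by (auto simp: rad_indices_def basis_elt_def intro!: eq_matI)
  then show ?thesis using rho_bracket[OF basis_elt_in basis_elt_in, of i j v] rho_0
    by (simp add: T_def)
qed

lemma act_iter_rad:
  assumes "b < n" and z: "z \<in> cplx (mirabolic_rad F (Suc b))"
  shows "\<exists>c. \<forall>v. act (iter (n - Suc b)) z v = (\<Sum>i\<in>rad_indices b. sm (c i) (T i v))"
proof -
  let ?z = "(lie_embed ^^ (n - Suc b)) z"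
  have zg: "z \<in> cplx (gl F (Suc b))" by (rule mirabolic_rad_in_gl[OF z])
  note power = lie_embed_power[OF zg, of "n - Suc b"]
  have "?z \<in> L"
    unfolding power using zg assms by (cases z) (auto simp: cplx_def gl_iff)
  have zero: "coord ?z i = 0" if "i \<in> U - rad_indices b" for i
  proof -
    obtain s p q where i: "i = (s, p, q)" "p < n" "q < n" "\<not> (p < b \<and> q = b)"
      using \<open>i \<in> U - rad_indices b\<close> by (cases i) (auto simp: rad_indices_def)
    have "fst z $$ (p, q) = 0 \<and> snd z $$ (p, q) = 0" if "p < Suc b" "q < Suc b"
    proof -
      have "p = Suc b - 1 \<or> q \<noteq> Suc b - 1" using i(4) that by auto
      moreover have "fst z \<in> mirabolic_rad F (Suc b)" "snd z \<in> mirabolic_rad F (Suc b)"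
        using z by (auto simp: cplx_def)
      ultimately show ?thesis unfolding mirabolic_rad_iff using that by blast
    qed
    then show ?thesis using i assms(1) by (auto simp: power coord_def)
  qed
  have "act (iter (n - Suc b)) z v = (\<Sum>i\<in>rad_indices b. sm (coord ?z i) (T i v))" for v
  proof -
    have "act (iter (n - Suc b)) z v = \<rho> ?z v"
      using assms zg rad_traceless[OF z] by (intro act_iter_traceless) auto
    also have "\<dots> = (\<Sum>i\<in>U. sm (coord ?z i) (T i v))" by (rule rho_expand[OF \<open>?z \<in> L\<close>])
    also have "\<dots> = (\<Sum>i\<in>rad_indices b. sm (coord ?z i) (T i v))"
      using zero assms(1) by (intro sum.mono_neutral_right) (auto simp: rad_indices_def)
    finally show ?thesis .
  qed
  then show ?thesis by blast
qed

text \<open>In a long word some letter is frequent, and commutativity lets its copies be applied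
  last. Their image then lies in the relations whatever the other letters do.\<close>

lemma rad_words_nilpotent:
  assumes depth: "depth F n sm \<rho> \<le> enat d" and d: "1 \<le> d" "d \<le> n"
  shows "\<exists>l. \<forall>ws v. set ws \<subseteq> rad_indices (n - d) \<and> length ws = l \<longrightarrow>
    foldr T ws v \<in> rels (iter (d - 1))"
proof -
  let ?R = "rels (iter (d - 1))" and ?J = "rad_indices (n - d)"
  have R: "subspace ?R" by (rule subspace_iter)
  have char: "T (s, a, b) v - sm (if Suc a = b then psi_value s else 0) v \<in> ?R"
    if "n - d < b" "b < n" "a < b" for s a b v
  proof -
    \<comment> \<open>The characters of the columns beyond \<open>n - d\<close> are those imposed by
      the first \<open>d - 1\<close> applications of \<Phi>.\<close>
    have "n - b \<le> d - 1" using that d by linarith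
    then show ?thesis using character_relation[OF that(3,2), of s v] rels_iter_mono by blast
  qed
  have "\<exists>k. \<forall>v. (T i ^^ k) v \<in> ?R" if "i \<in> ?J" for i
  proof -
    obtain s a where i: "i = (s, a, n - d)" "a < n - d" using \<open>i \<in> ?J\<close> by (auto simp: rad_indices_def)
    show ?thesis
    proof (cases "F = \<real> \<and> s")
      case True
      have "(T i ^^ 1) v = 0" for v using T_zero[of a "n - d" s v] True by (simp add: i)
      then show ?thesis using subspace_0[OF R] by metis
    next
      case False
      then have s: "F = \<real> \<longrightarrow> \<not> s" by blast
      show ?thesis unfolding i(1)
        by (rule root_vector_nilpotent[OF depth s d i(2) R char psi_value_nonzero[OF s]])
    qed
  qed
  then obtain k where k: "\<And>i v. i \<in> ?J \<Longrightarrow> (T i ^^ k i) v \<in> ?R" by metis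
  \<comment> \<open>A common upper bound for the exponents of the single root vectors.\<close>
  define K where "K = sum k ?J"
  have "foldr T ws v \<in> ?R" if ws: "set ws \<subseteq> ?J" "length ws = Suc (card ?J * K)" for ws v
  proof -
    obtain i where i: "i \<in> ?J" "count_list ws i \<ge> K"
      using ex_count_list_ge[of ?J ws K] ws by auto
    have "k i \<le> K" unfolding K_def using i by (intro member_le_sum) auto
    then obtain r where r: "count_list ws i = k i + r" using i(2) le_Suc_ex[of "k i" "count_list ws i"] by auto
    have "foldr T ws v = (T i ^^ count_list ws i) (foldr T (removeAll i ws) v)"
      by (rule foldr_commuting_count[of ?J T ws i v, OF rad_commute ws(1) i(1)])
    also have "\<dots> = (T i ^^ k i) ((T i ^^ r) (foldr T (removeAll i ws) v))"
      by (simp add: r funpow_add)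
    finally have "foldr T ws v = (T i ^^ k i) ((T i ^^ r) (foldr T (removeAll i ws) v))" .
    then show ?thesis using k[OF i(1)] by simp
  qed
  then show ?thesis by blast
qed

text \<open>Multilinearity passes from words in root vectors to arbitrary elements of the
  radical.\<close>

lemma rad_tensor_nilpotent:
  assumes depth: "depth F n sm \<rho> \<le> enat d" and d: "1 \<le> d" "d \<le> n"
  shows "\<exists>l. \<forall>\<beta> v. set \<beta> \<subseteq> cplx (mirabolic_rad F (Suc (n - d))) \<and> length \<beta> = l \<longrightarrow>
    foldr (act (iter (d - 1))) \<beta> v \<in> rels (iter (d - 1))"
proof -
  let ?A = "act (iter (d - 1))" and ?J = "rad_indices (n - d)"
  define G where "G l = {foldr T ws v | ws v. set ws \<subseteq> ?J \<and> length ws = l}" for l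
  obtain l where l: "G l \<subseteq> rels (iter (d - 1))"
    using rad_words_nilpotent[OF assms] unfolding G_def by blast
  have b: "n - d < n" "n - Suc (n - d) = d - 1" using d by auto
  have T_span: "T i u \<in> span (G (Suc l))" if "i \<in> ?J" "u \<in> span (G l)" for i u l
  proof -
    interpret Ti: Vector_Spaces.linear sm sm "T i" by (rule lin)
    have "span (G l) \<subseteq> {u. T i u \<in> span (G (Suc l))}"
    proof (rule span_minimal)
      show "subspace {u. T i u \<in> span (G (Suc l))}"
        by (auto simp: subspace_def Ti.zero Ti.add Ti.scale span_zero span_add span_scale)
      have "T i (foldr T ws v) \<in> G (Suc l)" if "set ws \<subseteq> ?J" "length ws = l" for ws v
        unfolding G_def using that \<open>i \<in> ?J\<close>
        by (intro CollectI exI[of _ "i # ws"] exI[of _ v]) auto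
      then show "G l \<subseteq> {u. T i u \<in> span (G (Suc l))}" by (auto simp: G_def[of l] intro: span_base)
    qed
    then show ?thesis using that by blast
  qed
  have "foldr ?A \<beta> v \<in> span (G (length \<beta>))" if "set \<beta> \<subseteq> cplx (mirabolic_rad F (Suc (n - d)))" for \<beta> v
    using that
  proof (induction \<beta>)
    case Nil
    have "v \<in> G 0" unfolding G_def by auto
    then show ?case by (simp add: span_base)
  next
    case (Cons z \<beta>)
    obtain c where "\<And>v. ?A z v = (\<Sum>i\<in>?J. sm (c i) (T i v))"
      using act_iter_rad[OF b(1), of z] Cons.prems b(2) by auto
    then show ?case using Cons by (auto intro!: span_sum span_scale T_span)
  qed
  moreover have "span (G l) \<subseteq> rels (iter (d - 1))" by (rule span_minimal[OF l subspace_iter])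
  ultimately show ?thesis by (intro exI[of _ l]) blast
qed

end

section \<open>Quotient modules\<close>

context vector_space
begin

lemma coset_mem_iff: "w \<in> coset N v \<longleftrightarrow> w - v \<in> N"
proof
  assume "w - v \<in> N"
  then show "w \<in> coset N v" unfolding coset_def by (intro image_eqI[of _ _ "w - v"]) auto
qed (auto simp: coset_def)

lemma coset_eq_iff:
  assumes "subspace N"
  shows "coset N u = coset N v \<longleftrightarrow> u - v \<in> N"
proof
  assume "coset N u = coset N v"
  moreover have "u \<in> coset N u" using subspace_0[OF assms] by (simp add: coset_mem_iff)
  ultimately show "u - v \<in> N" by (simp add: coset_mem_iff)
next
  have sub: "coset N u \<subseteq> coset N v" if "u - v \<in> N" for u v
    using subspace_add[OF assms that] by (fastforce simp: coset_mem_iff)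
  assume "u - v \<in> N"
  then show "coset N u = coset N v"
    using sub[of u v] sub[of v u] subspace_neg[OF assms, of "u - v"] by auto
qed

text \<open>The operations of \<open>quot_module\<close> are unions over representatives;
  compatibility of \<open>h\<close> collapses such a union to one coset.\<close>

lemma UN_coset:
  assumes R: "subspace R" and N: "subspace N" and "\<And>a. a - v \<in> R \<Longrightarrow> h a - h v \<in> N"
  shows "(\<Union>a\<in>coset R v. coset N (h a)) = coset N (h v)"
proof -
  have "coset N (h a) = coset N (h v)" if "a \<in> coset R v" for a
    using that assms by (simp add: coset_eq_iff coset_mem_iff)
  moreover have "v \<in> coset R v" using subspace_0[OF R] by (simp add: coset_mem_iff)
  ultimately show ?thesis by blast
qed

lemma coset_UNIV [simp]: "coset UNIV v = UNIV"
  by (auto simp: coset_mem_iff)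

end

locale quotient_presentation = vector_space sm for sm :: "complex \<Rightarrow> 'v::ab_group_add \<Rightarrow> 'v" +
  fixes M :: "'v quot_pres" and L :: "lie set"
  assumes sub: "subspace (rels M)"
    and act_diff: "x \<in> L \<Longrightarrow> act M x (u - v) = act M x u - act M x v"
    and stable: "x \<in> L \<Longrightarrow> v \<in> rels M \<Longrightarrow> act M x v \<in> rels M"
begin

abbreviation Q where "Q \<equiv> quot_module sm M"

lemma quot_module_simps:
  "mcarrier Q = range (coset (rels M))" "mzero Q = rels M"
  "madd Q (coset (rels M) u) (coset (rels M) v) = coset (rels M) (u + v)"
  "msmult Q c (coset (rels M) v) = coset (rels M) (sm c v)"
  "x \<in> L \<Longrightarrow> mact Q x (coset (rels M) v) = coset (rels M) (act M x v)"
proof -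
  have "(\<Union>b\<in>coset (rels M) v. coset (rels M) (a + b)) = coset (rels M) (a + v)" for a
    by (rule UN_coset[OF sub sub]) simp
  moreover have "(\<Union>a\<in>coset (rels M) u. coset (rels M) (a + v)) = coset (rels M) (u + v)"
    by (rule UN_coset[OF sub sub]) simp
  ultimately show "madd Q (coset (rels M) u) (coset (rels M) v) = coset (rels M) (u + v)"
    by (simp add: quot_module_def)
  have "sm c a - sm c v \<in> rels M" if "a - v \<in> rels M" for a
    using subspace_scale[OF sub that, of c] by (simp add: scale_right_diff_distrib)
  then show "msmult Q c (coset (rels M) v) = coset (rels M) (sm c v)"
    by (simp add: quot_module_def UN_coset[OF sub sub, where h = "sm c"])
  show "mact Q x (coset (rels M) v) = coset (rels M) (act M x v)" if x: "x \<in> L"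
  proof -
    have "act M x a - act M x v \<in> rels M" if "a - v \<in> rels M" for a
      using stable[OF x that] by (simp add: act_diff[OF x])
    then show ?thesis
      by (simp add: quot_module_def UN_coset[OF sub sub, where h = "act M x"])
  qed
qed (simp_all add: quot_module_def)

end

section \<open>The levels of \<Psi> and a stationary projective limit\<close>

lemma Psi_level_simps:
  "rels (Psi_level F sm m M l) = module.span sm (rels M \<union>
     {foldr (act M) \<beta> v | \<beta> v. length \<beta> = l \<and> set \<beta> \<subseteq> cplx (mirabolic_rad F m)})"
  "act (Psi_level F sm m M l) x v = act M (lie_embed x) v"
  by (auto simp: Psi_level_def restrict_gl_def)

text \<open>The embedded general linear Lie algebra normalises the radical. Passing x through a
  tensor replaces one factor by a bracket in the radical, so the number of factors stays the
  same.\<close>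

lemma (in ground_field) Psi_level_stable:
  assumes mod: "lie_module (cplx (gl F (Suc m))) sm (act M)"
    and stable: "\<And>v. v \<in> rels M \<Longrightarrow> act M (lie_embed x) v \<in> rels M"
    and x: "x \<in> cplx (gl F m)" and v: "v \<in> rels (Psi_level F sm (Suc m) M l)"
  shows "act M (lie_embed x) v \<in> rels (Psi_level F sm (Suc m) M l)"
proof -
  interpret V: vector_space sm using mod by (simp add: lie_module_def)
  let ?A = "act M" and ?x = "lie_embed x"
  define G where "G l = {foldr ?A \<beta> v | \<beta> v. length \<beta> = l \<and> set \<beta> \<subseteq> cplx (mirabolic_rad F (Suc m))}" for l
  have lin: "Vector_Spaces.linear sm sm (?A y)" if "y \<in> cplx (gl F (Suc m))" for y
    using mod that by (simp add: lie_module_def)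
  interpret l: Vector_Spaces.linear sm sm "?A ?x" by (rule lin[OF lie_embed_in[OF x]])
  have rad_span: "?A b u \<in> V.span (G (Suc l))"
    if b: "b \<in> cplx (mirabolic_rad F (Suc m))" and u: "u \<in> V.span (G l)" for b u l
  proof -
    interpret b: Vector_Spaces.linear sm sm "?A b" by (rule lin[OF mirabolic_rad_in_gl[OF b]])
    have "V.span (G l) \<subseteq> {u. ?A b u \<in> V.span (G (Suc l))}"
    proof (rule V.span_minimal)
      show "V.subspace {u. ?A b u \<in> V.span (G (Suc l))}"
        by (auto simp: V.subspace_def b.zero b.add b.scale V.span_zero V.span_add V.span_scale)
      have "?A b (foldr ?A \<beta> v) \<in> G (Suc l)"
        if "length \<beta> = l" "set \<beta> \<subseteq> cplx (mirabolic_rad F (Suc m))" for \<beta> v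
        unfolding G_def using that b by (intro CollectI exI[of _ "b # \<beta>"] exI[of _ v]) auto
      then show "G l \<subseteq> {u. ?A b u \<in> V.span (G (Suc l))}"
        by (auto simp: G_def[of l] intro: V.span_base)
    qed
    then show ?thesis using u by blast
  qed
  have word: "?A ?x (foldr ?A \<beta> v) \<in> V.span (G (length \<beta>))"
    if "set \<beta> \<subseteq> cplx (mirabolic_rad F (Suc m))" for \<beta> v
    using that
  proof (induction \<beta>)
    case Nil
    have "?A ?x v \<in> G 0" unfolding G_def by auto
    then show ?case by (simp add: V.span_base)
  next
    case (Cons b \<beta>)
    let ?u = "foldr ?A \<beta> v"
    have b: "b \<in> cplx (mirabolic_rad F (Suc m))" using Cons.prems by auto
    have "?A (lie_bracket ?x b) ?u = ?A ?x (?A b ?u) - ?A b (?A ?x ?u)"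
      using mod lie_embed_in[OF x] mirabolic_rad_in_gl[OF b] by (simp add: lie_module_def)
    then have "?A ?x (foldr ?A (b # \<beta>) v) = ?A (lie_bracket ?x b) ?u + ?A b (?A ?x ?u)" by simp
    moreover have "?u \<in> V.span (G (length \<beta>))"
      unfolding G_def using Cons.prems by (intro V.span_base) auto
    ultimately show ?case
      using Cons bracket_embed_rad(1)[OF x b] b by (auto intro!: V.span_add rad_span)
  qed
  have "V.span (rels M \<union> G l) \<subseteq> {u. ?A ?x u \<in> V.span (rels M \<union> G l)}"
  proof (rule V.span_minimal)
    show "V.subspace {u. ?A ?x u \<in> V.span (rels M \<union> G l)}"
      by (auto simp: V.subspace_def l.zero l.add l.scale V.span_zero V.span_add V.span_scale)
    show "rels M \<union> G l \<subseteq> {u. ?A ?x u \<in> V.span (rels M \<union> G l)}"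
    proof (intro Un_least subsetI CollectI)
      fix u assume "u \<in> rels M"
      then show "?A ?x u \<in> V.span (rels M \<union> G l)" using stable by (intro V.span_base) auto
    next
      fix u assume "u \<in> G l"
      then obtain \<beta> v where "u = foldr ?A \<beta> v" "length \<beta> = l" "set \<beta> \<subseteq> cplx (mirabolic_rad F (Suc m))"
        by (auto simp: G_def)
      then have "?A ?x u \<in> V.span (G l)" using word by auto
      then show "?A ?x u \<in> V.span (rels M \<union> G l)" using V.span_mono[of "G l" "rels M \<union> G l"] by auto
    qed
  qed
  then show ?thesis using v unfolding Psi_level_simps G_def by blast
qed

text \<open>By \<open>nil\<close> all levels from \<open>t\<close> on coincide with the module
  itself, so a compatible sequence is determined by its component at level \<open>t\<close>.\<close>

lemma (in ground_field) to_Psi_iso: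
  assumes mod: "lie_module (cplx (gl F (Suc m))) sm (act M)"
    and sub: "module.subspace sm (rels M)"
    and stable: "\<And>x v. x \<in> cplx (gl F m) \<Longrightarrow> v \<in> rels M \<Longrightarrow> act M (lie_embed x) v \<in> rels M"
    and nil: "\<And>\<beta> v. set \<beta> \<subseteq> cplx (mirabolic_rad F (Suc m)) \<Longrightarrow> length \<beta> = t \<Longrightarrow>
      foldr (act M) \<beta> v \<in> rels M"
  shows "lie_mod_iso (cplx (gl F m)) (quot_module sm (restrict_gl M)) (Psi F sm (Suc m) M)
    (to_Psi F sm (Suc m) M)"
proof -
  interpret V: vector_space sm using mod by (simp add: lie_module_def)
  let ?P = "\<lambda>l. Psi_level F sm (Suc m) M l" and ?L = "cplx (gl F m)" and ?f = "to_Psi F sm (Suc m) M"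
  let ?N = "\<lambda>l. rels (?P l)" and ?R = "rels M"
  have N: "V.subspace (?N l)" for l by (simp add: Psi_level_simps)
  have RN: "?R \<subseteq> ?N l" for l
    unfolding Psi_level_simps using V.span_superset by blast
  have N_Suc: "?N (Suc l) \<subseteq> ?N l" for l
    unfolding Psi_level_simps(1)[of _ _ _ _ "Suc l"]
  proof (rule V.span_minimal[OF _ N], intro Un_least subsetI)
    show "v \<in> ?N l" if "v \<in> ?R" for v using RN that by auto
    fix u assume "u \<in> {foldr (act M) \<beta> v |\<beta> v. length \<beta> = Suc l \<and> set \<beta> \<subseteq> cplx (mirabolic_rad F (Suc m))}"
    then obtain \<beta> v where u: "u = foldr (act M) \<beta> v" "length \<beta> = Suc l"
      "set \<beta> \<subseteq> cplx (mirabolic_rad F (Suc m))" by blast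
    then obtain \<beta>' b where \<beta>: "\<beta> = \<beta>' @ [b]" by (metis length_Suc_conv_rev)
    have "foldr (act M) \<beta>' (act M b v) \<in> ?N l"
      unfolding Psi_level_simps by (intro V.span_base UnI2 CollectI exI conjI refl) (use u \<beta> in auto)
    then show "u \<in> ?N l" using u \<beta> by simp
  qed
  have N_stab: "?N l = ?R" if "t \<le> l" for l
  proof
    have "foldr (act M) \<beta> v \<in> ?R" if "length \<beta> = l" "set \<beta> \<subseteq> cplx (mirabolic_rad F (Suc m))" for \<beta> v
    proof -
      \<comment> \<open>The first \<open>t\<close> factors of the list are applied last and already
        land in the relations.\<close>
      have "foldr (act M) \<beta> v = foldr (act M) (take t \<beta>) (foldr (act M) (drop t \<beta>) v)"
        by (metis append_take_drop_id foldr_append)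
      also have "\<dots> \<in> ?R"
        using that \<open>t \<le> l\<close> by (intro nil) (auto dest: in_set_takeD)
      finally show ?thesis .
    qed
    then show "?N l \<subseteq> ?R" unfolding Psi_level_simps by (intro V.span_minimal sub) auto
  qed (rule RN)
  have act_diff: "act M (lie_embed x) (u - v) = act M (lie_embed x) u - act M (lie_embed x) v"
    if "x \<in> ?L" for x u v
  proof -
    interpret l: Vector_Spaces.linear sm sm "act M (lie_embed x)"
      using mod lie_embed_in[OF that] by (simp add: lie_module_def)
    show ?thesis by (rule l.diff)
  qed
  have restrict: "rels (restrict_gl M) = ?R" "act (restrict_gl M) x v = act M (lie_embed x) v" for x v
    by (simp_all add: restrict_gl_def)
  have QR: "quotient_presentation sm (restrict_gl M) ?L"
    by unfold_locales (use sub act_diff stable in \<open>auto simp: restrict\<close>)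
  have QN: "quotient_presentation sm (?P l) ?L" for l
    by unfold_locales
      (use N act_diff Psi_level_stable[OF mod stable] in \<open>auto simp: Psi_level_simps(2)\<close>)
  note simpsR = quotient_presentation.quot_module_simps[OF QR, unfolded restrict]
  note simpsN = quotient_presentation.quot_module_simps[OF QN, unfolded Psi_level_simps(2)]
  have f: "?f (coset ?R v) = (\<lambda>l. coset (?N l) v)" for v
    unfolding to_Psi_def using RN by (intro ext V.UN_coset[OF sub N, where h = "\<lambda>a. a"]) auto
  have Psi: "mcarrier (Psi F sm (Suc m) M) =
      {a. (\<forall>l. a l \<in> range (coset (?N l))) \<and> (\<forall>l. a (Suc l) \<subseteq> a l)}"
    "madd (Psi F sm (Suc m) M) = (\<lambda>a b l. madd (quot_module sm (?P l)) (a l) (b l))"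
    "msmult (Psi F sm (Suc m) M) = (\<lambda>c a l. msmult (quot_module sm (?P l)) c (a l))"
    "mact (Psi F sm (Suc m) M) = (\<lambda>x a l. mact (quot_module sm (?P l)) x (a l))"
    by (simp_all add: Psi_def Let_def simpsN(1))
  have coset_mono: "coset A v \<subseteq> coset B v" if "A \<subseteq> B" for A B :: "'a set" and v
    using that by (auto simp: coset_def)
  have "bij_betw ?f (range (coset ?R)) (mcarrier (Psi F sm (Suc m) M))"
  proof (rule bij_betw_imageI[OF inj_onI])
    fix A B assume "A \<in> range (coset ?R)" "B \<in> range (coset ?R)" "?f A = ?f B"
    then obtain u v where "A = coset ?R u" "B = coset ?R v" "coset (?N t) u = coset (?N t) v"
      using f by (auto simp: fun_eq_iff)
    then show "A = B" using N_stab by simp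
  next
    show "?f ` range (coset ?R) = mcarrier (Psi F sm (Suc m) M)"
    proof (intro subset_antisym subsetI)
      fix a assume "a \<in> ?f ` range (coset ?R)"
      then show "a \<in> mcarrier (Psi F sm (Suc m) M)"
        unfolding Psi by (auto simp: f dest: subsetD[OF coset_mono[OF N_Suc]])
    next
      fix a assume "a \<in> mcarrier (Psi F sm (Suc m) M)"
      then have a: "\<And>l. a l \<in> range (coset (?N l))" "\<And>l. a (Suc l) \<subseteq> a l" by (auto simp: Psi)
      have anti: "a l' \<subseteq> a l" if "l \<le> l'" for l l' using that a(2) by (rule lift_Suc_antimono_le[rotated])
      obtain v where v: "a t = coset (?N t) v" using a(1) by blast
      have "a l = coset (?N l) v" for l
      proof -
        \<comment> \<open>At a level beyond both \<open>l\<close> and \<open>t\<close> one vector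
          represents the two components at once.\<close>
        define k where "k = max l t"
        obtain w where w: "a k = coset (?N k) w" using a(1) by blast
        then have "w \<in> a k" using V.subspace_0[OF N] by (simp add: V.coset_mem_iff)
        then have wl: "w \<in> a l" "w \<in> a t" using anti[of l k] anti[of t k] by (auto simp: k_def)
        have "w - v \<in> ?R" using wl(2) v N_stab[of t] by (simp add: V.coset_mem_iff)
        obtain u where u: "a l = coset (?N l) u" using a(1) by blast
        then have "w - u \<in> ?N l" using wl(1) by (simp add: V.coset_mem_iff)
        then have "coset (?N l) w = coset (?N l) u" by (simp add: V.coset_eq_iff N)
        moreover have "coset (?N l) w = coset (?N l) v"
          using \<open>w - v \<in> ?R\<close> RN by (auto simp: V.coset_eq_iff N)
        ultimately show ?thesis using u by simp
      qed
      then have "a = ?f (coset ?R v)" by (auto simp: f)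
      then show "a \<in> ?f ` range (coset ?R)" by blast
    qed
  qed
  then show ?thesis unfolding lie_mod_iso_def simpsR(1)
    by (auto simp: simpsR f Psi(2,3,4) simpsN)
qed

section \<open>Depth and derivatives\<close>

context gl_module
begin

lemma rels_next_derivative_UNIV:
  assumes depth: "depth F n sm \<rho> \<le> enat d" and d: "1 \<le> d" "d < n"
  shows "rels (iter d) = UNIV"
proof -
  \<comment> \<open>The simple root vector of column \<open>n - d\<close>, which exists because
    \<open>d < n\<close>. Its copy \<open>False\<close> has a nonzero character value over either
    field.\<close>
  let ?b = "n - d" and ?i = "(False, n - d - 1, n - d)" and ?c = "psi_value False"
  have R: "subspace (rels (iter d))" by (rule subspace_iter)
  obtain l where l: "\<And>ws v. set ws \<subseteq> rad_indices ?b \<Longrightarrow> length ws = l \<Longrightarrow>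
      foldr T ws v \<in> rels (iter (d - 1))"
    using rad_words_nilpotent[OF depth d(1)] d(2) by auto
  have step: "T ?i v - sm ?c v \<in> rels (iter d)" for v
  proof -
    have "n - d - 1 < n - d" "n - d < n" "Suc (n - d - 1) = n - d" "n - (n - d) = d" using d by auto
    then show ?thesis using character_relation[of "n - d - 1" "n - d" False v] by simp
  qed
  have pow: "(T ?i ^^ k) v - sm (?c ^ k) v \<in> rels (iter d)" for k v
  proof (induction k)
    case 0
    then show ?case using subspace_0[OF R] by simp
  next
    case (Suc k)
    have "(T ?i ^^ Suc k) v - sm (?c ^ Suc k) v =
      (T ?i ((T ?i ^^ k) v) - sm ?c ((T ?i ^^ k) v)) + sm ?c ((T ?i ^^ k) v - sm (?c ^ k) v)"
      by (simp add: scale_right_diff_distrib)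
    also have "\<dots> \<in> rels (iter d)"
      by (intro subspace_add[OF R] step subspace_scale[OF R] Suc)
    finally show ?case .
  qed
  have "v \<in> rels (iter d)" for v
  proof -
    have "foldr T (replicate l ?i) v \<in> rels (iter (d - 1))"
      using d by (intro l) (auto simp: rad_indices_def)
    then have "(T ?i ^^ l) v \<in> rels (iter d)"
      using rels_iter_mono[of "d - 1" d] by (auto simp: foldr_replicate)
    then have "sm (?c ^ l) v \<in> rels (iter d)"
      using subspace_diff[OF R _ pow[of l v]] by fastforce
    then have "sm (inverse (?c ^ l)) (sm (?c ^ l) v) \<in> rels (iter d)"
      by (rule subspace_scale[OF R])
    then show ?thesis using psi_value_nonzero[of False] by simp
  qed
  then show ?thesis by blast
qed

lemma E_der_to_D_der_iso:
  assumes depth: "depth F n sm \<rho> \<le> enat d" and d: "1 \<le> d" "d \<le> n"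
  shows "lie_mod_iso (cplx (gl F (n - d))) (E_der_gl F n d sm \<rho>) (D_der F n d sm \<rho>) (E_to_D F n d sm \<rho>)"
proof -
  have eq: "n - (d - 1) = Suc (n - d)" "n - d + 1 = Suc (n - d)" using d by auto
  obtain l where "\<And>\<beta> v. set \<beta> \<subseteq> cplx (mirabolic_rad F (Suc (n - d))) \<Longrightarrow> length \<beta> = l \<Longrightarrow>
      foldr (act (iter (d - 1))) \<beta> v \<in> rels (iter (d - 1))"
    using rad_tensor_nilpotent[OF assms] by blast
  then show ?thesis
    unfolding E_der_gl_def D_der_def E_to_D_def E_pres_def eq(2)
    using lie_module_iter[of "d - 1"] iter_stable[of "d - 1"] lie_embed_in_mirabolic d eq(1)
    by (intro to_Psi_iso[where t = l] subspace_iter) auto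
qed

lemma next_derivatives_zero:
  assumes "depth F n sm \<rho> \<le> enat d" and "1 \<le> d" "d < n"
  shows "zero_module (E_der F n (d + 1) sm \<rho>)" "zero_module (D_der F n (d + 1) sm \<rho>)"
    "zero_module (B_der F n (d + 1) sm \<rho>)"
proof -
  have R: "rels (E_pres F n (d + 1) sm \<rho>) = UNIV"
    using rels_next_derivative_UNIV[OF assms] by (simp add: E_pres_def)
  have q: "mcarrier (quot_module sm M) = {UNIV}" "mzero (quot_module sm M) = UNIV"
    if "rels M = UNIV" for M :: "'v quot_pres"
    using that by (auto simp: quot_module_def)
  have span: "span (UNIV \<union> A) = UNIV" for A by (metis Un_UNIV_left span_UNIV)
  have B: "rels (Psi0 F sm m (E_pres F n (d + 1) sm \<rho>)) = UNIV"
    and D: "rels (Psi_level F sm m (E_pres F n (d + 1) sm \<rho>) l) = UNIV" for m l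
    by (simp_all add: Psi0_def Psi_level_def restrict_gl_def R[simplified] span)
  show "zero_module (E_der F n (d + 1) sm \<rho>)"
    unfolding zero_module_def E_der_def q[OF R] ..
  show "zero_module (B_der F n (d + 1) sm \<rho>)"
    unfolding zero_module_def B_der_def q[OF B] ..
  show "zero_module (D_der F n (d + 1) sm \<rho>)"
    unfolding zero_module_def D_der_def Psi_def Let_def lie_mod.simps q[OF D]
    by (auto simp: fun_eq_iff)
qed

end

theorem corollary3p0p7:
  fixes F :: "complex set"
    and n d :: nat
    and K :: "complex mat set"
    and sm :: "complex \<Rightarrow> 'v::ab_group_add \<Rightarrow> 'v"
    and \<rho> :: "lie \<Rightarrow> 'v \<Rightarrow> 'v"
    and \<kappa> :: "complex mat \<Rightarrow> 'v \<Rightarrow> 'v"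
  assumes "F = \<real> \<or> F = UNIV"
    and "1 \<le> d" and "d \<le> n"
    and "maximal_compact_subgroup F n K"
    and "harish_chandra_module F n K sm \<rho> \<kappa>"
    and "depth F n sm \<rho> \<le> enat d"
  shows "lie_mod_iso (cplx (gl F (n - d)))
           (E_der_gl F n d sm \<rho>) (D_der F n d sm \<rho>) (E_to_D F n d sm \<rho>) \<and>
         (d + 1 \<le> n \<longrightarrow>
            zero_module (E_der F n (d + 1) sm \<rho>) \<and>
            zero_module (D_der F n (d + 1) sm \<rho>) \<and>
            zero_module (B_der F n (d + 1) sm \<rho>))"
proof -
  interpret gl_module F n sm \<rho>
    using assms(1,5) by unfold_locales (auto simp: harish_chandra_module_def gK_module_def)
  show ?thesis
    using E_der_to_D_der_iso[OF assms(6,2,3)] next_derivatives_zero[OF assms(6,2)] by simp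
qed

end
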